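(* Let $(\mathcal{A},\Omega,\Sigma,\mathrm{L}(\mathcal{C}),\mathrm{R}(\mathcal{C}),\mathcal{X})$ be a partial triangulated category. Then the subfactor $\mathcal{C}/\mathcal{X}$ is a triangulated category, and the two triangulated structures on $\mathcal{C}/\mathcal{X}$, namely $(\Omega_{\mathcal{X}},\nabla_{\mathcal{X}})$ induced by $\mathrm{L}(\mathcal{C})$ and $(\Sigma^{\mathcal{X}},\Delta^{\mathcal{X}})$ induced by $\mathrm{R}(\mathcal{C})$, are the same.
   Context: Conventions: all subcategories of additive categories are full and closed under isomorphisms; all functors between additive categories are additive. Stable category: for an additive subcategory $\mathcal{X}$ of an additive category $\mathcal{C}$, $\mathcal{C}/\mathcal{X}$ has the objects of $\mathcal{C}$, and its morphisms are classes $\underline{f}$ of morphisms of $\mathcal{C}$, where $f,f'$ are identified iff $f-f'$ factors through an object of $\mathcal{X}$. Basic notions: let $\mathcal{A}$ be an additive category with an additive endofunctor $\Sigma$, and let $\mathcal{X}\subseteq\mathcal{C}$ be additive subcategories. A morphism $f:A\to B$ is $\mathcal{X}$-monic if $\mathrm{Hom}(B,X)\to\mathrm{Hom}(A,X)$ is surjective for all $X\in\mathcal{X}$, and $\mathcal{X}$-epic if $\mathrm{Hom}(X,A)\to\mathrm{Hom}(X,B)$ is surjective for all $X\in\mathcal{X}$. An $\mathcal{X}$-preenvelope is an $\mathcal{X}$-monic $A\to X$ with $X\in\mathcal{X}$; an $\mathcal{X}$-precover is an $\mathcal{X}$-epic $X\to A$ with $X\in\mathcal{X}$. A right $\Sigma$-sequence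 is a sequence $A\xrightarrow{f}B\xrightarrow{g}C\xrightarrow{h}\Sigma(A)$; a morphism of such sequences is a triple $(\alpha,\beta,\gamma)$ such that $(\alpha,\beta,\gamma,\Sigma(\alpha))$ makes all squares commute. It is a right $\mathcal{C}$-sequence if $C\in\mathcal{C}$, $g$ is a weak cokernel of $f$ (i.e. $\mathrm{Hom}(C,Z)\to\mathrm{Hom}(B,Z)\to\mathrm{Hom}(A,Z)$ is exact for all $Z\in\mathcal{A}$) and $h$ is a weak cokernel of $g$. "$f:A\to B$ an $\mathcal{X}$-monic (or preenvelope) in $\mathcal{C}$" means in addition that $A,B\in\mathcal{C}$. Partial right triangulated category $(\mathcal{A},\Sigma,\mathrm{R}(\mathcal{C}),\mathcal{X})$: $\mathrm{R}(\mathcal{C})$ is a class of right $\mathcal{C}$-sequences (called right $\mathcal{C}$-triangles), closed under isomorphisms and finite direct sums, such that: (PRT1)(i) for each $A\in\mathcal{C}$ there is a right $\mathcal{C}$-triangle $A\xrightarrow{i}X\to U\to\Sigma(A)$ with $i$ an $\mathcal{X}$-preenvelope; (ii) for each $f:A\to B$ in $\mathcal{C}$, $A\xrightarrow{\binom{1}{f}}A\oplus B\xrightarrow{(f,-1)}B\xrightarrow{0}\Sigma(A)$ is in $\mathrm{R}(\mathcal{C})$; (iii) if $A\xrightarrow{i}X\to U\to\Sigma(A)$ is in $\mathrm{R}(\mathcal{C})$ with $i$ an $\mathcal{X}$-preenvelope in $\mathcal{C}$, then for any $f:A\to B$ in $\mathcal{C}$ there is a right $\mathcal{C}$-triangle $A\xrightarrow{\binom{i}{f}}X\oplus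 B\to N\to\Sigma(A)$. (PRT2) for any morphism $(\alpha,\beta,\gamma)$ of right $\mathcal{C}$-triangles from $A\xrightarrow{f}B\to C\to\Sigma(A)$ to $A'\to X\xrightarrow{s}U\to\Sigma(A')$ with $X\in\mathcal{X}$, if $\alpha$ factors through $f$ then $\gamma$ factors through $s$. (PRT3) given two sequences $A\xrightarrow{f}B\to C\to\Sigma(A)$ and $A'\xrightarrow{f'}B'\to C'\to\Sigma(A')$ in $\mathrm{R}(\mathcal{C})$ and $\alpha:A\to A'$, $\beta:B\to B'$ with $\beta f=f'\alpha$, there is $\gamma:C\to C'$ such that $(\alpha,\beta,\gamma)$ is a morphism of right $\Sigma$-sequences. (PRT4) if $A\xrightarrow{f}B\xrightarrow{l}C'\xrightarrow{a}\Sigma(A)$, $B\xrightarrow{g}C\xrightarrow{h}A'\xrightarrow{j}\Sigma(B)$ and $A\xrightarrow{gf}C\xrightarrow{k}B'\xrightarrow{b}\Sigma(A)$ are in $\mathrm{R}(\mathcal{C})$ with $f,g$ $\mathcal{X}$-monics in $\mathcal{C}$, then there are $r:C'\to B'$ and $s:B'\to A'$ with $rl=kg$, $br=a$, $sk=h$, $js=\Sigma(f)b$, such that $C'\xrightarrow{r}B'\xrightarrow{s}A'\xrightarrow{\Sigma(l)j}\Sigma(C')$ is in $\mathrm{R}(\mathcal{C})$ and $r$ is $\mathcal{X}$-monic. Partial left triangulated category (dual notion): $(\mathcal{A},\Omega,\mathrm{L}(\mathcal{C}),\mathcal{X})$, with $\mathrm{L}(\mathcal{C})$ a class of sequences $\Omega(B)\to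 K\to A\to B$ with $K\in\mathcal{C}$ (called left $\mathcal{C}$-triangles), is a partial left triangulated category iff $(\mathcal{A}^{op},\Omega^{op},\mathrm{L}(\mathcal{C})^{op},\mathcal{X}^{op})$, obtained by reversing all arrows, is a partial right triangulated category. Fixed triangles: in a partial right triangulated category, for each $A\in\mathcal{C}$ a right $\mathcal{C}$-triangle $A\xrightarrow{i^A}X^A\xrightarrow{p^A}U^A\xrightarrow{q^A}\Sigma(A)$ with $i^A$ an $\mathcal{X}$-preenvelope is fixed. In a partial left triangulated category, for each $A\in\mathcal{C}$ a left $\mathcal{C}$-triangle $\Omega(A)\xrightarrow{\nu_A}K_A\xrightarrow{\iota_A}X_A\xrightarrow{\pi_A}A$ with $\pi_A$ an $\mathcal{X}$-precover is fixed. Induced structure $(\Sigma^{\mathcal{X}},\Delta^{\mathcal{X}})$: $\Sigma^{\mathcal{X}}(A)=U^A$, and for $f:A\to B$ in $\mathcal{C}$, $\Sigma^{\mathcal{X}}(\underline{f})=\underline{\kappa}^f$ where $(f,\sigma^f,\kappa^f)$ is any morphism from the fixed right $\mathcal{C}$-triangle of $A$ to that of $B$. For a right $\mathcal{C}$-triangle $A\xrightarrow{f}B\xrightarrow{g}C\xrightarrow{h}\Sigma(A)$ with $f$ an $\mathcal{X}$-monic in $\mathcal{C}$, choose a morphism $(1_A,\delta^f,\xi(f,g))$ from it to the fixed right $\mathcal{C}$-triangle of $A$ ($\underline{\xi}(f,g)$ is uniquely determined); $A\xrightarrow{\underline{f}}B\xrightarrow{\underline{g}}C\xrightarrow{\underline{\xi}(f,g)}\Sigma^{\mathcal{X}}(A)$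 is a standard right triangle, and $\Delta^{\mathcal{X}}$ is the class of right $\Sigma^{\mathcal{X}}$-sequences in $\mathcal{C}/\mathcal{X}$ isomorphic to standard right triangles. The structure $(\Omega_{\mathcal{X}},\nabla_{\mathcal{X}})$ with $\Omega_{\mathcal{X}}(A)=K_A$ is obtained from $\mathrm{L}(\mathcal{C})$ by the dual construction: for $f:A\to B$ in $\mathcal{C}$, $\Omega_{\mathcal{X}}(\underline{f})=\underline{\kappa}_f$ where $\kappa_f:K_A\to K_B$ and $\sigma_f:X_A\to X_B$ are any morphisms such that $(\Omega(f),\kappa_f,\sigma_f,f)$ is a commutative diagram from the fixed left $\mathcal{C}$-triangle of $A$ to that of $B$; for a left $\mathcal{C}$-triangle $\Omega(C)\to A\xrightarrow{f}B\xrightarrow{g}C$ with $g$ an $\mathcal{X}$-epic and $B,C\in\mathcal{C}$, choose $\xi:K_C\to A$ and $\delta:X_C\to B$ such that $(1_{\Omega(C)},\xi,\delta,1_C)$ is a commutative diagram from the fixed left $\mathcal{C}$-triangle of $C$ to it ($\underline{\xi}$ is uniquely determined); $\Omega_{\mathcal{X}}(C)\xrightarrow{\underline{\xi}}A\xrightarrow{\underline{f}}B\xrightarrow{\underline{g}}C$ is a standard left triangle, and $\nabla_{\mathcal{X}}$ is the class of sequences $\Omega_{\mathcal{X}}(C)\to A\to B\to C$ in $\mathcal{C}/\mathcal{X}$ isomorphic to standard left triangles. Partial triangulated category $(\mathcal{A},\Omega,\Sigma,\mathrm{L}(\mathcal{C}),\mathrm{R}(\mathcal{C}),\mathcal{X})$: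 $(\mathcal{A},\Omega,\mathrm{L}(\mathcal{C}),\mathcal{X})$ is a partial left triangulated category, $(\mathcal{A},\Sigma,\mathrm{R}(\mathcal{C}),\mathcal{X})$ is a partial right triangulated category, and: (a) $(\Omega,\Sigma)$ is an adjoint pair with adjunction isomorphism $\psi_{C,A}:\mathrm{Hom}(\Omega(C),A)\to\mathrm{Hom}(C,\Sigma(A))$; (b) if $\Omega(C)\xrightarrow{u}A\xrightarrow{v}B\xrightarrow{w}C$ is in $\mathrm{L}(\mathcal{C})$ with $B,C\in\mathcal{C}$, then $A\xrightarrow{v}B\xrightarrow{w}C\xrightarrow{-\psi_{C,A}(u)}\Sigma(A)$ is in $\mathrm{R}(\mathcal{C})$; conversely, if $A\xrightarrow{f}B\xrightarrow{g}C\xrightarrow{h}\Sigma(A)$ is in $\mathrm{R}(\mathcal{C})$ with $A,B\in\mathcal{C}$, then $\Omega(C)\xrightarrow{-\psi_{C,A}^{-1}(h)}A\xrightarrow{f}B\xrightarrow{g}C$ is in $\mathrm{L}(\mathcal{C})$; (c) for each $A\in\mathcal{C}$, $p^A$ is an $\mathcal{X}$-precover and $\iota_A$ is an $\mathcal{X}$-preenvelope (in the fixed triangles). Meaning of "the same": there is an adjunction making $(\Sigma^{\mathcal{X}},\Omega_{\mathcal{X}})$ an adjoint pair of mutually quasi-inverse equivalences of $\mathcal{C}/\mathcal{X}$, with unit isomorphisms $\epsilon_A:A\to\Omega_{\mathcal{X}}\Sigma^{\mathcal{X}}(A)$, under which $\Delta^{\mathcal{X}}=\nabla_{\mathcal{X}}$: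 a sequence $A\xrightarrow{f}B\xrightarrow{g}C\xrightarrow{h}\Sigma^{\mathcal{X}}(A)$ lies in $\Delta^{\mathcal{X}}$ iff $\Omega_{\mathcal{X}}\Sigma^{\mathcal{X}}(A)\xrightarrow{f\epsilon_A^{-1}}B\xrightarrow{g}C\xrightarrow{h}\Sigma^{\mathcal{X}}(A)$ lies in $\nabla_{\mathcal{X}}$. *)

theory Defs
  imports "HOL-Algebra.Group"
begin

section \<open>Additive categories\<close>

text \<open>Composition is written in the usual order: \<open>g \<cdot> f\<close> is first \<open>f\<close>, then \<open>g\<close>.
  The operations are only meaningful on composable resp. parallel morphisms. Hom sets are
  assumed to be disjoint, so that a morphism determines its domain and codomain.\<close>

record ('o, 'm) acat =
  Ob :: "'o set"
  Hom :: "'o \<Rightarrow> 'o \<Rightarrow> 'm set"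
  Idt :: "'o \<Rightarrow> 'm"
  Cmp :: "'m \<Rightarrow> 'm \<Rightarrow> 'm"  (infixl "\<cdot>\<index>" 70)
  Add :: "'m \<Rightarrow> 'm \<Rightarrow> 'm"  (infixl "\<oplus>\<index>" 65)
  Zero :: "'o \<Rightarrow> 'o \<Rightarrow> 'm"
  Neg :: "'m \<Rightarrow> 'm"  ("\<ominus>\<index> _" [81] 80)

definition opp :: "('o, 'm) acat \<Rightarrow> ('o, 'm) acat" where
  "opp \<A> = \<lparr>Ob = Ob \<A>, Hom = (\<lambda>A B. Hom \<A> B A), Idt = Idt \<A>, Cmp = (\<lambda>g f. f \<cdot>\<^bsub>\<A>\<^esub> g),
            Add = Add \<A>, Zero = (\<lambda>A B. Zero \<A> B A), Neg = Neg \<A>\<rparr>"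

definition inverse_mor :: "('o, 'm) acat \<Rightarrow> 'o \<Rightarrow> 'o \<Rightarrow> 'm \<Rightarrow> 'm \<Rightarrow> bool" where
  "inverse_mor \<A> A B f g \<longleftrightarrow> f \<in> Hom \<A> A B \<and> g \<in> Hom \<A> B A \<and>
     g \<cdot>\<^bsub>\<A>\<^esub> f = Idt \<A> A \<and> f \<cdot>\<^bsub>\<A>\<^esub> g = Idt \<A> B"

definition iso_mor :: "('o, 'm) acat \<Rightarrow> 'o \<Rightarrow> 'o \<Rightarrow> 'm \<Rightarrow> bool" where
  "iso_mor \<A> A B f \<longleftrightarrow> (\<exists>g. inverse_mor \<A> A B f g)"

definition the_inverse :: "('o, 'm) acat \<Rightarrow> 'o \<Rightarrow> 'o \<Rightarrow> 'm \<Rightarrow> 'm" where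
  "the_inverse \<A> A B f = (THE g. inverse_mor \<A> A B f g)"

definition zero_object :: "('o, 'm) acat \<Rightarrow> 'o \<Rightarrow> bool" where
  "zero_object \<A> Z \<longleftrightarrow> Z \<in> Ob \<A> \<and>
     (\<forall>A\<in>Ob \<A>. Hom \<A> Z A = {Zero \<A> Z A} \<and> Hom \<A> A Z = {Zero \<A> A Z})"

definition biproduct ::
  "('o, 'm) acat \<Rightarrow> 'o \<Rightarrow> 'o \<Rightarrow> 'o \<Rightarrow> 'm \<Rightarrow> 'm \<Rightarrow> 'm \<Rightarrow> 'm \<Rightarrow> bool" where
  "biproduct \<A> A B S i1 i2 p1 p2 \<longleftrightarrow>
     i1 \<in> Hom \<A> A S \<and> i2 \<in> Hom \<A> B S \<and> p1 \<in> Hom \<A> S A \<and> p2 \<in> Hom \<A> S B \<and>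
     p1 \<cdot>\<^bsub>\<A>\<^esub> i1 = Idt \<A> A \<and> p2 \<cdot>\<^bsub>\<A>\<^esub> i2 = Idt \<A> B \<and>
     p2 \<cdot>\<^bsub>\<A>\<^esub> i1 = Zero \<A> A B \<and> p1 \<cdot>\<^bsub>\<A>\<^esub> i2 = Zero \<A> B A \<and>
     i1 \<cdot>\<^bsub>\<A>\<^esub> p1 \<oplus>\<^bsub>\<A>\<^esub> i2 \<cdot>\<^bsub>\<A>\<^esub> p2 = Idt \<A> S"

locale additive_category =
  fixes \<A> :: "('o, 'm) acat" (structure)
  assumes hom_ob: "f \<in> Hom \<A> A B \<Longrightarrow> A \<in> Ob \<A> \<and> B \<in> Ob \<A>"
    and hom_disjoint: "f \<in> Hom \<A> A B \<Longrightarrow> f \<in> Hom \<A> A' B' \<Longrightarrow> A = A' \<and> B = B'"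
    and id_hom: "A \<in> Ob \<A> \<Longrightarrow> Idt \<A> A \<in> Hom \<A> A A"
    and cmp_hom: "f \<in> Hom \<A> A B \<Longrightarrow> g \<in> Hom \<A> B C \<Longrightarrow> g \<cdot> f \<in> Hom \<A> A C"
    and cmp_id: "f \<in> Hom \<A> A B \<Longrightarrow> f \<cdot> Idt \<A> A = f \<and> Idt \<A> B \<cdot> f = f"
    and cmp_assoc: "f \<in> Hom \<A> A B \<Longrightarrow> g \<in> Hom \<A> B C \<Longrightarrow> h \<in> Hom \<A> C D \<Longrightarrow>
      h \<cdot> (g \<cdot> f) = (h \<cdot> g) \<cdot> f"
    and hom_group: "A \<in> Ob \<A> \<Longrightarrow> B \<in> Ob \<A> \<Longrightarrow>
      comm_group \<lparr>carrier = Hom \<A> A B, monoid.mult = Add \<A>, one = Zero \<A> A B\<rparr>"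
    and neg_hom: "f \<in> Hom \<A> A B \<Longrightarrow> \<ominus> f \<in> Hom \<A> A B \<and> f \<oplus> (\<ominus> f) = Zero \<A> A B"
    and cmp_add_left: "f \<in> Hom \<A> A B \<Longrightarrow> g \<in> Hom \<A> B C \<Longrightarrow> g' \<in> Hom \<A> B C \<Longrightarrow>
      (g \<oplus> g') \<cdot> f = g \<cdot> f \<oplus> g' \<cdot> f"
    and cmp_add_right: "f \<in> Hom \<A> A B \<Longrightarrow> f' \<in> Hom \<A> A B \<Longrightarrow> g \<in> Hom \<A> B C \<Longrightarrow>
      g \<cdot> (f \<oplus> f') = g \<cdot> f \<oplus> g \<cdot> f'"
    and ex_zero_object: "\<exists>Z. zero_object \<A> Z"
    and ex_biproduct: "A \<in> Ob \<A> \<Longrightarrow> B \<in> Ob \<A> \<Longrightarrow>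
      \<exists>S i1 i2 p1 p2. biproduct \<A> A B S i1 i2 p1 p2"

text \<open>A full additive subcategory closed under isomorphisms is given by its objects.\<close>

definition additive_subcategory :: "('o, 'm) acat \<Rightarrow> 'o set \<Rightarrow> bool" where
  "additive_subcategory \<A> \<C> \<longleftrightarrow> \<C> \<subseteq> Ob \<A> \<and>
     (\<forall>A B f. A \<in> \<C> \<longrightarrow> iso_mor \<A> A B f \<longrightarrow> B \<in> \<C>) \<and>
     (\<forall>Z. zero_object \<A> Z \<longrightarrow> Z \<in> \<C>) \<and>
     (\<forall>A B S i1 i2 p1 p2. A \<in> \<C> \<longrightarrow> B \<in> \<C> \<longrightarrow> biproduct \<A> A B S i1 i2 p1 p2 \<longrightarrow> S \<in> \<C>)"

section \<open>Endofunctors, adjunctions and equivalences\<close>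

record ('o, 'm) endofun =
  fob :: "'o \<Rightarrow> 'o"
  fmor :: "'m \<Rightarrow> 'm"

definition id_fun :: "('o, 'm) endofun" where
  "id_fun = \<lparr>fob = (\<lambda>A. A), fmor = (\<lambda>f. f)\<rparr>"

definition comp_fun :: "('o, 'm) endofun \<Rightarrow> ('o, 'm) endofun \<Rightarrow> ('o, 'm) endofun" where
  "comp_fun G F = \<lparr>fob = fob G \<circ> fob F, fmor = fmor G \<circ> fmor F\<rparr>"

definition additive_functor :: "('o, 'm) acat \<Rightarrow> ('o, 'm) endofun \<Rightarrow> bool" where
  "additive_functor \<A> F \<longleftrightarrow>
     (\<forall>A\<in>Ob \<A>. fob F A \<in> Ob \<A> \<and> fmor F (Idt \<A> A) = Idt \<A> (fob F A)) \<and>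
     (\<forall>A B f. f \<in> Hom \<A> A B \<longrightarrow> fmor F f \<in> Hom \<A> (fob F A) (fob F B)) \<and>
     (\<forall>A B C f g. f \<in> Hom \<A> A B \<longrightarrow> g \<in> Hom \<A> B C \<longrightarrow>
        fmor F (g \<cdot>\<^bsub>\<A>\<^esub> f) = fmor F g \<cdot>\<^bsub>\<A>\<^esub> fmor F f) \<and>
     (\<forall>A B f g. f \<in> Hom \<A> A B \<longrightarrow> g \<in> Hom \<A> A B \<longrightarrow>
        fmor F (f \<oplus>\<^bsub>\<A>\<^esub> g) = fmor F f \<oplus>\<^bsub>\<A>\<^esub> fmor F g)"

definition nat_iso ::
  "('o, 'm) acat \<Rightarrow> ('o, 'm) endofun \<Rightarrow> ('o, 'm) endofun \<Rightarrow> ('o \<Rightarrow> 'm) \<Rightarrow> bool" where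
  "nat_iso \<A> F G \<theta> \<longleftrightarrow> (\<forall>A\<in>Ob \<A>. iso_mor \<A> (fob F A) (fob G A) (\<theta> A)) \<and>
     (\<forall>A B f. f \<in> Hom \<A> A B \<longrightarrow> \<theta> B \<cdot>\<^bsub>\<A>\<^esub> fmor F f = fmor G f \<cdot>\<^bsub>\<A>\<^esub> \<theta> A)"

definition autoequivalence :: "('o, 'm) acat \<Rightarrow> ('o, 'm) endofun \<Rightarrow> bool" where
  "autoequivalence \<A> F \<longleftrightarrow> additive_functor \<A> F \<and>
     (\<exists>G \<theta> \<theta>'. additive_functor \<A> G \<and> nat_iso \<A> id_fun (comp_fun G F) \<theta> \<and>
        nat_iso \<A> (comp_fun F G) id_fun \<theta>')"

text \<open>\<open>adjoint_pair \<A> F G \<psi>\<close>: \<open>F\<close> is left adjoint to \<open>G\<close> via natural bijections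
  \<open>\<psi> C A : Hom (F C) A \<rightarrow> Hom C (G A)\<close>.\<close>

definition adjoint_pair ::
  "('o, 'm) acat \<Rightarrow> ('o, 'm) endofun \<Rightarrow> ('o, 'm) endofun \<Rightarrow> ('o \<Rightarrow> 'o \<Rightarrow> 'm \<Rightarrow> 'm) \<Rightarrow> bool" where
  "adjoint_pair \<A> F G \<psi> \<longleftrightarrow> additive_functor \<A> F \<and> additive_functor \<A> G \<and>
     (\<forall>C\<in>Ob \<A>. \<forall>A\<in>Ob \<A>. bij_betw (\<psi> C A) (Hom \<A> (fob F C) A) (Hom \<A> C (fob G A))) \<and>
     (\<forall>C C' A A' c a u. c \<in> Hom \<A> C' C \<longrightarrow> a \<in> Hom \<A> A A' \<longrightarrow> u \<in> Hom \<A> (fob F C) A \<longrightarrow>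
        \<psi> C' A' (a \<cdot>\<^bsub>\<A>\<^esub> u \<cdot>\<^bsub>\<A>\<^esub> fmor F c) = fmor G a \<cdot>\<^bsub>\<A>\<^esub> \<psi> C A u \<cdot>\<^bsub>\<A>\<^esub> c)"

definition adj_inv ::
  "('o, 'm) acat \<Rightarrow> ('o, 'm) endofun \<Rightarrow> ('o \<Rightarrow> 'o \<Rightarrow> 'm \<Rightarrow> 'm) \<Rightarrow> 'o \<Rightarrow> 'o \<Rightarrow> 'm \<Rightarrow> 'm" where
  "adj_inv \<A> F \<psi> C A = inv_into (Hom \<A> (fob F C) A) (\<psi> C A)"

definition adj_unit ::
  "('o, 'm) acat \<Rightarrow> ('o, 'm) endofun \<Rightarrow> ('o \<Rightarrow> 'o \<Rightarrow> 'm \<Rightarrow> 'm) \<Rightarrow> 'o \<Rightarrow> 'm" where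
  "adj_unit \<A> F \<psi> A = \<psi> A (fob F A) (Idt \<A> (fob F A))"

definition adj_counit ::
  "('o, 'm) acat \<Rightarrow> ('o, 'm) endofun \<Rightarrow> ('o, 'm) endofun \<Rightarrow> ('o \<Rightarrow> 'o \<Rightarrow> 'm \<Rightarrow> 'm) \<Rightarrow> 'o \<Rightarrow> 'm" where
  "adj_counit \<A> F G \<psi> A = adj_inv \<A> F \<psi> (fob G A) A (Idt \<A> (fob G A))"

definition adjoint_equivalence ::
  "('o, 'm) acat \<Rightarrow> ('o, 'm) endofun \<Rightarrow> ('o, 'm) endofun \<Rightarrow> ('o \<Rightarrow> 'o \<Rightarrow> 'm \<Rightarrow> 'm) \<Rightarrow> bool" where
  "adjoint_equivalence \<A> F G \<psi> \<longleftrightarrow> adjoint_pair \<A> F G \<psi> \<and>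
     nat_iso \<A> id_fun (comp_fun G F) (adj_unit \<A> F \<psi>) \<and>
     nat_iso \<A> (comp_fun F G) id_fun (adj_counit \<A> F G \<psi>)"

section \<open>Right sequences\<close>

text \<open>A sequence is the triple of its morphisms; the objects are determined by them.
  \<open>rev_seq\<close> reads a sequence \<open>\<Omega> C \<rightarrow> A \<rightarrow> B \<rightarrow> C\<close> of a category as a right sequence
  \<open>C \<rightarrow> B \<rightarrow> A \<rightarrow> \<Omega> C\<close> of the opposite category, and vice versa.\<close>

type_synonym 'm seq = "'m \<times> 'm \<times> 'm"

definition rev_seq :: "'m seq \<Rightarrow> 'm seq" where
  "rev_seq t = (case t of (f, g, h) \<Rightarrow> (h, g, f))"

definition right_seq ::
  "('o, 'm) acat \<Rightarrow> ('o, 'm) endofun \<Rightarrow> 'o \<Rightarrow> 'o \<Rightarrow> 'o \<Rightarrow> 'm seq \<Rightarrow> bool" where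
  "right_seq \<A> \<Sigma> A B C t \<longleftrightarrow> (case t of (f, g, h) \<Rightarrow>
     f \<in> Hom \<A> A B \<and> g \<in> Hom \<A> B C \<and> h \<in> Hom \<A> C (fob \<Sigma> A))"

definition right_seq_mor ::
  "('o, 'm) acat \<Rightarrow> ('o, 'm) endofun \<Rightarrow> 'm seq \<Rightarrow> 'm seq \<Rightarrow> 'm \<Rightarrow> 'm \<Rightarrow> 'm \<Rightarrow> bool" where
  "right_seq_mor \<A> \<Sigma> t t' \<alpha> \<beta> \<gamma> \<longleftrightarrow> (\<exists>A B C A' B' C'.
     right_seq \<A> \<Sigma> A B C t \<and> right_seq \<A> \<Sigma> A' B' C' t' \<and>
     \<alpha> \<in> Hom \<A> A A' \<and> \<beta> \<in> Hom \<A> B B' \<and> \<gamma> \<in> Hom \<A> C C' \<and>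
     (case t of (f, g, h) \<Rightarrow> case t' of (f', g', h') \<Rightarrow>
        \<beta> \<cdot>\<^bsub>\<A>\<^esub> f = f' \<cdot>\<^bsub>\<A>\<^esub> \<alpha> \<and> \<gamma> \<cdot>\<^bsub>\<A>\<^esub> g = g' \<cdot>\<^bsub>\<A>\<^esub> \<beta> \<and> fmor \<Sigma> \<alpha> \<cdot>\<^bsub>\<A>\<^esub> h = h' \<cdot>\<^bsub>\<A>\<^esub> \<gamma>))"

definition right_seq_iso ::
  "('o, 'm) acat \<Rightarrow> ('o, 'm) endofun \<Rightarrow> 'm seq \<Rightarrow> 'm seq \<Rightarrow> bool" where
  "right_seq_iso \<A> \<Sigma> t t' \<longleftrightarrow> (\<exists>\<alpha> \<beta> \<gamma> A B C A' B' C'. right_seq_mor \<A> \<Sigma> t t' \<alpha> \<beta> \<gamma> \<and>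
     iso_mor \<A> A A' \<alpha> \<and> iso_mor \<A> B B' \<beta> \<and> iso_mor \<A> C C' \<gamma>)"

definition weak_cokernel ::
  "('o, 'm) acat \<Rightarrow> 'o \<Rightarrow> 'o \<Rightarrow> 'o \<Rightarrow> 'm \<Rightarrow> 'm \<Rightarrow> bool" where
  "weak_cokernel \<A> A B C f g \<longleftrightarrow> f \<in> Hom \<A> A B \<and> g \<in> Hom \<A> B C \<and>
     (\<forall>Z\<in>Ob \<A>. {k \<in> Hom \<A> B Z. k \<cdot>\<^bsub>\<A>\<^esub> f = Zero \<A> A Z} = (\<lambda>l. l \<cdot>\<^bsub>\<A>\<^esub> g) ` Hom \<A> C Z)"

definition right_C_seq ::
  "('o, 'm) acat \<Rightarrow> ('o, 'm) endofun \<Rightarrow> 'o set \<Rightarrow> 'm seq \<Rightarrow> bool" where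
  "right_C_seq \<A> \<Sigma> \<C> t \<longleftrightarrow> (\<exists>A B C. right_seq \<A> \<Sigma> A B C t \<and> C \<in> \<C> \<and>
     (case t of (f, g, h) \<Rightarrow> weak_cokernel \<A> A B C f g \<and> weak_cokernel \<A> B C (fob \<Sigma> A) g h))"

definition X_monic :: "('o, 'm) acat \<Rightarrow> 'o set \<Rightarrow> 'o \<Rightarrow> 'o \<Rightarrow> 'm \<Rightarrow> bool" where
  "X_monic \<A> \<X> A B f \<longleftrightarrow> f \<in> Hom \<A> A B \<and>
     (\<forall>X\<in>\<X>. (\<lambda>v. v \<cdot>\<^bsub>\<A>\<^esub> f) ` Hom \<A> B X = Hom \<A> A X)"

definition X_epic :: "('o, 'm) acat \<Rightarrow> 'o set \<Rightarrow> 'o \<Rightarrow> 'o \<Rightarrow> 'm \<Rightarrow> bool" where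
  "X_epic \<A> \<X> A B f \<longleftrightarrow> f \<in> Hom \<A> A B \<and>
     (\<forall>X\<in>\<X>. (\<lambda>v. f \<cdot>\<^bsub>\<A>\<^esub> v) ` Hom \<A> X A = Hom \<A> X B)"

definition X_preenvelope :: "('o, 'm) acat \<Rightarrow> 'o set \<Rightarrow> 'o \<Rightarrow> 'o \<Rightarrow> 'm \<Rightarrow> bool" where
  "X_preenvelope \<A> \<X> A X f \<longleftrightarrow> X \<in> \<X> \<and> X_monic \<A> \<X> A X f"

definition X_precover :: "('o, 'm) acat \<Rightarrow> 'o set \<Rightarrow> 'o \<Rightarrow> 'o \<Rightarrow> 'm \<Rightarrow> bool" where
  "X_precover \<A> \<X> X A f \<longleftrightarrow> X \<in> \<X> \<and> X_epic \<A> \<X> X A f"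

section \<open>Partial right and left triangulated categories\<close>

text \<open>Direct sums are not chosen: \<open>A \<oplus> B\<close> stands for an arbitrary biproduct
  \<open>(S, i1, i2, p1, p2)\<close>. The column \<open>(1, f)\<close> is \<open>i1 + i2 f\<close> and the row \<open>(f, -1)\<close> is
  \<open>f p1 - p2\<close>. The last morphism of a direct sum of two sequences is composed with the
  canonical isomorphism \<open>\<Sigma> A \<oplus> \<Sigma> A' \<cong> \<Sigma> (A \<oplus> A')\<close>.\<close>

locale partial_right_triangulated = additive_category \<A>
  for \<A> :: "('o, 'm) acat" (structure) +
  fixes \<Sigma> :: "('o, 'm) endofun" and R :: "'m seq set" and \<C> :: "'o set" and \<X> :: "'o set"
  assumes shift_functor: "additive_functor \<A> \<Sigma>"
    and sub_C: "additive_subcategory \<A> \<C>"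
    and sub_X: "additive_subcategory \<A> \<X>"
    and X_C: "\<X> \<subseteq> \<C>"
    and right_C: "t \<in> R \<Longrightarrow> right_C_seq \<A> \<Sigma> \<C> t"
    and closed_iso: "t \<in> R \<Longrightarrow> right_seq_iso \<A> \<Sigma> t t' \<Longrightarrow> t' \<in> R"
    and closed_zero: "zero_object \<A> Z \<Longrightarrow>
      (Zero \<A> Z Z, Zero \<A> Z Z, Zero \<A> Z (fob \<Sigma> Z)) \<in> R"
    and closed_sum: "(f, g, h) \<in> R \<Longrightarrow> (f', g', h') \<in> R \<Longrightarrow>
      right_seq \<A> \<Sigma> A B C (f, g, h) \<Longrightarrow> right_seq \<A> \<Sigma> A' B' C' (f', g', h') \<Longrightarrow>
      biproduct \<A> A A' SA iA iA' pA pA' \<Longrightarrow> biproduct \<A> B B' SB iB iB' pB pB' \<Longrightarrow>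
      biproduct \<A> C C' SC iC iC' pC pC' \<Longrightarrow>
      (iB \<cdot> f \<cdot> pA \<oplus> iB' \<cdot> f' \<cdot> pA', iC \<cdot> g \<cdot> pB \<oplus> iC' \<cdot> g' \<cdot> pB',
       fmor \<Sigma> iA \<cdot> h \<cdot> pC \<oplus> fmor \<Sigma> iA' \<cdot> h' \<cdot> pC') \<in> R"
    and PRT1_i: "A \<in> \<C> \<Longrightarrow> \<exists>X U i p q. (i, p, q) \<in> R \<and> right_seq \<A> \<Sigma> A X U (i, p, q) \<and>
      X_preenvelope \<A> \<X> A X i"
    and PRT1_ii: "A \<in> \<C> \<Longrightarrow> B \<in> \<C> \<Longrightarrow> f \<in> Hom \<A> A B \<Longrightarrow> biproduct \<A> A B S i1 i2 p1 p2 \<Longrightarrow>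
      (i1 \<oplus> i2 \<cdot> f, f \<cdot> p1 \<oplus> (\<ominus> p2), Zero \<A> B (fob \<Sigma> A)) \<in> R"
    and PRT1_iii: "(i, p, q) \<in> R \<Longrightarrow> A \<in> \<C> \<Longrightarrow> X_preenvelope \<A> \<X> A X i \<Longrightarrow>
      B \<in> \<C> \<Longrightarrow> f \<in> Hom \<A> A B \<Longrightarrow> biproduct \<A> X B S i1 i2 p1 p2 \<Longrightarrow>
      \<exists>g h. (i1 \<cdot> i \<oplus> i2 \<cdot> f, g, h) \<in> R"
    and PRT2: "(f, g, h) \<in> R \<Longrightarrow> (f', s, h') \<in> R \<Longrightarrow>
      right_seq \<A> \<Sigma> A B C (f, g, h) \<Longrightarrow> right_seq \<A> \<Sigma> A' X U (f', s, h') \<Longrightarrow> X \<in> \<X> \<Longrightarrow>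
      right_seq_mor \<A> \<Sigma> (f, g, h) (f', s, h') \<alpha> \<beta> \<gamma> \<Longrightarrow>
      (\<exists>u\<in>Hom \<A> B A'. \<alpha> = u \<cdot> f) \<Longrightarrow> (\<exists>v\<in>Hom \<A> C X. \<gamma> = s \<cdot> v)"
    and PRT3: "(f, g, h) \<in> R \<Longrightarrow> (f', g', h') \<in> R \<Longrightarrow>
      f \<in> Hom \<A> A B \<Longrightarrow> f' \<in> Hom \<A> A' B' \<Longrightarrow> \<alpha> \<in> Hom \<A> A A' \<Longrightarrow> \<beta> \<in> Hom \<A> B B' \<Longrightarrow>
      \<beta> \<cdot> f = f' \<cdot> \<alpha> \<Longrightarrow> \<exists>\<gamma>. right_seq_mor \<A> \<Sigma> (f, g, h) (f', g', h') \<alpha> \<beta> \<gamma>"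
    and PRT4: "(f, l, a) \<in> R \<Longrightarrow> (g, h, j) \<in> R \<Longrightarrow> (g \<cdot> f, k, b) \<in> R \<Longrightarrow>
      A \<in> \<C> \<Longrightarrow> B \<in> \<C> \<Longrightarrow> C \<in> \<C> \<Longrightarrow> X_monic \<A> \<X> A B f \<Longrightarrow> X_monic \<A> \<X> B C g \<Longrightarrow>
      right_seq \<A> \<Sigma> A B C' (f, l, a) \<Longrightarrow> right_seq \<A> \<Sigma> B C A' (g, h, j) \<Longrightarrow>
      right_seq \<A> \<Sigma> A C B' (g \<cdot> f, k, b) \<Longrightarrow>
      \<exists>r s. r \<in> Hom \<A> C' B' \<and> s \<in> Hom \<A> B' A' \<and>
        r \<cdot> l = k \<cdot> g \<and> b \<cdot> r = a \<and> s \<cdot> k = h \<and> j \<cdot> s = fmor \<Sigma> f \<cdot> b \<and>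
        (r, s, fmor \<Sigma> l \<cdot> j) \<in> R \<and> X_monic \<A> \<X> C' B' r"

definition partial_left_triangulated ::
  "('o, 'm) acat \<Rightarrow> ('o, 'm) endofun \<Rightarrow> 'm seq set \<Rightarrow> 'o set \<Rightarrow> 'o set \<Rightarrow> bool" where
  "partial_left_triangulated \<A> \<Omega> L \<C> \<X> \<longleftrightarrow>
     partial_right_triangulated (opp \<A>) \<Omega> (rev_seq ` L) \<C> \<X>"

text \<open>The fixed right triangles
  \<open>A \<rightarrow> tX A \<rightarrow> tU A \<rightarrow> \<Sigma> A\<close> with morphisms \<open>ti A\<close>, \<open>tp A\<close>, \<open>tq A\<close>. For a partial left
  triangulated category the record is read in the opposite category: the fixed left triangle
  \<open>\<Omega> A \<rightarrow> K_A \<rightarrow> X_A \<rightarrow> A\<close> with morphisms \<open>\<nu>_A\<close>, \<open>\<iota>_A\<close>, \<open>\<pi>_A\<close> is stored as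
  \<open>tX A = X_A\<close>, \<open>tU A = K_A\<close>, \<open>ti A = \<pi>_A\<close>, \<open>tp A = \<iota>_A\<close>, \<open>tq A = \<nu>_A\<close>.\<close>

record ('o, 'm) fixed_tri =
  tX :: "'o \<Rightarrow> 'o"
  tU :: "'o \<Rightarrow> 'o"
  ti :: "'o \<Rightarrow> 'm"
  tp :: "'o \<Rightarrow> 'm"
  tq :: "'o \<Rightarrow> 'm"

definition tri_at :: "('o, 'm) fixed_tri \<Rightarrow> 'o \<Rightarrow> 'm seq" where
  "tri_at T A = (ti T A, tp T A, tq T A)"

definition fixed_right_triangles :: "('o, 'm) acat \<Rightarrow> ('o, 'm) endofun \<Rightarrow> 'm seq set \<Rightarrow>
    'o set \<Rightarrow> 'o set \<Rightarrow> ('o, 'm) fixed_tri \<Rightarrow> bool" where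
  "fixed_right_triangles \<A> \<Sigma> R \<C> \<X> T \<longleftrightarrow> (\<forall>A\<in>\<C>. tri_at T A \<in> R \<and>
     right_seq \<A> \<Sigma> A (tX T A) (tU T A) (tri_at T A) \<and> X_preenvelope \<A> \<X> A (tX T A) (ti T A))"

definition fixed_left_triangles :: "('o, 'm) acat \<Rightarrow> ('o, 'm) endofun \<Rightarrow> 'm seq set \<Rightarrow>
    'o set \<Rightarrow> 'o set \<Rightarrow> ('o, 'm) fixed_tri \<Rightarrow> bool" where
  "fixed_left_triangles \<A> \<Omega> L \<C> \<X> S \<longleftrightarrow>
     fixed_right_triangles (opp \<A>) \<Omega> (rev_seq ` L) \<C> \<X> S"

section \<open>The stable category and the induced structures\<close>

definition factors_through :: "('o, 'm) acat \<Rightarrow> 'o set \<Rightarrow> 'm \<Rightarrow> bool" where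
  "factors_through \<A> \<X> f \<longleftrightarrow>
     (\<exists>A B. \<exists>X\<in>\<X>. \<exists>a\<in>Hom \<A> A X. \<exists>b\<in>Hom \<A> X B. f = b \<cdot>\<^bsub>\<A>\<^esub> a)"

definition stab_class :: "('o, 'm) acat \<Rightarrow> 'o set \<Rightarrow> 'm \<Rightarrow> 'm set" where
  "stab_class \<A> \<X> f = {f'. (\<exists>A B. f \<in> Hom \<A> A B \<and> f' \<in> Hom \<A> A B) \<and>
     factors_through \<A> \<X> (f \<oplus>\<^bsub>\<A>\<^esub> (\<ominus>\<^bsub>\<A>\<^esub> f'))}"

definition stab :: "('o, 'm) acat \<Rightarrow> 'o set \<Rightarrow> 'o set \<Rightarrow> ('o, 'm set) acat" where
  "stab \<A> \<C> \<X> = \<lparr>Ob = \<C>,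
     Hom = (\<lambda>A B. {stab_class \<A> \<X> f |f. A \<in> \<C> \<and> B \<in> \<C> \<and> f \<in> Hom \<A> A B}),
     Idt = (\<lambda>A. stab_class \<A> \<X> (Idt \<A> A)),
     Cmp = (\<lambda>G F. \<Union>g\<in>G. \<Union>f\<in>F. stab_class \<A> \<X> (g \<cdot>\<^bsub>\<A>\<^esub> f)),
     Add = (\<lambda>F G. \<Union>f\<in>F. \<Union>g\<in>G. stab_class \<A> \<X> (f \<oplus>\<^bsub>\<A>\<^esub> g)),
     Zero = (\<lambda>A B. stab_class \<A> \<X> (Zero \<A> A B)),
     Neg = (\<lambda>F. \<Union>f\<in>F. stab_class \<A> \<X> (\<ominus>\<^bsub>\<A>\<^esub> f))\<rparr>"

text \<open>The definite description reflects that the class of \<open>\<kappa>\<close> depends neither on the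
  representative \<open>f\<close> nor on the choice of \<open>\<sigma>\<close> and \<open>\<kappa>\<close>.\<close>

definition susp :: "('o, 'm) acat \<Rightarrow> ('o, 'm) endofun \<Rightarrow> 'o set \<Rightarrow> 'o set \<Rightarrow>
    ('o, 'm) fixed_tri \<Rightarrow> ('o, 'm set) endofun" where
  "susp \<A> \<Sigma> \<C> \<X> T = \<lparr>fob = tU T,
     fmor = (\<lambda>F. THE K. \<exists>A\<in>\<C>. \<exists>B\<in>\<C>. \<exists>f\<in>Hom \<A> A B. \<exists>\<sigma> \<kappa>. F = stab_class \<A> \<X> f \<and>
       right_seq_mor \<A> \<Sigma> (tri_at T A) (tri_at T B) f \<sigma> \<kappa> \<and> K = stab_class \<A> \<X> \<kappa>)\<rparr>"

definition standard_right :: "('o, 'm) acat \<Rightarrow> ('o, 'm) endofun \<Rightarrow> 'm seq set \<Rightarrow> 'o set \<Rightarrow>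
    'o set \<Rightarrow> ('o, 'm) fixed_tri \<Rightarrow> 'm set seq set" where
  "standard_right \<A> \<Sigma> R \<C> \<X> T =
     {(stab_class \<A> \<X> f, stab_class \<A> \<X> g, stab_class \<A> \<X> \<xi>) |f g \<xi>.
        \<exists>A\<in>\<C>. \<exists>B\<in>\<C>. \<exists>h \<delta>. (f, g, h) \<in> R \<and> X_monic \<A> \<X> A B f \<and>
          right_seq_mor \<A> \<Sigma> (f, g, h) (tri_at T A) (Idt \<A> A) \<delta> \<xi>}"

definition right_triangles :: "('o, 'm) acat \<Rightarrow> ('o, 'm) endofun \<Rightarrow> 'm seq set \<Rightarrow> 'o set \<Rightarrow>
    'o set \<Rightarrow> ('o, 'm) fixed_tri \<Rightarrow> 'm set seq set" where
  "right_triangles \<A> \<Sigma> R \<C> \<X> T = {t. \<exists>s\<in>standard_right \<A> \<Sigma> R \<C> \<X> T.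
     right_seq_iso (stab \<A> \<C> \<X>) (susp \<A> \<Sigma> \<C> \<X> T) s t}"

text \<open>The dual construction is carried out in the opposite category; the stable category of
  the opposite category is the opposite of the stable category (lemma \<open>stab_opp\<close>). Lemmas
  \<open>loop_explicit\<close> and \<open>standard_left_explicit\<close> spell out the result.\<close>

definition loop :: "('o, 'm) acat \<Rightarrow> ('o, 'm) endofun \<Rightarrow> 'o set \<Rightarrow> 'o set \<Rightarrow>
    ('o, 'm) fixed_tri \<Rightarrow> ('o, 'm set) endofun" where
  "loop \<A> \<Omega> \<C> \<X> S = susp (opp \<A>) \<Omega> \<C> \<X> S"

definition standard_left :: "('o, 'm) acat \<Rightarrow> ('o, 'm) endofun \<Rightarrow> 'm seq set \<Rightarrow> 'o set \<Rightarrow>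
    'o set \<Rightarrow> ('o, 'm) fixed_tri \<Rightarrow> 'm set seq set" where
  "standard_left \<A> \<Omega> L \<C> \<X> S = rev_seq ` standard_right (opp \<A>) \<Omega> (rev_seq ` L) \<C> \<X> S"

definition left_triangles :: "('o, 'm) acat \<Rightarrow> ('o, 'm) endofun \<Rightarrow> 'm seq set \<Rightarrow> 'o set \<Rightarrow>
    'o set \<Rightarrow> ('o, 'm) fixed_tri \<Rightarrow> 'm set seq set" where
  "left_triangles \<A> \<Omega> L \<C> \<X> S = {t. \<exists>s\<in>standard_left \<A> \<Omega> L \<C> \<X> S.
     right_seq_iso (opp (stab \<A> \<C> \<X>)) (loop \<A> \<Omega> \<C> \<X> S) (rev_seq s) (rev_seq t)}"

lemma stab_class_opp: "stab_class (opp \<A>) \<X> f = stab_class \<A> \<X> f"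
  by (auto simp: stab_class_def factors_through_def opp_def; metis)

lemma stab_opp: "stab (opp \<A>) \<C> \<X> = opp (stab \<A> \<C> \<X>)"
  unfolding stab_def stab_class_opp by (auto simp: opp_def fun_eq_iff)

lemma left_triangles_opp:
  "left_triangles \<A> \<Omega> L \<C> \<X> S = rev_seq ` right_triangles (opp \<A>) \<Omega> (rev_seq ` L) \<C> \<X> S"
proof -
  have rr: "rev_seq (rev_seq t) = t" for t :: "'x seq"
    by (simp add: rev_seq_def split: prod.splits)
  have rev_iff: "t \<in> rev_seq ` Q \<longleftrightarrow> rev_seq t \<in> Q" for t :: "'x seq" and Q
    using rr by (metis image_iff)
  show ?thesis
    by (rule Set.set_eqI) (simp add: rev_iff left_triangles_def right_triangles_def
        standard_left_def loop_def stab_opp rr)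
qed

lemma standard_left_explicit:
  "standard_left \<A> \<Omega> L \<C> \<X> S =
     {(stab_class \<A> \<X> \<xi>, stab_class \<A> \<X> f, stab_class \<A> \<X> g) |\<xi> f g.
        \<exists>C\<in>\<C>. \<exists>B\<in>\<C>. \<exists>u \<delta>. (u, f, g) \<in> L \<and> X_epic \<A> \<X> B C g \<and>
          right_seq_mor (opp \<A>) \<Omega> (g, f, u) (ti S C, tp S C, tq S C) (Idt \<A> C) \<delta> \<xi>}"
proof -
  have mem: "(a, b, c) \<in> rev_seq ` L \<longleftrightarrow> (c, b, a) \<in> L" for a b c
    by (force simp: rev_seq_def split: prod.splits)
  have ep: "X_monic (opp \<A>) \<X> A B f \<longleftrightarrow> X_epic \<A> \<X> B A f" for A B f
    by (simp add: X_monic_def X_epic_def opp_def)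
  have idt: "Idt (opp \<A>) = Idt \<A>" by (simp add: opp_def)
  show ?thesis
    unfolding standard_left_def standard_right_def stab_class_opp mem ep idt tri_at_def
    by (auto simp: rev_seq_def image_def; blast)
qed

lemma left_mor_explicit:
  "right_seq_mor (opp \<A>) \<Omega> (w, v, u) (w', v', u') c b a \<longleftrightarrow>
     (\<exists>A B C A' B' C'.
        u \<in> Hom \<A> (fob \<Omega> C) A \<and> v \<in> Hom \<A> A B \<and> w \<in> Hom \<A> B C \<and>
        u' \<in> Hom \<A> (fob \<Omega> C') A' \<and> v' \<in> Hom \<A> A' B' \<and> w' \<in> Hom \<A> B' C' \<and>
        a \<in> Hom \<A> A' A \<and> b \<in> Hom \<A> B' B \<and> c \<in> Hom \<A> C' C \<and>
        a \<cdot>\<^bsub>\<A>\<^esub> u' = u \<cdot>\<^bsub>\<A>\<^esub> fmor \<Omega> c \<and> b \<cdot>\<^bsub>\<A>\<^esub> v' = v \<cdot>\<^bsub>\<A>\<^esub> a \<and> c \<cdot>\<^bsub>\<A>\<^esub> w' = w \<cdot>\<^bsub>\<A>\<^esub> b)"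
  unfolding right_seq_mor_def right_seq_def opp_def
  by (simp, rule iffI; elim exE conjE; intro exI conjI; (assumption | rule sym, assumption))

lemma loop_explicit:
  "fmor (loop \<A> \<Omega> \<C> \<X> S) F = (THE K. \<exists>A\<in>\<C>. \<exists>B\<in>\<C>. \<exists>f\<in>Hom \<A> A B. \<exists>\<sigma> \<kappa>.
     F = stab_class \<A> \<X> f \<and>
     right_seq_mor (opp \<A>) \<Omega> (ti S B, tp S B, tq S B) (ti S A, tp S A, tq S A) f \<sigma> \<kappa> \<and>
     K = stab_class \<A> \<X> \<kappa>)"
proof -
  have h: "Hom (opp \<A>) A B = Hom \<A> B A" for A B by (simp add: opp_def)
  show ?thesis
    unfolding loop_def susp_def stab_class_opp tri_at_def h
    by simp (rule arg_cong[where f = The], rule ext, blast)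
qed

section \<open>Partial triangulated categories\<close>

locale partial_triangulated =
  fixes \<A> :: "('o, 'm) acat" (structure)
    and \<Omega> \<Sigma> :: "('o, 'm) endofun" and L R :: "'m seq set" and \<C> \<X> :: "'o set"
    and \<psi> :: "'o \<Rightarrow> 'o \<Rightarrow> 'm \<Rightarrow> 'm" and S T :: "('o, 'm) fixed_tri"
  assumes left: "partial_left_triangulated \<A> \<Omega> L \<C> \<X>"
    and right: "partial_right_triangulated \<A> \<Sigma> R \<C> \<X>"
    and fixed_left: "fixed_left_triangles \<A> \<Omega> L \<C> \<X> S"
    and fixed_right: "fixed_right_triangles \<A> \<Sigma> R \<C> \<X> T"
    and adjoint: "adjoint_pair \<A> \<Omega> \<Sigma> \<psi>"
    and left_to_right: "(u, v, w) \<in> L \<Longrightarrow> B \<in> \<C> \<Longrightarrow> C \<in> \<C> \<Longrightarrow>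
      u \<in> Hom \<A> (fob \<Omega> C) A \<Longrightarrow> v \<in> Hom \<A> A B \<Longrightarrow> w \<in> Hom \<A> B C \<Longrightarrow>
      (v, w, \<ominus> (\<psi> C A u)) \<in> R"
    and right_to_left: "(f, g, h) \<in> R \<Longrightarrow> A \<in> \<C> \<Longrightarrow> B \<in> \<C> \<Longrightarrow>
      right_seq \<A> \<Sigma> A B C (f, g, h) \<Longrightarrow> (\<ominus> (adj_inv \<A> \<Omega> \<psi> C A h), f, g) \<in> L"
    and p_precover: "A \<in> \<C> \<Longrightarrow> X_precover \<A> \<X> (tX T A) (tU T A) (tp T A)"
    and iota_preenvelope: "A \<in> \<C> \<Longrightarrow> X_preenvelope \<A> \<X> (tU S A) (tX S A) (tp S A)"

section \<open>Triangulated categories\<close>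

locale triangulated_category = additive_category \<T>
  for \<T> :: "('o, 'm) acat" (structure) +
  fixes \<Sigma> :: "('o, 'm) endofun" and \<Delta> :: "'m seq set"
  assumes shift: "autoequivalence \<T> \<Sigma>"
    and tri_seq: "t \<in> \<Delta> \<Longrightarrow> \<exists>A B C. right_seq \<T> \<Sigma> A B C t"
    and tri_iso: "t \<in> \<Delta> \<Longrightarrow> right_seq_iso \<T> \<Sigma> t t' \<Longrightarrow> t' \<in> \<Delta>"
    and TR1_id: "A \<in> Ob \<T> \<Longrightarrow> zero_object \<T> Z \<Longrightarrow>
      (Idt \<T> A, Zero \<T> A Z, Zero \<T> Z (fob \<Sigma> A)) \<in> \<Delta>"
    and TR1_ex: "f \<in> Hom \<T> A B \<Longrightarrow> \<exists>g h. (f, g, h) \<in> \<Delta>"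
    and TR2: "right_seq \<T> \<Sigma> A B C (f, g, h) \<Longrightarrow>
      (f, g, h) \<in> \<Delta> \<longleftrightarrow> (g, h, \<ominus> (fmor \<Sigma> f)) \<in> \<Delta>"
    and TR3: "(f, g, h) \<in> \<Delta> \<Longrightarrow> (f', g', h') \<in> \<Delta> \<Longrightarrow>
      f \<in> Hom \<T> A B \<Longrightarrow> f' \<in> Hom \<T> A' B' \<Longrightarrow> \<alpha> \<in> Hom \<T> A A' \<Longrightarrow> \<beta> \<in> Hom \<T> B B' \<Longrightarrow>
      \<beta> \<cdot> f = f' \<cdot> \<alpha> \<Longrightarrow> \<exists>\<gamma>. right_seq_mor \<T> \<Sigma> (f, g, h) (f', g', h') \<alpha> \<beta> \<gamma>"
    and TR4: "(f, l, a) \<in> \<Delta> \<Longrightarrow> (g, h, j) \<in> \<Delta> \<Longrightarrow> (g \<cdot> f, k, b) \<in> \<Delta> \<Longrightarrow>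
      right_seq \<T> \<Sigma> A B C' (f, l, a) \<Longrightarrow> right_seq \<T> \<Sigma> B C A' (g, h, j) \<Longrightarrow>
      right_seq \<T> \<Sigma> A C B' (g \<cdot> f, k, b) \<Longrightarrow>
      \<exists>r s. r \<in> Hom \<T> C' B' \<and> s \<in> Hom \<T> B' A' \<and>
        r \<cdot> l = k \<cdot> g \<and> b \<cdot> r = a \<and> s \<cdot> k = h \<and> j \<cdot> s = fmor \<Sigma> f \<cdot> b \<and>
        (r, s, fmor \<Sigma> l \<cdot> j) \<in> \<Delta>"

text \<open>A triangulated structure given by a loop functor and left triangles
  \<open>\<Omega> C \<rightarrow> A \<rightarrow> B \<rightarrow> C\<close>.\<close>

definition left_triangulated_category ::
  "('o, 'm) acat \<Rightarrow> ('o, 'm) endofun \<Rightarrow> 'm seq set \<Rightarrow> bool" where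
  "left_triangulated_category \<T> \<Omega> N \<longleftrightarrow> triangulated_category (opp \<T>) \<Omega> (rev_seq ` N)"

definition same_triangulation :: "('o, 'm) acat \<Rightarrow> ('o, 'm) endofun \<Rightarrow> 'm seq set \<Rightarrow>
    ('o, 'm) endofun \<Rightarrow> 'm seq set \<Rightarrow> bool" where
  "same_triangulation \<T> \<Omega> N \<Sigma> \<Delta> \<longleftrightarrow> (\<exists>\<phi>. adjoint_equivalence \<T> \<Sigma> \<Omega> \<phi> \<and>
     (\<forall>A B C f g h. right_seq \<T> \<Sigma> A B C (f, g, h) \<longrightarrow>
        ((f, g, h) \<in> \<Delta> \<longleftrightarrow>
        (f \<cdot>\<^bsub>\<T>\<^esub> the_inverse \<T> A (fob \<Omega> (fob \<Sigma> A)) (adj_unit \<T> \<Sigma> \<phi> A), g, h) \<in> N)))"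

end

theory Submission
  imports Defs
begin

text \<open>Replacing a morphism \<open>f: A \<rightarrow> B\<close> by the isomorphic \<open>\<X>\<close>-monic \<open>(i\<^sup>A, f): A \<rightarrow> X\<^sup>A \<oplus> B\<close>, the axioms (PRT1)-(PRT4)
  yield TR1, TR3, the forward rotation and the octahedral axiom in \<open>\<C>/\<X>\<close>. The fixed right triangles
  \<open>A \<rightarrow> X\<^sup>A \<rightarrow> U\<^sup>A\<close> and the rotated fixed left triangles \<open>K\<^sub>A \<rightarrow> X\<^sub>A \<rightarrow> A\<close> all start with an \<open>\<X>\<close>-preenvelope
  and continue with an \<open>\<X>\<close>-precover; for two such triangles, the morphisms between them give a
  bijection between the stable morphisms on the left ends and those on the right ends. Hence
  suspension and loop are mutually inverse equivalences, adjoint to each other, and full faithfulness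
  of the suspension gives the backward rotation. Finally the hypotheses are self-dual, and each
  triangle is isomorphic to one that is standard for both structures.\<close>

section \<open>Calculus in additive categories\<close>

text \<open>The axioms give only weak cokernels and non-unique fillers, and a square of
  \<open>\<C>/\<X>\<close> commutes in \<open>\<A>\<close> only up to a morphism through
  \<open>\<X>\<close>. Both defects are repaired by \<open>\<X>\<close>-monics: the error term
  extends along an \<open>\<X>\<close>-monic, so squares can be made strict, and (PRT2) makes the
  stable class of a filler into a fixed triangle depend only on the class of its first component.
  The third morphism \<open>\<xi>\<close> of a standard triangle is such a filler, so identities
  about it are shown by exhibiting two fillers over one first component. A unipotence argument
  stands in for the missing uniqueness of third objects. The adjunction of \<open>\<Omega>\<close>
  and \<open>\<Sigma>\<close> on \<open>\<A>\<close> only serves to pass between right and left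
  triangles; the one on \<open>\<C>/\<X>\<close> is built afresh from comparisons of triangles and
  carries a sign. The sign comes from rotation: comparing over the identity would give
  \<open>(v, w, \<Sigma> \<xi>)\<close>, up to isomorphism, as the right triangle belonging to a
  left triangle \<open>(\<xi>, v, w)\<close>, whereas rotating back needs
  \<open>- \<Sigma> \<xi>\<close>.\<close>

context additive_category
begin

text \<open>Since hom sets are disjoint, a morphism determines its ends. Typing thus becomes
  equations on \<open>dm\<close> and \<open>cd\<close>, which the simplifier can discharge as side
  conditions without naming objects.\<close>

definition mor :: "'m \<Rightarrow> bool" where "mor f \<longleftrightarrow> (\<exists>A B. f \<in> Hom \<A> A B)"
definition dm :: "'m \<Rightarrow> 'o" where "dm f = (THE A. \<exists>B. f \<in> Hom \<A> A B)"
definition cd :: "'m \<Rightarrow> 'o" where "cd f = (THE B. \<exists>A. f \<in> Hom \<A> A B)"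

abbreviation idt where "idt \<equiv> Idt \<A>"
abbreviation zmor where "zmor \<equiv> Zero \<A>"

lemma hom_dm_cd: assumes "f \<in> Hom \<A> A B" shows "dm f = A" "cd f = B"
  unfolding dm_def cd_def using assms by (blast dest: hom_disjoint)+

lemma hom_iff: "f \<in> Hom \<A> A B \<longleftrightarrow> mor f \<and> dm f = A \<and> cd f = B \<and> A \<in> Ob \<A> \<and> B \<in> Ob \<A>"
  using hom_dm_cd hom_ob by (auto simp: mor_def)

lemma mor_hom: "mor f \<Longrightarrow> f \<in> Hom \<A> (dm f) (cd f)"
  using hom_dm_cd by (auto simp: mor_def)

lemma dm_Ob [simp]: "mor f \<Longrightarrow> dm f \<in> Ob \<A>" and cd_Ob [simp]: "mor f \<Longrightarrow> cd f \<in> Ob \<A>"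
  using mor_hom hom_ob by blast+

lemma cmp_mor [simp]:
  assumes "mor f" "mor g" "cd f = dm g"
  shows "mor (g \<cdot> f)" "dm (g \<cdot> f) = dm f" "cd (g \<cdot> f) = cd g"
proof -
  have "g \<cdot> f \<in> Hom \<A> (dm f) (cd g)"
    using cmp_hom[of f "dm f" "cd f" g "cd g"] assms mor_hom[of f] mor_hom[of g] by simp
  then show "mor (g \<cdot> f)" "dm (g \<cdot> f) = dm f" "cd (g \<cdot> f) = cd g"
    using hom_iff by blast+
qed

lemma idt_mor [simp]:
  assumes "A \<in> Ob \<A>" shows "mor (idt A)" "dm (idt A) = A" "cd (idt A) = A"
  using id_hom[OF assms] by (simp_all add: hom_iff)

lemma zero_hom: assumes "A \<in> Ob \<A>" "B \<in> Ob \<A>" shows "zmor A B \<in> Hom \<A> A B"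
proof -
  interpret comm_group "\<lparr>carrier = Hom \<A> A B, monoid.mult = Add \<A>, one = zmor A B\<rparr>"
    using hom_group assms by blast
  show ?thesis using one_closed by simp
qed

lemma zero_mor [simp]:
  assumes "A \<in> Ob \<A>" "B \<in> Ob \<A>"
  shows "mor (zmor A B)" "dm (zmor A B) = A" "cd (zmor A B) = B"
  using zero_hom[OF assms] by (simp_all add: hom_iff)

lemma neg_mor [simp]:
  assumes "mor f" shows "mor (\<ominus> f)" "dm (\<ominus> f) = dm f" "cd (\<ominus> f) = cd f"
  using neg_hom[OF mor_hom[OF assms]] by (simp_all add: hom_iff)

lemma add_neg [simp]: "mor f \<Longrightarrow> f \<oplus> (\<ominus> f) = zmor (dm f) (cd f)"
  using neg_hom mor_hom by blast

lemma add_group: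
  assumes "f \<in> Hom \<A> A B" "g \<in> Hom \<A> A B" "h \<in> Hom \<A> A B"
  shows "f \<oplus> g \<in> Hom \<A> A B" "f \<oplus> g = g \<oplus> f" "f \<oplus> g \<oplus> h = f \<oplus> (g \<oplus> h)"
    "f \<oplus> zmor A B = f" "zmor A B \<oplus> f = f" "f \<oplus> g = f \<oplus> h \<longleftrightarrow> g = h"
proof -
  interpret G: comm_group "\<lparr>carrier = Hom \<A> A B, monoid.mult = Add \<A>, one = zmor A B\<rparr>"
    using hom_group hom_ob assms by blast
  show "f \<oplus> g \<in> Hom \<A> A B" using G.m_closed assms by simp
  show "f \<oplus> g = g \<oplus> f" using G.m_comm assms by simp
  show "f \<oplus> g \<oplus> h = f \<oplus> (g \<oplus> h)" using G.m_assoc assms by simp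
  show "f \<oplus> zmor A B = f" using G.r_one assms by simp
  show "zmor A B \<oplus> f = f" using G.l_one assms by simp
  show "f \<oplus> g = f \<oplus> h \<longleftrightarrow> g = h" using G.Units_l_cancel[of f g h] G.Units assms by auto
qed

lemma add_mor [simp]:
  assumes "mor f" "mor g" "dm f = dm g" "cd f = cd g"
  shows "mor (f \<oplus> g)" "dm (f \<oplus> g) = dm g" "cd (f \<oplus> g) = cd g"
  using add_group(1)[of f "dm g" "cd g" g g] assms by (auto simp: hom_iff)

lemma add_commute:
  "mor f \<Longrightarrow> mor g \<Longrightarrow> dm f = dm g \<Longrightarrow> cd f = cd g \<Longrightarrow> f \<oplus> g = g \<oplus> f"
  using add_group(2)[of f "dm g" "cd g" g g] by (auto simp: hom_iff)

lemma add_assoc: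
  "mor f \<Longrightarrow> mor g \<Longrightarrow> mor h \<Longrightarrow> dm f = dm g \<Longrightarrow> cd f = cd g \<Longrightarrow> dm g = dm h \<Longrightarrow> cd g = cd h \<Longrightarrow>
   f \<oplus> g \<oplus> h = f \<oplus> (g \<oplus> h)"
  using add_group(3)[of f "dm h" "cd h" g h] by (auto simp: hom_iff)

lemma add_left_commute:
  "mor f \<Longrightarrow> mor g \<Longrightarrow> mor h \<Longrightarrow> dm f = dm g \<Longrightarrow> cd f = cd g \<Longrightarrow> dm g = dm h \<Longrightarrow> cd g = cd h \<Longrightarrow>
   f \<oplus> (g \<oplus> h) = g \<oplus> (f \<oplus> h)"
  by (metis add_assoc add_commute)

lemma add_zero [simp]:
  "mor f \<Longrightarrow> dm f = A \<Longrightarrow> cd f = B \<Longrightarrow> f \<oplus> zmor A B = f"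
  "mor f \<Longrightarrow> dm f = A \<Longrightarrow> cd f = B \<Longrightarrow> zmor A B \<oplus> f = f"
  using add_group(4,5)[of f A B] by (auto simp: hom_iff)

lemma add_left_cancel [simp]:
  "mor f \<Longrightarrow> mor g \<Longrightarrow> mor h \<Longrightarrow> dm f = dm g \<Longrightarrow> cd f = cd g \<Longrightarrow> dm g = dm h \<Longrightarrow> cd g = cd h \<Longrightarrow>
   f \<oplus> g = f \<oplus> h \<longleftrightarrow> g = h"
  using add_group(6)[of f "dm h" "cd h" g h] by (auto simp: hom_iff)

lemma neg_add [simp]: "mor f \<Longrightarrow> (\<ominus> f) \<oplus> f = zmor (dm f) (cd f)"
  by (metis add_neg add_commute neg_mor)

lemma add_neg_cancel [simp]:
  assumes "mor f" "mor g" "dm f = dm g" "cd f = cd g"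
  shows "f \<oplus> ((\<ominus> f) \<oplus> g) = g" "(\<ominus> f) \<oplus> (f \<oplus> g) = g"
  using assms by (simp_all add: add_assoc[symmetric])

lemma neg_unique:
  assumes "mor f" "mor g" "dm f = dm g" "cd f = cd g" "f \<oplus> g = zmor (dm g) (cd g)"
  shows "g = \<ominus> f"
proof -
  have "f \<oplus> g = f \<oplus> (\<ominus> f)" using assms by simp
  then show ?thesis by (subst (asm) add_left_cancel) (use assms in auto)
qed

lemma neg_neg [simp]: "mor f \<Longrightarrow> \<ominus> (\<ominus> f) = f"
  using neg_unique[of "\<ominus> f" f] by simp

lemma neg_zero [simp]: "A \<in> Ob \<A> \<Longrightarrow> B \<in> Ob \<A> \<Longrightarrow> \<ominus> (zmor A B) = zmor A B"
  using neg_unique[of "zmor A B" "zmor A B"] by simp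

lemma neg_add_distrib [simp]:
  assumes "mor f" "mor g" "dm f = dm g" "cd f = cd g"
  shows "\<ominus> (f \<oplus> g) = (\<ominus> f) \<oplus> (\<ominus> g)"
proof -
  have "f \<oplus> g \<oplus> ((\<ominus> f) \<oplus> (\<ominus> g)) = f \<oplus> ((\<ominus> f) \<oplus> (g \<oplus> (\<ominus> g)))"
    using assms by (simp add: add_assoc add_left_commute)
  then show ?thesis using neg_unique[of "f \<oplus> g" "(\<ominus> f) \<oplus> (\<ominus> g)"] assms by simp
qed

lemma assoc [simp]:
  "mor f \<Longrightarrow> mor g \<Longrightarrow> mor h \<Longrightarrow> cd f = dm g \<Longrightarrow> cd g = dm h \<Longrightarrow> h \<cdot> g \<cdot> f = h \<cdot> (g \<cdot> f)"
  using cmp_assoc[of f "dm f" "cd f" g "cd g" h "cd h"] by (simp add: hom_iff)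

lemma idt_cmp [simp]:
  "mor f \<Longrightarrow> dm f = A \<Longrightarrow> f \<cdot> idt A = f"
  "mor f \<Longrightarrow> cd f = A \<Longrightarrow> idt A \<cdot> f = f"
  using cmp_id mor_hom by blast+

lemma distrib [simp]:
  "mor f \<Longrightarrow> mor g \<Longrightarrow> mor g' \<Longrightarrow> cd f = dm g \<Longrightarrow> dm g = dm g' \<Longrightarrow> cd g = cd g' \<Longrightarrow>
    (g \<oplus> g') \<cdot> f = g \<cdot> f \<oplus> g' \<cdot> f"
  "mor f \<Longrightarrow> mor f' \<Longrightarrow> mor g \<Longrightarrow> dm f = dm f' \<Longrightarrow> cd f = cd f' \<Longrightarrow> cd f = dm g \<Longrightarrow>
    g \<cdot> (f \<oplus> f') = g \<cdot> f \<oplus> g \<cdot> f'"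
  using cmp_add_left[of f "dm f" "dm g" g "cd g" g'] cmp_add_right[of f "dm f" "dm g" f' g "cd g"]
  by (simp_all add: hom_iff)

text \<open>Cancel one summand. This is how distributivity forces composites with zero to vanish,
  and additivity forces a functor to preserve zero.\<close>

lemma self_add_zero:
  assumes "mor f" "f \<oplus> f = f" shows "f = zmor (dm f) (cd f)"
proof -
  have "f \<oplus> f = f \<oplus> zmor (dm f) (cd f)" using assms by simp
  then show ?thesis by (subst (asm) add_left_cancel) (use assms in auto)
qed

lemma zero_cmp [simp]:
  "mor f \<Longrightarrow> cd f = A \<Longrightarrow> B \<in> Ob \<A> \<Longrightarrow> zmor A B \<cdot> f = zmor (dm f) B"
  "mor f \<Longrightarrow> dm f = B \<Longrightarrow> A \<in> Ob \<A> \<Longrightarrow> f \<cdot> zmor A B = zmor A (cd f)"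
proof -
  assume "mor f" "cd f = A" "B \<in> Ob \<A>"
  then have *: "mor f" "cd f = A" "B \<in> Ob \<A>" "A \<in> Ob \<A>" by auto
  then have "zmor A B \<cdot> f \<oplus> zmor A B \<cdot> f = (zmor A B \<oplus> zmor A B) \<cdot> f"
    by (intro distrib(1)[symmetric]) auto
  also have "\<dots> = zmor A B \<cdot> f" using * by simp
  finally show "zmor A B \<cdot> f = zmor (dm f) B" using self_add_zero[of "zmor A B \<cdot> f"] * by auto
next
  assume "mor f" "dm f = B" "A \<in> Ob \<A>"
  then have *: "mor f" "dm f = B" "A \<in> Ob \<A>" "B \<in> Ob \<A>" by auto
  then have "f \<cdot> zmor A B \<oplus> f \<cdot> zmor A B = f \<cdot> (zmor A B \<oplus> zmor A B)"
    by (intro distrib(2)[symmetric]) auto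
  also have "\<dots> = f \<cdot> zmor A B" using * by simp
  finally show "f \<cdot> zmor A B = zmor A (cd f)" using self_add_zero[of "f \<cdot> zmor A B"] * by auto
qed

lemma neg_cmp [simp]:
  assumes "mor f" "mor g" "cd f = dm g"
  shows "(\<ominus> g) \<cdot> f = \<ominus> (g \<cdot> f)" "g \<cdot> (\<ominus> f) = \<ominus> (g \<cdot> f)"
proof -
  have "g \<cdot> f \<oplus> (\<ominus> g) \<cdot> f = (g \<oplus> (\<ominus> g)) \<cdot> f" using assms by (intro distrib(1)[symmetric]) auto
  also have "\<dots> = zmor (dm f) (cd g)" using assms by simp
  finally show "(\<ominus> g) \<cdot> f = \<ominus> (g \<cdot> f)" using neg_unique[of "g \<cdot> f" "(\<ominus> g) \<cdot> f"] assms by auto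
next
  have "g \<cdot> f \<oplus> g \<cdot> (\<ominus> f) = g \<cdot> (f \<oplus> (\<ominus> f))" using assms by (intro distrib(2)[symmetric]) auto
  also have "\<dots> = zmor (dm f) (cd g)" using assms by simp
  finally show "g \<cdot> (\<ominus> f) = \<ominus> (g \<cdot> f)" using neg_unique[of "g \<cdot> f" "g \<cdot> (\<ominus> f)"] assms by auto
qed

lemma neg_inject [simp]: "mor f \<Longrightarrow> mor g \<Longrightarrow> \<ominus> f = \<ominus> g \<longleftrightarrow> f = g"
  by (metis neg_neg)

lemmas add_ac = add_assoc add_commute add_left_commute

text \<open>Pushes an equation between composites under a further composition on the right, to be used
  together with the right-associated normal form.\<close>

lemma cmp_eq_assoc:
  "g \<cdot> f = k \<Longrightarrow> mor f \<Longrightarrow> mor g \<Longrightarrow> mor x \<Longrightarrow> cd f = dm g \<Longrightarrow> cd x = dm f \<Longrightarrow> g \<cdot> (f \<cdot> x) = k \<cdot> x"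
  by (metis assoc)

section \<open>Isomorphisms, zero objects, biproducts and additive functors\<close>

abbreviation isom where "isom \<equiv> inverse_mor \<A>"

lemma inverse_morD:
  assumes "isom A B f g"
  shows "mor f" "mor g" "dm f = A" "cd f = B" "dm g = B" "cd g = A" "A \<in> Ob \<A>" "B \<in> Ob \<A>"
    "g \<cdot> f = idt A" "f \<cdot> g = idt B"
  using assms unfolding inverse_mor_def hom_iff by auto

lemma inverse_mor_sym: "isom A B f g \<Longrightarrow> isom B A g f"
  by (auto simp: inverse_mor_def)

lemma inverse_mor_unique:
  assumes "isom A B f g" "isom A B f g'" shows "g = g'"
proof -
  note 1 = inverse_morD[OF assms(1)] and 2 = inverse_morD[OF assms(2)]
  have "g = g \<cdot> (f \<cdot> g')" using 1 2 by simp
  also have "\<dots> = (g \<cdot> f) \<cdot> g'" using 1(1-8) 2(1-8) by simp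
  finally show ?thesis using 1 2 by simp
qed

lemma the_inverse_eq: "isom A B f g \<Longrightarrow> the_inverse \<A> A B f = g"
  unfolding the_inverse_def using inverse_mor_unique by blast

lemma inverse_mor_cmp:
  assumes "isom A B f g" "isom B C f' g'"
  shows "isom A C (f' \<cdot> f) (g \<cdot> g')"
proof -
  note 1 = inverse_morD[OF assms(1)] and 2 = inverse_morD[OF assms(2)]
  have "g \<cdot> (g' \<cdot> (f' \<cdot> f)) = g \<cdot> ((g' \<cdot> f') \<cdot> f)" using 1(1-8) 2(1-8) by simp
  moreover have "f' \<cdot> (f \<cdot> (g \<cdot> g')) = f' \<cdot> ((f \<cdot> g) \<cdot> g')" using 1(1-8) 2(1-8) by simp
  ultimately show ?thesis using 1 2 by (simp add: inverse_mor_def hom_iff)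
qed

lemma inverse_mor_idt: "A \<in> Ob \<A> \<Longrightarrow> isom A A (idt A) (idt A)"
  by (simp add: inverse_mor_def hom_iff)

lemma inverse_mor_neg: "isom A B f g \<Longrightarrow> isom A B (\<ominus> f) (\<ominus> g)"
  by (auto simp: inverse_mor_def hom_iff)

lemma zero_object_hom:
  assumes "zero_object \<A> Z" "f \<in> Hom \<A> A Z \<or> f \<in> Hom \<A> Z A"
  shows "f = zmor (dm f) (cd f)"
  using assms unfolding zero_object_def by (metis hom_dm_cd hom_ob singletonD)

text \<open>The identity alone decides, since every morphism into or out of \<open>Z\<close> is a
  composite with it. In this form the notion passes to the stable category, where identities of
  objects of \<open>\<X>\<close> become zero.\<close>

lemma zero_object_iff: "zero_object \<A> Z \<longleftrightarrow> Z \<in> Ob \<A> \<and> idt Z = zmor Z Z"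
proof
  assume "zero_object \<A> Z"
  then show "Z \<in> Ob \<A> \<and> idt Z = zmor Z Z"
    using id_hom unfolding zero_object_def by fastforce
next
  assume *: "Z \<in> Ob \<A> \<and> idt Z = zmor Z Z"
  have "f = zmor Z A" if "f \<in> Hom \<A> Z A" for f A
  proof -
    have "f = f \<cdot> idt Z" using that by (simp add: hom_iff)
    then show ?thesis using * that by (simp add: hom_iff)
  qed
  moreover have "f = zmor A Z" if "f \<in> Hom \<A> A Z" for f A
  proof -
    have "f = idt Z \<cdot> f" using that by (simp add: hom_iff)
    then show ?thesis using * that by (simp add: hom_iff)
  qed
  ultimately show "zero_object \<A> Z"
    using * zero_hom unfolding zero_object_def by blast
qed

lemma biproductD:
  assumes "biproduct \<A> A B S i1 i2 p1 p2"
  shows "mor i1" "mor i2" "mor p1" "mor p2" "dm i1 = A" "dm i2 = B" "dm p1 = S" "dm p2 = S"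
    "cd i1 = S" "cd i2 = S" "cd p1 = A" "cd p2 = B" "A \<in> Ob \<A>" "B \<in> Ob \<A>" "S \<in> Ob \<A>"
    "p1 \<cdot> i1 = idt A" "p2 \<cdot> i2 = idt B" "p2 \<cdot> i1 = zmor A B" "p1 \<cdot> i2 = zmor B A"
    "i1 \<cdot> p1 \<oplus> i2 \<cdot> p2 = idt S"
  using assms unfolding biproduct_def hom_iff by auto

lemma biproduct_cancel:
  assumes "biproduct \<A> A B S i1 i2 p1 p2" "mor x"
  shows "cd x = A \<Longrightarrow> p1 \<cdot> (i1 \<cdot> x) = x" "cd x = B \<Longrightarrow> p2 \<cdot> (i2 \<cdot> x) = x"
    "cd x = A \<Longrightarrow> p2 \<cdot> (i1 \<cdot> x) = zmor (dm x) B" "cd x = B \<Longrightarrow> p1 \<cdot> (i2 \<cdot> x) = zmor (dm x) A"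
  using cmp_eq_assoc[of p1 i1 _ x] cmp_eq_assoc[of p2 i2 _ x] cmp_eq_assoc[of p2 i1 _ x]
    cmp_eq_assoc[of p1 i2 _ x] biproductD[OF assms(1)] assms(2) by simp_all

lemma biproduct_expand:
  assumes "biproduct \<A> A B S i1 i2 p1 p2" "v \<in> Hom \<A> S Z"
  shows "v = v \<cdot> i1 \<cdot> p1 \<oplus> v \<cdot> i2 \<cdot> p2"
proof -
  have "v = v \<cdot> (i1 \<cdot> p1 \<oplus> i2 \<cdot> p2)" using assms biproductD[OF assms(1)] by (simp add: hom_iff)
  then show ?thesis using assms biproductD(1-15)[OF assms(1)] by (simp add: hom_iff)
qed

lemma biproduct_sym:
  assumes "biproduct \<A> A B S i1 i2 p1 p2" shows "biproduct \<A> B A S i2 i1 p2 p1"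
proof -
  note b = biproductD[OF assms]
  have "i2 \<cdot> p2 \<oplus> i1 \<cdot> p1 = i1 \<cdot> p1 \<oplus> i2 \<cdot> p2" by (rule add_commute) (use b(1-15) in simp_all)
  then show ?thesis using b by (simp add: biproduct_def hom_iff)
qed

text \<open>\<open>A\<close> itself serves as the sum of \<open>A\<close> and a zero object, so
  axioms on biproducts can be applied with a zero summand without changing any object.\<close>

lemma biproduct_zero:
  assumes "zero_object \<A> Z" "A \<in> Ob \<A>"
  shows "biproduct \<A> A Z A (idt A) (zmor Z A) (idt A) (zmor A Z)"
  using assms unfolding zero_object_iff by (simp add: biproduct_def hom_iff)

lemma additive_functorD:
  assumes "additive_functor \<A> F"
  shows "A \<in> Ob \<A> \<Longrightarrow> fob F A \<in> Ob \<A>" "A \<in> Ob \<A> \<Longrightarrow> fmor F (idt A) = idt (fob F A)"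
    "mor f \<Longrightarrow> mor (fmor F f)" "mor f \<Longrightarrow> dm (fmor F f) = fob F (dm f)"
    "mor f \<Longrightarrow> cd (fmor F f) = fob F (cd f)"
    "mor f \<Longrightarrow> mor g \<Longrightarrow> cd f = dm g \<Longrightarrow> fmor F (g \<cdot> f) = fmor F g \<cdot> fmor F f"
    "mor f \<Longrightarrow> mor g \<Longrightarrow> dm f = dm g \<Longrightarrow> cd f = cd g \<Longrightarrow> fmor F (f \<oplus> g) = fmor F f \<oplus> fmor F g"
proof -
  show "A \<in> Ob \<A> \<Longrightarrow> fob F A \<in> Ob \<A>" "A \<in> Ob \<A> \<Longrightarrow> fmor F (idt A) = idt (fob F A)"
    using assms by (auto simp: additive_functor_def)
  show 1: "mor f \<Longrightarrow> mor (fmor F f)" "mor f \<Longrightarrow> dm (fmor F f) = fob F (dm f)"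
    "mor f \<Longrightarrow> cd (fmor F f) = fob F (cd f)" for f
    using assms mor_hom[of f] unfolding additive_functor_def by (meson hom_iff)+
  show "fmor F (g \<cdot> f) = fmor F g \<cdot> fmor F f" if "mor f" "mor g" "cd f = dm g"
    using assms mor_hom[of f] mor_hom[of g] that unfolding additive_functor_def by metis
  show "fmor F (f \<oplus> g) = fmor F f \<oplus> fmor F g" if "mor f" "mor g" "dm f = dm g" "cd f = cd g"
    using assms mor_hom[of f] mor_hom[of g] that unfolding additive_functor_def by metis
qed

lemma additive_functor_zero:
  assumes "additive_functor \<A> F" "A \<in> Ob \<A>" "B \<in> Ob \<A>"
  shows "fmor F (zmor A B) = zmor (fob F A) (fob F B)"
  using additive_functorD(7)[OF assms(1), of "zmor A B" "zmor A B"] assms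
    self_add_zero[of "fmor F (zmor A B)"] additive_functorD(3-5)[OF assms(1), of "zmor A B"]
  by simp

lemma additive_functor_neg:
  assumes "additive_functor \<A> F" "mor f"
  shows "fmor F (\<ominus> f) = \<ominus> (fmor F f)"
  using additive_functorD(7)[OF assms(1), of "f" "\<ominus> f"] assms additive_functor_zero[OF assms(1), of "dm f" "cd f"]
    neg_unique[of "fmor F f" "fmor F (\<ominus> f)"] additive_functorD(3-5)[OF assms(1)]
  by simp

end

section \<open>Presentations of triangulated categories\<close>

context additive_category
begin

lemma right_seq_iff:
  "right_seq \<A> F A B C (f, g, h) \<longleftrightarrow> mor f \<and> mor g \<and> mor h \<and> dm f = A \<and> cd f = B \<and> dm g = B \<and>
    cd g = C \<and> dm h = C \<and> cd h = fob F A \<and> A \<in> Ob \<A> \<and> B \<in> Ob \<A> \<and> C \<in> Ob \<A>"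
  unfolding right_seq_def hom_iff by auto (metis cd_Ob)

lemma right_seq_mor_iff:
  "right_seq_mor \<A> F (f, g, h) (f', g', h') \<alpha> \<beta> \<gamma> \<longleftrightarrow>
    mor f \<and> mor g \<and> mor h \<and> dm g = cd f \<and> dm h = cd g \<and> cd h = fob F (dm f) \<and>
    mor f' \<and> mor g' \<and> mor h' \<and> dm g' = cd f' \<and> dm h' = cd g' \<and> cd h' = fob F (dm f') \<and>
    mor \<alpha> \<and> dm \<alpha> = dm f \<and> cd \<alpha> = dm f' \<and> mor \<beta> \<and> dm \<beta> = cd f \<and> cd \<beta> = cd f' \<and>
    mor \<gamma> \<and> dm \<gamma> = cd g \<and> cd \<gamma> = cd g' \<and>
    \<beta> \<cdot> f = f' \<cdot> \<alpha> \<and> \<gamma> \<cdot> g = g' \<cdot> \<beta> \<and> fmor F \<alpha> \<cdot> h = h' \<cdot> \<gamma>"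
  unfolding right_seq_mor_def by (auto simp: right_seq_iff hom_iff)

lemma right_seq_iso_iff:
  "right_seq_iso \<A> F t t' \<longleftrightarrow> (\<exists>\<alpha> \<beta> \<gamma> \<alpha>' \<beta>' \<gamma>'. right_seq_mor \<A> F t t' \<alpha> \<beta> \<gamma> \<and>
     isom (dm \<alpha>) (cd \<alpha>) \<alpha> \<alpha>' \<and> isom (dm \<beta>) (cd \<beta>) \<beta> \<beta>' \<and>
     isom (dm \<gamma>) (cd \<gamma>) \<gamma> \<gamma>')"
  unfolding right_seq_iso_def iso_mor_def by (metis inverse_morD(3,4))

lemma square_inverse:
  assumes "isom A A' \<alpha> \<alpha>'" "isom B B' \<beta> \<beta>'"
    "mor f" "mor f'" "dm f = A" "cd f = B" "dm f' = A'" "cd f' = B'" "\<beta> \<cdot> f = f' \<cdot> \<alpha>"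
  shows "\<beta>' \<cdot> f' = f \<cdot> \<alpha>'"
proof -
  note a = inverse_morD[OF assms(1)] and b = inverse_morD[OF assms(2)]
  have "\<beta>' \<cdot> f' = \<beta>' \<cdot> (f' \<cdot> \<alpha>) \<cdot> \<alpha>'"
    using a b assms(3-8) by simp
  also have "\<dots> = (\<beta>' \<cdot> \<beta>) \<cdot> (f \<cdot> \<alpha>')"
    unfolding assms(9)[symmetric] using a(1-8) b(1-8) assms(3-8) by simp
  finally show ?thesis using a b assms(3-8) by simp
qed

end

locale shift_category = additive_category \<A> for \<A> :: "('o, 'm) acat" (structure) +
  fixes F :: "('o, 'm) endofun"
  assumes shift_fun: "additive_functor \<A> F"
begin

abbreviation smor where "smor \<equiv> right_seq_mor \<A> F"

lemmas shift_simps [simp] = additive_functorD[OF shift_fun] additive_functor_zero[OF shift_fun]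
  additive_functor_neg[OF shift_fun]

lemma inverse_mor_shift:
  assumes "isom A B f g"
  shows "isom (fob F A) (fob F B) (fmor F f) (fmor F g)"
proof -
  note i = inverse_morD[OF assms]
  have "fmor F g \<cdot> fmor F f = fmor F (g \<cdot> f)" "fmor F f \<cdot> fmor F g = fmor F (f \<cdot> g)"
    using i(1-8) by simp_all
  then show ?thesis unfolding i(9,10) using i(1-8) by (simp add: inverse_mor_def hom_iff)
qed

section \<open>Right sequences up to isomorphism\<close>

lemma right_seq_mor_cmp:
  assumes "smor t t' \<alpha> \<beta> \<gamma>" "smor t' t'' \<alpha>' \<beta>' \<gamma>'"
  shows "smor t t'' (\<alpha>' \<cdot> \<alpha>) (\<beta>' \<cdot> \<beta>) (\<gamma>' \<cdot> \<gamma>)"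
proof -
  obtain f g h f' g' h' f'' g'' h'' where t: "t = (f, g, h)" "t' = (f', g', h')" "t'' = (f'', g'', h'')"
    by (metis prod.exhaust)
  note a = assms[unfolded t right_seq_mor_iff]
  have 1: "\<beta> \<cdot> f = f' \<cdot> \<alpha>" "\<gamma> \<cdot> g = g' \<cdot> \<beta>" "fmor F \<alpha> \<cdot> h = h' \<cdot> \<gamma>"
    "\<beta>' \<cdot> f' = f'' \<cdot> \<alpha>'" "\<gamma>' \<cdot> g' = g'' \<cdot> \<beta>'" "fmor F \<alpha>' \<cdot> h' = h'' \<cdot> \<gamma>'"
    using a by auto
  show ?thesis
    unfolding t right_seq_mor_iff using a
    by (simp add: 1 1[THEN cmp_eq_assoc])
qed

lemma right_seq_mor_inverse:
  assumes "smor t t' \<alpha> \<beta> \<gamma>" "isom A A' \<alpha> \<alpha>'" "isom B B' \<beta> \<beta>'"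
    "isom C C' \<gamma> \<gamma>'"
  shows "smor t' t \<alpha>' \<beta>' \<gamma>'"
proof -
  obtain f g h f' g' h' where t: "t = (f, g, h)" "t' = (f', g', h')"
    by (metis prod.exhaust)
  note a = assms(1)[unfolded t right_seq_mor_iff] inverse_morD[OF assms(2)] inverse_morD[OF assms(3)]
    inverse_morD[OF assms(4)]
  have "\<beta>' \<cdot> f' = f \<cdot> \<alpha>'" by (rule square_inverse[OF assms(2,3)]) (use a in auto)
  moreover have "\<gamma>' \<cdot> g' = g \<cdot> \<beta>'" by (rule square_inverse[OF assms(3,4)]) (use a in auto)
  moreover have "fmor F \<alpha>' \<cdot> h' = h \<cdot> \<gamma>'"
    by (rule square_inverse[OF assms(4) inverse_mor_shift[OF assms(2)]]) (use a in auto)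
  ultimately show ?thesis
    unfolding t right_seq_mor_iff using a by auto
qed

lemma right_seq_isoI:
  assumes "smor t t' \<alpha> \<beta> \<gamma>" "isom A A' \<alpha> \<alpha>'" "isom B B' \<beta> \<beta>'"
    "isom C C' \<gamma> \<gamma>'"
  shows "right_seq_iso \<A> F t t'"
  using assms unfolding right_seq_iso_def iso_mor_def by blast

lemma right_seq_iso_sym:
  assumes "right_seq_iso \<A> F t t'" shows "right_seq_iso \<A> F t' t"
proof -
  obtain \<alpha> \<beta> \<gamma> \<alpha>' \<beta>' \<gamma>' where 1: "smor t t' \<alpha> \<beta> \<gamma>"
    "isom (dm \<alpha>) (cd \<alpha>) \<alpha> \<alpha>'" "isom (dm \<beta>) (cd \<beta>) \<beta> \<beta>'"
     "isom (dm \<gamma>) (cd \<gamma>) \<gamma> \<gamma>'" using assms unfolding right_seq_iso_iff by blast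
  show ?thesis
    by (rule right_seq_isoI[OF right_seq_mor_inverse[OF 1] 1(2-4)[THEN inverse_mor_sym]])
qed

lemma right_seq_iso_trans:
  assumes "right_seq_iso \<A> F t t'" "right_seq_iso \<A> F t' t''" shows "right_seq_iso \<A> F t t''"
proof -
  obtain \<alpha> \<beta> \<gamma> \<alpha>' \<beta>' \<gamma>' where 1: "smor t t' \<alpha> \<beta> \<gamma>"
    "isom (dm \<alpha>) (cd \<alpha>) \<alpha> \<alpha>'" "isom (dm \<beta>) (cd \<beta>) \<beta> \<beta>'"
     "isom (dm \<gamma>) (cd \<gamma>) \<gamma> \<gamma>'" using assms(1) unfolding right_seq_iso_iff by blast
  obtain \<alpha>2 \<beta>2 \<gamma>2 \<alpha>2' \<beta>2' \<gamma>2' where 2: "smor t' t'' \<alpha>2 \<beta>2 \<gamma>2"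
    "isom (dm \<alpha>2) (cd \<alpha>2) \<alpha>2 \<alpha>2'" "isom (dm \<beta>2) (cd \<beta>2) \<beta>2 \<beta>2'"
     "isom (dm \<gamma>2) (cd \<gamma>2) \<gamma>2 \<gamma>2'" using assms(2) unfolding right_seq_iso_iff by blast
  obtain f g h f' g' h' f'' g'' h'' where t: "t = (f, g, h)" "t' = (f', g', h')" "t'' = (f'', g'', h'')"
    by (metis prod.exhaust)
  have e: "dm \<alpha>2 = cd \<alpha>" "dm \<beta>2 = cd \<beta>" "dm \<gamma>2 = cd \<gamma>"
    using 1(1) 2(1) unfolding t right_seq_mor_iff by simp_all
  show ?thesis
    unfolding right_seq_iso_def iso_mor_def
    using right_seq_mor_cmp[OF 1(1) 2(1)] inverse_mor_cmp[OF 1(2) 2(2)[unfolded e]]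
      inverse_mor_cmp[OF 1(3) 2(3)[unfolded e]] inverse_mor_cmp[OF 1(4) 2(4)[unfolded e]]
    by blast
qed

lemma right_seq_iso_refl:
  assumes "right_seq \<A> F A B C t" shows "right_seq_iso \<A> F t t"
proof -
  obtain f g h where t: "t = (f, g, h)" by (metis prod.exhaust)
  note a = assms[unfolded t right_seq_iff]
  show ?thesis
    by (rule right_seq_isoI[OF _ inverse_mor_idt inverse_mor_idt inverse_mor_idt,
          of _ _ A B C])
      (use a in \<open>auto simp: t right_seq_mor_iff\<close>)
qed

end

text \<open>It suffices to rotate one triangle on each morphism and to have the octahedron for one choice of
  triangles, up to isomorphism of the two composable morphisms.\<close>

locale standard_triangles = shift_category \<A> F for \<A> :: "('o, 'm) acat" (structure) and F +
  fixes D :: "'m seq set" and tri :: "'m seq set"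
  assumes tri_def: "tri = {t. \<exists>s\<in>D. right_seq_iso \<A> F s t}"
    and std_seq: "t \<in> D \<Longrightarrow> \<exists>A B C. right_seq \<A> F A B C t"
    and std_id: "A \<in> Ob \<A> \<Longrightarrow>
      \<exists>Z. zero_object \<A> Z \<and> (idt A, zmor A Z, zmor Z (fob F A)) \<in> D"
    and std_TR3: "(f, g, h) \<in> D \<Longrightarrow> (f', g', h') \<in> D \<Longrightarrow>
      f \<in> Hom \<A> A B \<Longrightarrow> f' \<in> Hom \<A> A' B' \<Longrightarrow> \<alpha> \<in> Hom \<A> A A' \<Longrightarrow> \<beta> \<in> Hom \<A> B B' \<Longrightarrow>
      \<beta> \<cdot> f = f' \<cdot> \<alpha> \<Longrightarrow> \<exists>\<gamma>. smor (f, g, h) (f', g', h') \<alpha> \<beta> \<gamma>"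
    and std_coker: "(f, g, h) \<in> D \<Longrightarrow> right_seq \<A> F A B C (f, g, h) \<Longrightarrow>
      k \<in> Hom \<A> C Z \<Longrightarrow> k \<cdot> g = zmor B Z \<Longrightarrow> \<exists>x\<in>Hom \<A> (fob F A) Z. k = x \<cdot> h"
    and ex_rotation: "f \<in> Hom \<A> A B \<Longrightarrow> \<exists>g h. (f, g, h) \<in> tri \<and> (\<ominus> g, h, fmor F f) \<in> tri"
    and ex_octahedron: "f \<in> Hom \<A> A B \<Longrightarrow> g \<in> Hom \<A> B C \<Longrightarrow>
      \<exists>B1 C1 \<beta> \<beta>' \<delta> \<delta>' f1 g1 l a h j k b r s. isom B B1 \<beta> \<beta>' \<and> isom C C1 \<delta> \<delta>' \<and>
        f1 \<in> Hom \<A> A B1 \<and> g1 \<in> Hom \<A> B1 C1 \<and> \<beta> \<cdot> f = f1 \<and> \<delta> \<cdot> g = g1 \<cdot> \<beta> \<and>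
        (f1, l, a) \<in> tri \<and> (g1, h, j) \<in> tri \<and> (g1 \<cdot> f1, k, b) \<in> tri \<and>
        r \<cdot> l = k \<cdot> g1 \<and> b \<cdot> r = a \<and> s \<cdot> k = h \<and> j \<cdot> s = fmor F f1 \<cdot> b \<and>
        (r, s, fmor F l \<cdot> j) \<in> tri \<and> (\<exists>C' B' A'. right_seq \<A> F A B1 C' (f1, l, a) \<and>
          right_seq \<A> F B1 C1 A' (g1, h, j) \<and> right_seq \<A> F A C1 B' (g1 \<cdot> f1, k, b) \<and>
          r \<in> Hom \<A> C' B' \<and> s \<in> Hom \<A> B' A')"
begin

section \<open>The axioms for the isomorphism closure of \<open>D\<close>\<close>

lemma tri_iso: "t \<in> tri \<Longrightarrow> right_seq_iso \<A> F t t' \<Longrightarrow> t' \<in> tri"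
  unfolding tri_def using right_seq_iso_trans by blast

lemma tri_right_seq:
  assumes "t \<in> tri" shows "\<exists>A B C. right_seq \<A> F A B C t"
  using assms unfolding tri_def right_seq_iso_def right_seq_mor_def by blast

lemma tri_hom:
  assumes "(f, g, h) \<in> tri"
  shows "mor f" "mor g" "mor h" "dm g = cd f" "dm h = cd g" "cd h = fob F (dm f)"
  using tri_right_seq[OF assms] unfolding right_seq_iff by auto

lemma tri_std:
  assumes "t \<in> tri"
  obtains s \<alpha> \<beta> \<gamma> \<alpha>' \<beta>' \<gamma>' where "s \<in> D" "smor s t \<alpha> \<beta> \<gamma>" "smor t s \<alpha>' \<beta>' \<gamma>'"
    "isom (dm \<alpha>) (cd \<alpha>) \<alpha> \<alpha>'" "isom (dm \<beta>) (cd \<beta>) \<beta> \<beta>'"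
    "isom (dm \<gamma>) (cd \<gamma>) \<gamma> \<gamma>'"
proof -
  obtain s \<alpha> \<beta> \<gamma> \<alpha>' \<beta>' \<gamma>' where 1: "s \<in> D" "smor s t \<alpha> \<beta> \<gamma>"
    "isom (dm \<alpha>) (cd \<alpha>) \<alpha> \<alpha>'" "isom (dm \<beta>) (cd \<beta>) \<beta> \<beta>'"
    "isom (dm \<gamma>) (cd \<gamma>) \<gamma> \<gamma>'"
    using assms unfolding tri_def right_seq_iso_iff by blast
  show thesis by (rule that[OF 1(1,2) right_seq_mor_inverse[OF 1(2-5)] 1(3-5)])
qed

text \<open>\<open>std_TR3\<close> speaks of \<open>D\<close> only. The pair is conjugated by
  isomorphisms to standard triangles, filled there and carried back; the conjugating isomorphisms
  cancel on the first two objects.\<close>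

lemma tri_TR3:
  assumes "(f, g, h) \<in> tri" "(f', g', h') \<in> tri" "\<alpha> \<in> Hom \<A> (dm f) (dm f')" "\<beta> \<in> Hom \<A> (cd f) (cd f')"
    "\<beta> \<cdot> f = f' \<cdot> \<alpha>"
  shows "\<exists>\<gamma>. smor (f, g, h) (f', g', h') \<alpha> \<beta> \<gamma>"
proof -
  obtain s a b c a' b' c' where s: "s \<in> D" "smor s (f, g, h) a b c"
    "smor (f, g, h) s a' b' c'" "isom (dm a) (cd a) a a'"
    "isom (dm b) (cd b) b b'"
    using tri_std[OF assms(1)] by metis
  obtain s2 a2 b2 c2 a2' b2' c2' where s2: "s2 \<in> D" "smor s2 (f', g', h') a2 b2 c2"
    "smor (f', g', h') s2 a2' b2' c2'" "isom (dm a2) (cd a2) a2 a2'"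
    "isom (dm b2) (cd b2) b2 b2'"
    using tri_std[OF assms(2)] by metis
  obtain u v w u2 v2 w2 where t: "s = (u, v, w)" "s2 = (u2, v2, w2)" by (metis prod.exhaust)
  note ty = s(2,3)[unfolded t right_seq_mor_iff] s2(2,3)[unfolded t right_seq_mor_iff]
    assms(3,4)[unfolded hom_iff]
  have e: "b \<cdot> u = f \<cdot> a" "b2' \<cdot> f' = u2 \<cdot> a2'" using ty by auto
  have "(b2' \<cdot> \<beta> \<cdot> b) \<cdot> u = u2 \<cdot> (a2' \<cdot> \<alpha> \<cdot> a)"
    using ty assms(5) by (simp add: e e[THEN cmp_eq_assoc] assms(5)[THEN cmp_eq_assoc])
  then obtain c3 where "smor s s2 (a2' \<cdot> \<alpha> \<cdot> a) (b2' \<cdot> \<beta> \<cdot> b) c3"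
    using std_TR3[OF s(1)[unfolded t] s2(1)[unfolded t],
      of "dm u" "cd u" "dm u2" "cd u2" "a2' \<cdot> \<alpha> \<cdot> a" "b2' \<cdot> \<beta> \<cdot> b"] ty t
    by (auto simp: hom_iff)
  from right_seq_mor_cmp[OF right_seq_mor_cmp[OF s(3) this] s2(2)]
  have *: "smor (f, g, h) (f', g', h') (a2 \<cdot> (a2' \<cdot> \<alpha> \<cdot> a \<cdot> a')) (b2 \<cdot> (b2' \<cdot> \<beta> \<cdot> b \<cdot> b')) (c2 \<cdot> (c3 \<cdot> c'))" .
  have 1: "a \<cdot> a' = idt (cd a)" "a2 \<cdot> a2' = idt (cd a2)" "b \<cdot> b' = idt (cd b)" "b2 \<cdot> b2' = idt (cd b2)"
    using s(4,5) s2(4,5) by (simp_all add: inverse_mor_def)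
  have "a2 \<cdot> (a2' \<cdot> \<alpha> \<cdot> a \<cdot> a') = \<alpha>" "b2 \<cdot> (b2' \<cdot> \<beta> \<cdot> b \<cdot> b') = \<beta>"
    using ty by (simp_all add: 1 1[THEN cmp_eq_assoc])
  then show ?thesis using * by metis
qed

text \<open>Exactness at the third object, transported along an isomorphism with a standard
  triangle. It is what makes fillers of identities unipotent.\<close>

lemma tri_coker:
  assumes "(f, g, h) \<in> tri" "k \<in> Hom \<A> (cd g) Z" "k \<cdot> g = zmor (cd f) Z"
  shows "\<exists>x\<in>Hom \<A> (cd h) Z. k = x \<cdot> h"
proof -
  obtain s a b c a' b' c' where s: "s \<in> D" "smor s (f, g, h) a b c"
    "smor (f, g, h) s a' b' c'" "isom (dm c) (cd c) c c'"
    using tri_std[OF assms(1)] by metis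
  obtain u v w where t: "s = (u, v, w)" by (metis prod.exhaust)
  note ty = s(2,3)[unfolded t right_seq_mor_iff] assms(2)[unfolded hom_iff]
  have e: "c \<cdot> v = g \<cdot> b" using ty by auto
  have "(k \<cdot> c) \<cdot> v = zmor (cd u) Z"
    using ty by (simp add: e assms(3)[THEN cmp_eq_assoc])
  then obtain x where x: "x \<in> Hom \<A> (fob F (dm u)) Z" "k \<cdot> c = x \<cdot> w"
    using std_coker[OF s(1)[unfolded t], of "dm u" "cd u" "cd v" "k \<cdot> c" Z] ty
    by (auto simp: hom_iff right_seq_iff)
  have "k = k \<cdot> c \<cdot> c'" using ty s(4) by (simp add: inverse_mor_def)
  also have "\<dots> = x \<cdot> (w \<cdot> c')" using x ty by (simp add: hom_iff)
  also have "w \<cdot> c' = fmor F a' \<cdot> h" using ty by simp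
  finally have "k = (x \<cdot> fmor F a') \<cdot> h" using ty x by (simp add: hom_iff)
  moreover have "x \<cdot> fmor F a' \<in> Hom \<A> (cd h) Z" using ty x by (simp add: hom_iff)
  ultimately show ?thesis by blast
qed

text \<open>An endomorphism \<open>(1, 1, \<gamma>)\<close> of a triangle is unipotent: \<open>(\<gamma> - 1)\<^sup>2 = 0\<close>.\<close>

lemma tri_endo_iso:
  assumes "(f, g, h) \<in> tri" "\<gamma> \<in> Hom \<A> (cd g) (cd g)" "\<gamma> \<cdot> g = g" "h \<cdot> \<gamma> = h"
  shows "\<exists>\<gamma>'. isom (cd g) (cd g) \<gamma> \<gamma>'"
proof -
  note ty = tri_hom[OF assms(1)] assms(2)[unfolded hom_iff]
  define e where "e = \<gamma> \<oplus> (\<ominus> idt (cd g))"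
  have e: "mor e" "dm e = cd g" "cd e = cd g" using ty by (simp_all add: e_def)
  have \<gamma>: "\<gamma> = idt (cd g) \<oplus> e"
    using ty by (simp add: e_def add_left_commute)
  \<comment> \<open>\<open>e\<close> vanishes on \<open>g\<close>, so it factors as
    \<open>x \<cdot> h\<close>; since \<open>h \<cdot> e\<close> is zero as well,
    \<open>e \<cdot> e = x \<cdot> (h \<cdot> e)\<close> vanishes.\<close>
  have "e \<cdot> g = zmor (cd f) (cd g)" "h \<cdot> e = zmor (cd g) (cd h)"
    using ty assms(3,4) by (simp_all add: e_def)
  moreover from tri_coker[OF assms(1), of e "cd g"] this(1) obtain x where
    x: "x \<in> Hom \<A> (cd h) (cd g)" "e = x \<cdot> h" using e ty by (auto simp: hom_iff)
  ultimately have "e \<cdot> e = zmor (cd g) (cd g)" using ty e(1)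
    by (metis (no_types, lifting) assoc hom_iff zero_cmp(2) x e cd_Ob)
  then have "isom (cd g) (cd g) \<gamma> (idt (cd g) \<oplus> (\<ominus> e))"
    unfolding \<gamma> using e ty by (simp add: inverse_mor_def hom_iff add_assoc)
  then show ?thesis by blast
qed

text \<open>\<open>w \<cdot> v\<close> is a left inverse of \<open>u\<close> and
  \<open>v \<cdot> w'\<close> a right inverse, so the two agree. The form suits fillers in opposite
  directions, which need not be inverse to each other.\<close>

lemma two_sided_iso:
  assumes "u \<in> Hom \<A> A B" "v \<in> Hom \<A> B A" "isom A A (v \<cdot> u) w" "isom B B (u \<cdot> v) w'"
  shows "\<exists>u'. isom A B u u'"
proof -
  note ty = assms(1,2)[unfolded hom_iff] inverse_morD(1-8)[OF assms(3)] inverse_morD(1-8)[OF assms(4)]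
  have 1: "(w \<cdot> v) \<cdot> u = idt A" "u \<cdot> (v \<cdot> w') = idt B"
    using inverse_morD(9)[OF assms(3)] inverse_morD(10)[OF assms(4)] ty by simp_all
  have "w \<cdot> v = (w \<cdot> v) \<cdot> (u \<cdot> (v \<cdot> w'))" using ty 1(2) by simp
  also have "\<dots> = ((w \<cdot> v) \<cdot> u) \<cdot> (v \<cdot> w')" using ty by simp
  finally have "w \<cdot> v = v \<cdot> w'" unfolding 1(1) using ty by simp
  then have "isom A B u (w \<cdot> v)" using ty 1 by (simp add: inverse_mor_def hom_iff)
  then show ?thesis by blast
qed

text \<open>In place of the five lemma: fill the given pair and the inverse pair. Both composites of
  the fillers lie over identities on the first two objects, hence are invertible, and so is each
  filler.\<close>

lemma tri_iso_third:
  assumes "(f, g, h) \<in> tri" "(f', g', h') \<in> tri" "isom (dm f) (dm f') \<alpha> \<alpha>'"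
    "isom (cd f) (cd f') \<beta> \<beta>'" "\<beta> \<cdot> f = f' \<cdot> \<alpha>"
  shows "\<exists>\<gamma> \<gamma>'. smor (f, g, h) (f', g', h') \<alpha> \<beta> \<gamma> \<and> isom (cd g) (cd g') \<gamma> \<gamma>'"
proof -
  note ty = tri_hom[OF assms(1)] tri_hom[OF assms(2)] inverse_morD[OF assms(3)] inverse_morD[OF assms(4)]
  obtain \<gamma> where g: "smor (f, g, h) (f', g', h') \<alpha> \<beta> \<gamma>"
    using tri_TR3[OF assms(1,2) _ _ assms(5)] ty by (auto simp: hom_iff)
  have "\<beta>' \<cdot> f' = f \<cdot> \<alpha>'" by (rule square_inverse[OF assms(3,4)]) (use ty assms(5) in auto)
  then obtain \<delta> where d: "smor (f', g', h') (f, g, h) \<alpha>' \<beta>' \<delta>"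
    using tri_TR3[OF assms(2,1), of \<alpha>' \<beta>'] ty by (auto simp: hom_iff)
  have "smor (f, g, h) (f, g, h) (idt (dm f)) (idt (cd f)) (\<delta> \<cdot> \<gamma>)"
    using right_seq_mor_cmp[OF g d] ty by simp
  then have 1: "\<delta> \<cdot> \<gamma> \<in> Hom \<A> (cd g) (cd g)" "\<delta> \<cdot> \<gamma> \<cdot> g = g" "h \<cdot> (\<delta> \<cdot> \<gamma>) = h"
    unfolding right_seq_mor_iff hom_iff using ty by simp_all
  have "smor (f', g', h') (f', g', h') (idt (dm f')) (idt (cd f')) (\<gamma> \<cdot> \<delta>)"
    using right_seq_mor_cmp[OF d g] ty by simp
  then have 2: "\<gamma> \<cdot> \<delta> \<in> Hom \<A> (cd g') (cd g')" "\<gamma> \<cdot> \<delta> \<cdot> g' = g'" "h' \<cdot> (\<gamma> \<cdot> \<delta>) = h'"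
    unfolding right_seq_mor_iff hom_iff using ty by simp_all
  have "\<exists>\<gamma>'. isom (cd g) (cd g') \<gamma> \<gamma>'"
    using two_sided_iso[of \<gamma> "cd g" "cd g'" \<delta>] tri_endo_iso[OF assms(1) 1] tri_endo_iso[OF assms(2) 2]
      g d unfolding right_seq_mor_iff hom_iff by auto
  then show ?thesis using g by blast
qed

text \<open>The isomorphism is \<open>-1\<close> on the first object in one case and on the second
  in the other. The first case moves the sign of a rotated triangle from its first morphism to its
  last.\<close>

lemma tri_neg: 
  assumes "(f, g, h) \<in> tri" shows "(\<ominus> f, g, \<ominus> h) \<in> tri" "(\<ominus> f, \<ominus> g, h) \<in> tri"
proof -
  note ty = tri_hom[OF assms]
  have "smor (f, g, h) (\<ominus> f, g, \<ominus> h) (\<ominus> (idt (dm f))) (idt (cd f)) (idt (cd g))"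
    "smor (f, g, h) (\<ominus> f, \<ominus> g, h) (idt (dm f)) (\<ominus> (idt (cd f))) (idt (cd g))"
    using ty unfolding right_seq_mor_iff by simp_all
  from this[THEN right_seq_isoI[OF _ _ _ inverse_mor_idt]]
  show "(\<ominus> f, g, \<ominus> h) \<in> tri" "(\<ominus> f, \<ominus> g, h) \<in> tri"
    using tri_iso[OF assms] inverse_mor_neg[OF inverse_mor_idt] inverse_mor_idt ty
    by (metis dm_Ob cd_Ob)+
qed

text \<open>\<open>ex_rotation\<close> rotates some triangle on \<open>f\<close>. Any other differs
  from it by an isomorphism that is the identity on the first two objects; the same components,
  shifted by one place, identify the rotations.\<close>

lemma tri_rotate:
  assumes "(f, g, h) \<in> tri" shows "(g, h, \<ominus> (fmor F f)) \<in> tri"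
proof -
  note ty = tri_hom[OF assms]
  obtain g0 h0 where t: "(f, g0, h0) \<in> tri" "(\<ominus> g0, h0, fmor F f) \<in> tri"
    using ex_rotation[OF mor_hom[OF ty(1)]] by blast
  then have t: "(f, g0, h0) \<in> tri" "(g0, h0, \<ominus> (fmor F f)) \<in> tri"
    using tri_neg(1)[OF t(2)] tri_hom[OF t(1)] by simp_all
  obtain \<gamma> \<gamma>' where 1: "smor (f, g0, h0) (f, g, h) (idt (dm f)) (idt (cd f)) \<gamma>"
    "isom (cd g0) (cd g) \<gamma> \<gamma>'"
    using tri_iso_third[OF t(1) assms inverse_mor_idt inverse_mor_idt] ty by auto
  have "smor (g0, h0, \<ominus> (fmor F f)) (g, h, \<ominus> (fmor F f)) (idt (cd f)) \<gamma> (idt (fob F (dm f)))"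
    using 1(1) ty tri_hom[OF t(1)] unfolding right_seq_mor_iff by simp
  from right_seq_isoI[OF this inverse_mor_idt 1(2) inverse_mor_idt] tri_iso[OF t(2)]
  show ?thesis using ty by auto
qed

lemma tri_TR1_id:
  assumes "A \<in> Ob \<A>" "zero_object \<A> Z"
  shows "(idt A, zmor A Z, zmor Z (fob F A)) \<in> tri"
proof -
  obtain Z0 where Z0: "zero_object \<A> Z0" "(idt A, zmor A Z0, zmor Z0 (fob F A)) \<in> D"
    using std_id[OF assms(1)] by blast
  have z: "isom Z0 Z (zmor Z0 Z) (zmor Z Z0)"
    using assms(2) Z0(1) by (simp add: zero_object_iff inverse_mor_def hom_iff)
  have "smor (idt A, zmor A Z0, zmor Z0 (fob F A))
    (idt A, zmor A Z, zmor Z (fob F A)) (idt A) (idt A) (zmor Z0 Z)"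
    using assms Z0(1) by (simp add: zero_object_iff right_seq_mor_iff)
  from right_seq_isoI[OF this inverse_mor_idt inverse_mor_idt z] assms(1) Z0(2)
  show ?thesis unfolding tri_def by blast
qed

text \<open>The octahedron is available only for a replacement \<open>(f1, g1)\<close> and chosen
  triangles. Isomorphisms over \<open>(1, \<beta>)\<close>, \<open>(\<beta>, \<delta>)\<close> and
  \<open>(1, \<delta>)\<close> identify the three given triangles with the chosen ones, and the
  connecting morphisms are conjugated by their third components.\<close>

lemma tri_TR4:
  assumes f: "(f, l, a) \<in> tri" and g: "(g, h, j) \<in> tri" and gf: "(g \<cdot> f, k, b) \<in> tri" and fg: "cd f = dm g"
  shows "\<exists>r s. r \<in> Hom \<A> (cd l) (cd k) \<and> s \<in> Hom \<A> (cd k) (cd h) \<and>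
        r \<cdot> l = k \<cdot> g \<and> b \<cdot> r = a \<and> s \<cdot> k = h \<and> j \<cdot> s = fmor F f \<cdot> b \<and>
        (r, s, fmor F l \<cdot> j) \<in> tri"
proof -
  note t = tri_hom[OF f] tri_hom[OF g] tri_hom[OF gf]
  obtain B1 C1 \<beta> \<beta>' \<delta> \<delta>' f1 g1 l1 a1 h1 j1 k1 b1 r1 s1 where
    \<beta>: "isom (cd f) B1 \<beta> \<beta>'" and \<delta>: "isom (cd g) C1 \<delta> \<delta>'" and
    f1: "f1 \<in> Hom \<A> (dm f) B1" "g1 \<in> Hom \<A> B1 C1" "\<beta> \<cdot> f = f1" "\<delta> \<cdot> g = g1 \<cdot> \<beta>" and
    T: "(f1, l1, a1) \<in> tri" "(g1, h1, j1) \<in> tri" "(g1 \<cdot> f1, k1, b1) \<in> tri" and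
    O: "r1 \<cdot> l1 = k1 \<cdot> g1" "b1 \<cdot> r1 = a1" "s1 \<cdot> k1 = h1" "j1 \<cdot> s1 = fmor F f1 \<cdot> b1" and
    R: "(r1, s1, fmor F l1 \<cdot> j1) \<in> tri" and
    ty0: "\<exists>C' B' A'. right_seq \<A> F (dm f) B1 C' (f1, l1, a1) \<and>
          right_seq \<A> F B1 C1 A' (g1, h1, j1) \<and> right_seq \<A> F (dm f) C1 B' (g1 \<cdot> f1, k1, b1) \<and>
          r1 \<in> Hom \<A> C' B' \<and> s1 \<in> Hom \<A> B' A'"
    using ex_octahedron[OF mor_hom[OF t(1)] mor_hom[OF t(7), folded fg]] by blast
  have ty: "r1 \<in> Hom \<A> (dm a1) (dm b1)" "s1 \<in> Hom \<A> (dm b1) (dm j1)"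
    using ty0 unfolding right_seq_iff by auto
  note t = t inverse_morD(1-8)[OF \<beta>] inverse_morD(1-8)[OF \<delta>] f1(1,2)[unfolded hom_iff]
    tri_hom[OF T(1)] tri_hom[OF T(2)] tri_hom[OF T(3)] tri_hom[OF R] ty[unfolded hom_iff] fg
  have dmgf: "dm (g \<cdot> f) = dm f" "cd (g \<cdot> f) = cd g" "dm (g1 \<cdot> f1) = dm f1" "cd (g1 \<cdot> f1) = cd g1" using t by auto
  obtain \<gamma> \<gamma>' where \<gamma>: "smor (f, l, a) (f1, l1, a1) (idt (dm f)) \<beta> \<gamma>"
    "isom (cd l) (cd l1) \<gamma> \<gamma>'"
    using tri_iso_third[OF f T(1), of "idt (dm f)" "idt (dm f)" \<beta> \<beta>'] \<beta> f1 t inverse_mor_idt by auto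
  obtain \<epsilon> \<epsilon>' where \<epsilon>: "smor (g, h, j) (g1, h1, j1) \<beta> \<delta> \<epsilon>"
    "isom (cd h) (cd h1) \<epsilon> \<epsilon>'"
    using tri_iso_third[OF g T(2), of \<beta> \<beta>' \<delta> \<delta>'] \<beta> \<delta> f1 t by auto
  have e: "\<delta> \<cdot> (g \<cdot> f) = (g1 \<cdot> f1) \<cdot> idt (dm f)"
    using t f1(3) by (simp add: f1(4)[THEN cmp_eq_assoc])
  obtain \<zeta> \<zeta>' where \<zeta>: "smor (g \<cdot> f, k, b) (g1 \<cdot> f1, k1, b1) (idt (dm f)) \<delta> \<zeta>"
    "isom (cd k) (cd k1) \<zeta> \<zeta>'"
    using tri_iso_third[OF gf T(3), of "idt (dm f)" "idt (dm f)" \<delta> \<delta>'] \<delta> e t inverse_mor_idt by auto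
  note t = t inverse_morD(1-8)[OF \<gamma>(2)] inverse_morD(1-8)[OF \<epsilon>(2)] inverse_morD(1-8)[OF \<zeta>(2)]
  note inv = inverse_morD(9,10)[OF \<beta>] inverse_morD(9,10)[OF \<delta>] inverse_morD(9,10)[OF \<gamma>(2)]
    inverse_morD(9,10)[OF \<epsilon>(2)] inverse_morD(9,10)[OF \<zeta>(2)]
  have E: "\<gamma> \<cdot> l = l1 \<cdot> \<beta>" "a1 \<cdot> \<gamma> = a" "\<epsilon> \<cdot> h = h1 \<cdot> \<delta>" "fmor F \<beta> \<cdot> j = j1 \<cdot> \<epsilon>" "\<zeta> \<cdot> k = k1 \<cdot> \<delta>" "b1 \<cdot> \<zeta> = b"
    using \<gamma>(1) \<epsilon>(1) \<zeta>(1) t unfolding right_seq_mor_iff by simp_all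
  have E': "\<gamma>' \<cdot> l1 = l \<cdot> \<beta>'"
    by (rule square_inverse[OF \<beta> \<gamma>(2)]) (use t E in auto)
  have Ej: "fmor F \<beta>' \<cdot> j1 = j \<cdot> \<epsilon>'"
    by (rule square_inverse[OF \<epsilon>(2) inverse_mor_shift[OF \<beta>]]) (use t E in auto)
  have Ek: "k \<cdot> \<delta>' = \<zeta>' \<cdot> k1"
    by (rule square_inverse[OF \<delta> \<zeta>(2), symmetric]) (use t E in auto)
  have Eb: "b \<cdot> \<zeta>' = b1" unfolding E(6)[symmetric] using t inv by simp
  define r s where "r = \<zeta>' \<cdot> (r1 \<cdot> \<gamma>)" and "s = \<epsilon>' \<cdot> (s1 \<cdot> \<zeta>)"
  have rs: "mor r" "mor s" "dm r = cd l" "cd r = cd k" "dm s = cd k" "cd s = cd h"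
    unfolding r_def s_def using t by simp_all
  have 1: "r \<cdot> l = k \<cdot> g"
  proof -
    have "r \<cdot> l = \<zeta>' \<cdot> (k1 \<cdot> (g1 \<cdot> \<beta>))"
      unfolding r_def using t by (simp add: E(1) O(1)[THEN cmp_eq_assoc])
    also have "\<dots> = (\<zeta>' \<cdot> k1) \<cdot> (\<delta> \<cdot> g)" using t f1(4) by simp
    also have "\<dots> = k \<cdot> g" unfolding Ek[symmetric] using t inv by (simp add: inv[THEN cmp_eq_assoc])
    finally show ?thesis .
  qed
  have 2: "b \<cdot> r = a"
    unfolding r_def using t E(2) O(2) by (simp add: Eb[THEN cmp_eq_assoc] O(2)[THEN cmp_eq_assoc])
  have 3: "s \<cdot> k = h"
    unfolding s_def using t inv by (simp add: E(5) O(3)[THEN cmp_eq_assoc] E(3)[symmetric] inv[THEN cmp_eq_assoc])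
  \<comment> \<open>Of the four relations only this one involves the shift of the replaced morphism:
    \<open>f1 = \<beta> \<cdot> f\<close>, and \<open>\<beta>'\<close> cancels
    \<open>\<beta>\<close> under the shift.\<close>
  have 4: "j \<cdot> s = fmor F f \<cdot> b"
  proof -
    have "j \<cdot> s = fmor F \<beta>' \<cdot> (j1 \<cdot> s1) \<cdot> \<zeta>"
      unfolding s_def using t by (simp add: Ej[symmetric, THEN cmp_eq_assoc])
    also have "\<dots> = fmor F \<beta>' \<cdot> (fmor F (\<beta> \<cdot> f) \<cdot> b)"
      unfolding O(4) using t E(6) f1(3) by simp
    also have "\<dots> = fmor F (\<beta>' \<cdot> (\<beta> \<cdot> f)) \<cdot> b" using t by simp
    also have "\<beta>' \<cdot> (\<beta> \<cdot> f) = f" using t by (simp add: inv inv[THEN cmp_eq_assoc])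
    finally show ?thesis .
  qed
  have "smor (r1, s1, fmor F l1 \<cdot> j1) (r, s, fmor F l \<cdot> j) \<gamma>' \<zeta>' \<epsilon>'"
  proof -
    have "\<zeta>' \<cdot> r1 = r \<cdot> \<gamma>'" "\<epsilon>' \<cdot> s1 = s \<cdot> \<zeta>'"
      unfolding r_def s_def using t inv by simp_all
    moreover have "fmor F \<gamma>' \<cdot> (fmor F l1 \<cdot> j1) = fmor F (\<gamma>' \<cdot> l1) \<cdot> j1" using t by simp
    then have "fmor F \<gamma>' \<cdot> (fmor F l1 \<cdot> j1) = (fmor F l \<cdot> j) \<cdot> \<epsilon>'"
      unfolding E' using t Ej by simp
    ultimately show ?thesis unfolding right_seq_mor_iff using t rs by simp
  qed
  from right_seq_isoI[OF this \<gamma>(2)[THEN inverse_mor_sym] \<zeta>(2)[THEN inverse_mor_sym] \<epsilon>(2)[THEN inverse_mor_sym]]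
  have "(r, s, fmor F l \<cdot> j) \<in> tri" using tri_iso[OF R] by blast
  then show ?thesis using 1 2 3 4 rs t by (auto simp: hom_iff)
qed

text \<open>Both the given triangle and a chosen \<open>(f, g0, h0)\<close> rotate to triangles on
  \<open>- F f\<close>, which are isomorphic over identities. Full faithfulness brings the third
  component of that isomorphism back to an isomorphism from \<open>(f, g0, h0)\<close> to
  \<open>(f, g, h)\<close>.\<close>

lemma tri_rotate_back:
  assumes full: "\<And>A B c. A \<in> Ob \<A> \<Longrightarrow> B \<in> Ob \<A> \<Longrightarrow> c \<in> Hom \<A> (fob F A) (fob F B) \<Longrightarrow>
      \<exists>c0\<in>Hom \<A> A B. fmor F c0 = c"
    and faithful: "\<And>A B u v. u \<in> Hom \<A> A B \<Longrightarrow> v \<in> Hom \<A> A B \<Longrightarrow> fmor F u = fmor F v \<Longrightarrow> u = v"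
    and rs: "right_seq \<A> F A B C (f, g, h)" and t: "(g, h, \<ominus> (fmor F f)) \<in> tri"
  shows "(f, g, h) \<in> tri"
proof -
  note ty = rs[unfolded right_seq_iff]
  obtain g0 h0 where t0: "(f, g0, h0) \<in> tri"
    using ex_rotation[OF mor_hom[of f]] ty by blast
  note ty0 = tri_hom[OF t0]
  \<comment> \<open>From \<open>(g, h, - F f)\<close> two rotations lead to a triangle on
    \<open>- F f\<close>; from \<open>(f, g0, h0)\<close> it takes three.\<close>
  have 1: "(\<ominus> (fmor F f), \<ominus> (fmor F g), \<ominus> (fmor F h)) \<in> tri"
    using tri_rotate[OF tri_rotate[OF t]] .
  have 2: "(\<ominus> (fmor F f), \<ominus> (fmor F g0), \<ominus> (fmor F h0)) \<in> tri"
    using tri_rotate[OF tri_rotate[OF tri_rotate[OF t0]]] .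
  obtain c c' where c: "smor (\<ominus> (fmor F f), \<ominus> (fmor F g0), \<ominus> (fmor F h0))
      (\<ominus> (fmor F f), \<ominus> (fmor F g), \<ominus> (fmor F h)) (idt (fob F A)) (idt (fob F B)) c"
    "isom (fob F (cd g0)) (fob F C) c c'"
    using tri_iso_third[OF 2 1 inverse_mor_idt inverse_mor_idt] ty ty0 by auto
  obtain d where d: "d \<in> Hom \<A> (cd g0) C" "fmor F d = c"
    using full[of "cd g0" C c] inverse_morD[OF c(2)] ty ty0 by (auto simp: hom_iff)
  obtain d' where d': "d' \<in> Hom \<A> C (cd g0)" "fmor F d' = c'"
    using full[of C "cd g0" c'] inverse_morD[OF c(2)] ty ty0 by (auto simp: hom_iff)
  note dty = d(1)[unfolded hom_iff] d'(1)[unfolded hom_iff]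
  have "fmor F (d' \<cdot> d) = fmor F (idt (cd g0))" "fmor F (d \<cdot> d') = fmor F (idt C)"
    using dty d(2) d'(2) inverse_morD(9,10)[OF c(2)] by simp_all
  then have i: "isom (cd g0) C d d'"
    using faithful dty unfolding inverse_mor_def hom_iff
    by (metis cmp_mor idt_mor hom_iff)
  have "c \<cdot> (\<ominus> fmor F g0) = \<ominus> fmor F g" "\<ominus> fmor F h0 = (\<ominus> fmor F h) \<cdot> c"
    using c(1) ty ty0 unfolding right_seq_mor_iff by simp_all
  then have "\<ominus> fmor F (d \<cdot> g0) = \<ominus> fmor F g" "\<ominus> fmor F (h \<cdot> d) = \<ominus> fmor F h0"
    unfolding d(2)[symmetric] using dty ty ty0 by simp_all
  then have "fmor F (d \<cdot> g0) = fmor F g" "fmor F (h \<cdot> d) = fmor F h0"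
    using dty ty ty0 by simp_all
  then have "d \<cdot> g0 = g" "h \<cdot> d = h0"
    using faithful[of "d \<cdot> g0" B C g] faithful[of "h \<cdot> d" "cd g0" "fob F A" h0] dty ty ty0
    by (simp_all add: hom_iff)
  then have "smor (f, g0, h0) (f, g, h) (idt A) (idt B) d"
    unfolding right_seq_mor_iff using ty ty0 dty by simp
  from right_seq_isoI[OF this inverse_mor_idt inverse_mor_idt i] show ?thesis
    using tri_iso[OF t0] ty by blast
qed

theorem triangulated:
  assumes "autoequivalence \<A> F"
    and full: "\<And>A B c. A \<in> Ob \<A> \<Longrightarrow> B \<in> Ob \<A> \<Longrightarrow> c \<in> Hom \<A> (fob F A) (fob F B) \<Longrightarrow>
      \<exists>c0\<in>Hom \<A> A B. fmor F c0 = c"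
    and faithful: "\<And>A B u v. u \<in> Hom \<A> A B \<Longrightarrow> v \<in> Hom \<A> A B \<Longrightarrow> fmor F u = fmor F v \<Longrightarrow> u = v"
  shows "triangulated_category \<A> F tri"
proof
  show "autoequivalence \<A> F" by fact
  show "\<exists>A B C. right_seq \<A> F A B C t" if "t \<in> tri" for t using tri_right_seq[OF that] .
  show "t' \<in> tri" if "t \<in> tri" "right_seq_iso \<A> F t t'" for t t' using tri_iso[OF that] .
  show "(idt A, zmor A Z, zmor Z (fob F A)) \<in> tri" if "A \<in> Ob \<A>" "zero_object \<A> Z" for A Z
    using tri_TR1_id[OF that] .
  show "\<exists>g h. (f, g, h) \<in> tri" if "f \<in> Hom \<A> A B" for f A B using ex_rotation[OF that] by blast
  show "(f, g, h) \<in> tri \<longleftrightarrow> (g, h, \<ominus> (fmor F f)) \<in> tri" if "right_seq \<A> F A B C (f, g, h)" for A B C f g h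
    using tri_rotate[of f g h] tri_rotate_back[OF assms(2,3) that] by (rule iffI)
  show "\<exists>\<gamma>. smor (f, g, h) (f', g', h') \<alpha> \<beta> \<gamma>"
    if "(f, g, h) \<in> tri" "(f', g', h') \<in> tri" "f \<in> Hom \<A> A B" "f' \<in> Hom \<A> A' B'" "\<alpha> \<in> Hom \<A> A A'"
      "\<beta> \<in> Hom \<A> B B'" "\<beta> \<cdot> f = f' \<cdot> \<alpha>" for f g h f' g' h' A B A' B' \<alpha> \<beta>
    using tri_TR3[OF that(1,2) _ _ that(7)] that by (auto simp: hom_iff)
  show "\<exists>r s. r \<in> Hom \<A> C' B' \<and> s \<in> Hom \<A> B' A' \<and>
        r \<cdot> l = k \<cdot> g \<and> b \<cdot> r = a \<and> s \<cdot> k = h \<and> j \<cdot> s = fmor F f \<cdot> b \<and>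
        (r, s, fmor F l \<cdot> j) \<in> tri"
    if "(f, l, a) \<in> tri" "(g, h, j) \<in> tri" "(g \<cdot> f, k, b) \<in> tri"
      "right_seq \<A> F A B C' (f, l, a)" "right_seq \<A> F B C A' (g, h, j)"
      "right_seq \<A> F A C B' (g \<cdot> f, k, b)" for f l a g h j k b A B C A' B' C'
    using tri_TR4[OF that(1-3)] that(4-6) unfolding right_seq_iff by auto
qed

end

section \<open>The stable category\<close>

locale stable_category = additive_category \<A> for \<A> :: "('o, 'm) acat" (structure) +
  fixes \<C> \<X> :: "'o set"
  assumes C_sub: "additive_subcategory \<A> \<C>"
    and X_sub: "additive_subcategory \<A> \<X>"
    and X_le_C: "\<X> \<subseteq> \<C>"
begin

abbreviation K where "K \<equiv> stab \<A> \<C> \<X>"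
abbreviation stab_comp (infixl "\<cdot>\<^sub>K" 70) where "G \<cdot>\<^sub>K F \<equiv> Cmp K G F"
abbreviation stab_minus ("-\<^sub>K _" [81] 80) where "-\<^sub>K F \<equiv> Neg K F"
abbreviation cl where "cl \<equiv> stab_class \<A> \<X>"
abbreviation null where "null \<equiv> factors_through \<A> \<X>"

lemma C_Ob [simp]: "A \<in> \<C> \<Longrightarrow> A \<in> Ob \<A>" and X_in_C [simp]: "A \<in> \<X> \<Longrightarrow> A \<in> \<C>"
  using C_sub X_le_C unfolding additive_subcategory_def by blast+

lemma biproduct_C: "A \<in> \<C> \<Longrightarrow> B \<in> \<C> \<Longrightarrow> biproduct \<A> A B S i1 i2 p1 p2 \<Longrightarrow> S \<in> \<C>"
  using C_sub unfolding additive_subcategory_def by blast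

lemma biproduct_X: "A \<in> \<X> \<Longrightarrow> B \<in> \<X> \<Longrightarrow> biproduct \<A> A B S i1 i2 p1 p2 \<Longrightarrow> S \<in> \<X>"
  using X_sub unfolding additive_subcategory_def by blast

lemma zero_in_X: "zero_object \<A> Z \<Longrightarrow> Z \<in> \<X>"
  using X_sub unfolding additive_subcategory_def by blast

section \<open>The ideal of morphisms through \<open>\<X>\<close>, and classes modulo it\<close>

lemma null_iff: "null f \<longleftrightarrow> (\<exists>a b. mor a \<and> mor b \<and> cd a = dm b \<and> dm b \<in> \<X> \<and> f = b \<cdot> a)"
proof
  assume "null f"
  then obtain A B X a b where "X \<in> \<X>" "a \<in> Hom \<A> A X" "b \<in> Hom \<A> X B" "f = b \<cdot> a"
    unfolding factors_through_def by blast
  then show "\<exists>a b. mor a \<and> mor b \<and> cd a = dm b \<and> dm b \<in> \<X> \<and> f = b \<cdot> a"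
    by (auto simp: hom_iff)
next
  assume "\<exists>a b. mor a \<and> mor b \<and> cd a = dm b \<and> dm b \<in> \<X> \<and> f = b \<cdot> a"
  then obtain a b where "mor a" "mor b" "cd a = dm b" "dm b \<in> \<X>" "f = b \<cdot> a" by blast
  then show "null f"
    unfolding factors_through_def
    by (intro exI[of _ "dm a"] exI[of _ "cd b"] bexI[of _ "dm b"] bexI[of _ a] bexI[of _ b])
      (auto simp: hom_iff)
qed

lemma nullI: "mor a \<Longrightarrow> mor b \<Longrightarrow> cd a = dm b \<Longrightarrow> dm b \<in> \<X> \<Longrightarrow> null (b \<cdot> a)"
  unfolding null_iff by blast

lemma nullE:
  assumes "null f"
  obtains a b where "mor a" "mor b" "cd a = dm b" "dm b \<in> \<X>" "f = b \<cdot> a" "dm a = dm f" "cd b = cd f"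
  using assms unfolding null_iff by auto

lemma null_mor: "null f \<Longrightarrow> mor f"
  unfolding null_iff by auto

lemma null_cmp_left: assumes "null f" "mor g" "cd f = dm g" shows "null (g \<cdot> f)"
proof -
  obtain a b where "mor a" "mor b" "cd a = dm b" "dm b \<in> \<X>" "f = b \<cdot> a" using assms null_iff by auto
  then show ?thesis using nullI[of a "g \<cdot> b"] assms(2,3) by simp
qed

lemma null_cmp_right: assumes "null f" "mor g" "cd g = dm f" shows "null (f \<cdot> g)"
proof -
  obtain a b where "mor a" "mor b" "cd a = dm b" "dm b \<in> \<X>" "f = b \<cdot> a" using assms null_iff by auto
  then show ?thesis using nullI[of "a \<cdot> g" b] assms(2,3) by simp
qed

lemma null_neg: assumes "null f" shows "null (\<ominus> f)"
proof -
  obtain a b where "mor a" "mor b" "cd a = dm b" "dm b \<in> \<X>" "f = b \<cdot> a" using assms null_iff by auto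
  then show ?thesis using nullI[of "a" "\<ominus> b"] by simp
qed

text \<open>Two factorizations combine into one through the biproduct of the middle objects, which
  \<open>\<X>\<close> contains. With closure under composition this makes the null morphisms an
  ideal.\<close>

lemma null_add: assumes "null f" "null g" "dm f = dm g" "cd f = cd g" shows "null (f \<oplus> g)"
proof -
  obtain a b where 1: "mor a" "mor b" "cd a = dm b" "dm b \<in> \<X>" "f = b \<cdot> a" using assms null_iff by auto
  obtain a' b' where 2: "mor a'" "mor b'" "cd a' = dm b'" "dm b' \<in> \<X>" "g = b' \<cdot> a'" using assms null_iff by auto
  obtain S i1 i2 p1 p2 where B: "biproduct \<A> (dm b) (dm b') S i1 i2 p1 p2"
    using ex_biproduct 1 2 by (meson C_Ob X_in_C)
  note b = biproductD[OF B]
  have "f \<oplus> g = (b \<cdot> p1 \<oplus> b' \<cdot> p2) \<cdot> (i1 \<cdot> a \<oplus> i2 \<cdot> a')"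
    using b 1 2 assms(3,4) by (simp add: biproduct_cancel[OF B])
  moreover have "S \<in> \<X>" using biproduct_X 1 2 B by blast
  ultimately show ?thesis using nullI[of "i1 \<cdot> a \<oplus> i2 \<cdot> a'" "b \<cdot> p1 \<oplus> b' \<cdot> p2"] b 1 2 assms(3,4) by simp
qed

lemma null_X: "mor f \<Longrightarrow> dm f \<in> \<X> \<or> cd f \<in> \<X> \<Longrightarrow> null f"
  using nullI[of f "idt (cd f)"] nullI[of "idt (dm f)" f] by auto

lemma null_zero: "A \<in> Ob \<A> \<Longrightarrow> B \<in> Ob \<A> \<Longrightarrow> null (zmor A B)"
proof -
  assume AB: "A \<in> Ob \<A>" "B \<in> Ob \<A>"
  obtain Z where Z: "zero_object \<A> Z" using ex_zero_object by blast
  show "null (zmor A B)"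
    using nullI[of "zmor A Z" "zmor Z B"] zero_in_X[OF Z] AB by simp
qed

lemma cl_mem: "f' \<in> cl f \<longleftrightarrow> mor f \<and> mor f' \<and> dm f' = dm f \<and> cd f' = cd f \<and> null (f \<oplus> (\<ominus> f'))"
  unfolding stab_class_def by (auto simp: hom_iff)

lemma cl_refl: "mor f \<Longrightarrow> f \<in> cl f"
  by (simp add: cl_mem null_zero)

text \<open>Null morphisms form a subgroup of each hom set, and the classes are its cosets. A class
  also remembers the ends of its members, which keeps the stable hom sets disjoint.\<close>

lemma cl_eq_iff:
  assumes "mor f" "mor g"
  shows "cl f = cl g \<longleftrightarrow> dm f = dm g \<and> cd f = cd g \<and> null (f \<oplus> (\<ominus> g))"
proof
  assume "cl f = cl g"
  then have "g \<in> cl f" using cl_refl[OF assms(2)] by simp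
  then show "dm f = dm g \<and> cd f = cd g \<and> null (f \<oplus> (\<ominus> g))" by (auto simp: cl_mem)
next
  assume fg: "dm f = dm g \<and> cd f = cd g \<and> null (f \<oplus> (\<ominus> g))"
  have "null (f \<oplus> (\<ominus> x)) \<longleftrightarrow> null (g \<oplus> (\<ominus> x))" if x: "mor x" "dm x = dm g" "cd x = cd g" for x
  proof -
    have "f \<oplus> (\<ominus> x) = (f \<oplus> (\<ominus> g)) \<oplus> (g \<oplus> (\<ominus> x))"
      using assms fg x by (simp add: add_assoc)
    moreover have "\<ominus> (f \<oplus> (\<ominus> g)) = g \<oplus> (\<ominus> f)"
      using assms fg x by (simp add: add_commute)
    then have "g \<oplus> (\<ominus> x) = (\<ominus> (f \<oplus> (\<ominus> g))) \<oplus> (f \<oplus> (\<ominus> x))"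
      using assms fg x by (simp add: add_assoc)
    ultimately show ?thesis
      using null_add[of "f \<oplus> (\<ominus> g)" "g \<oplus> (\<ominus> x)"] null_neg[of "f \<oplus> (\<ominus> g)"]
        null_add[of "\<ominus> (f \<oplus> (\<ominus> g))" "f \<oplus> (\<ominus> x)"] assms fg x
      by (metis add_mor(1,2,3) neg_mor(1,2,3))
  qed
  then show "cl f = cl g" using assms fg by (auto simp: cl_mem)
qed

lemma cl_eqI: "mor f \<Longrightarrow> mor g \<Longrightarrow> dm f = dm g \<Longrightarrow> cd f = cd g \<Longrightarrow> null (f \<oplus> (\<ominus> g)) \<Longrightarrow> cl f = cl g"
  by (simp add: cl_eq_iff)

lemma cl_zero_iff: "mor f \<Longrightarrow> dm f = A \<Longrightarrow> cd f = B \<Longrightarrow> cl f = cl (zmor A B) \<longleftrightarrow> null f"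
  using cl_eq_iff[of f "zmor (dm f) (cd f)"] by auto

lemma cl_add_null: "mor f \<Longrightarrow> null x \<Longrightarrow> dm f = dm x \<Longrightarrow> cd f = cd x \<Longrightarrow> cl (f \<oplus> x) = cl f"
  using null_mor[of x] by (intro cl_eqI) (simp_all add: add_commute[of f x] add_assoc)

lemma stab_simps [simp]:
  "Ob K = \<C>" "Idt K A = cl (idt A)" "Zero K A B = cl (zmor A B)"
  by (simp_all add: stab_def)

lemma stab_hom_iff: "F \<in> Hom K A B \<longleftrightarrow> A \<in> \<C> \<and> B \<in> \<C> \<and> (\<exists>f. mor f \<and> dm f = A \<and> cd f = B \<and> F = cl f)"
  by (auto simp: stab_def hom_iff)

lemma stab_homI: "mor f \<Longrightarrow> dm f \<in> \<C> \<Longrightarrow> cd f \<in> \<C> \<Longrightarrow> dm f = A \<Longrightarrow> cd f = B \<Longrightarrow> cl f \<in> Hom K A B"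
  unfolding stab_hom_iff by blast

lemma stab_homE:
  assumes "F \<in> Hom K A B"
  obtains f where "mor f" "dm f = A" "cd f = B" "F = cl f" "A \<in> \<C>" "B \<in> \<C>"
  using assms unfolding stab_hom_iff by blast

text \<open>Composition of classes is a union over all representatives. All members of the union
  coincide, because \<open>g \<cdot> f - g' \<cdot> f' = g \<cdot> (f - f') + (g - g') \<cdot>
  f'\<close> lies in the ideal.\<close>

lemma stab_cmp [simp]:
  assumes "mor f" "mor g" "cd f = dm g"
  shows "cl g \<cdot>\<^sub>K cl f = cl (g \<cdot> f)"
proof -
  have "cl (g' \<cdot> f') = cl (g \<cdot> f)" if g': "g' \<in> cl g" and f': "f' \<in> cl f" for g' f'
  proof -
    note ty = g'[unfolded cl_mem] f'[unfolded cl_mem] assms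
    have "g \<cdot> f \<oplus> (\<ominus> (g' \<cdot> f')) = g \<cdot> (f \<oplus> (\<ominus> f')) \<oplus> (g \<oplus> (\<ominus> g')) \<cdot> f'"
      using ty by (simp add: add_assoc)
    moreover have "null (g \<cdot> (f \<oplus> (\<ominus> f')) \<oplus> (g \<oplus> (\<ominus> g')) \<cdot> f')"
      by (rule null_add[OF null_cmp_left null_cmp_right]) (use ty in auto)
    ultimately have "cl (g \<cdot> f) = cl (g' \<cdot> f')" using ty by (intro cl_eqI) auto
    then show ?thesis by simp
  qed
  moreover have "f \<in> cl f" "g \<in> cl g" using assms cl_refl by auto
  ultimately show ?thesis unfolding stab_def acat.simps by blast
qed

lemma stab_add [simp]:
  assumes "mor f" "mor g" "dm f = dm g" "cd f = cd g"
  shows "cl f \<oplus>\<^bsub>K\<^esub> cl g = cl (f \<oplus> g)"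
proof -
  have "cl (f' \<oplus> g') = cl (f \<oplus> g)" if g': "g' \<in> cl g" and f': "f' \<in> cl f" for g' f'
  proof -
    note ty = g'[unfolded cl_mem] f'[unfolded cl_mem] assms
    have "(f \<oplus> g) \<oplus> (\<ominus> (f' \<oplus> g')) = (f \<oplus> (\<ominus> f')) \<oplus> (g \<oplus> (\<ominus> g'))"
      using ty by (simp add: add_assoc add_left_commute)
    moreover have "null ((f \<oplus> (\<ominus> f')) \<oplus> (g \<oplus> (\<ominus> g')))"
      by (rule null_add) (use ty in auto)
    ultimately have "cl (f \<oplus> g) = cl (f' \<oplus> g')" using ty by (intro cl_eqI) auto
    then show ?thesis by simp
  qed
  moreover have "f \<in> cl f" "g \<in> cl g" using assms cl_refl by auto
  ultimately show ?thesis unfolding stab_def acat.simps by blast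
qed

lemma stab_neg [simp]:
  assumes "mor f" shows "-\<^sub>K cl f = cl (\<ominus> f)"
proof -
  have "cl (\<ominus> f') = cl (\<ominus> f)" if f': "f' \<in> cl f" for f'
  proof -
    note ty = f'[unfolded cl_mem] assms
    have "null (\<ominus> (f \<oplus> (\<ominus> f')))" using ty null_neg by blast
    then have "cl (\<ominus> f) = cl (\<ominus> f')" using ty by (intro cl_eqI) auto
    then show ?thesis by simp
  qed
  moreover have "f \<in> cl f" using assms cl_refl by auto
  ultimately show ?thesis unfolding stab_def acat.simps by blast
qed

lemma stab_biproduct:
  assumes "A \<in> \<C>" "B \<in> \<C>" "biproduct \<A> A B S i1 i2 p1 p2"
  shows "biproduct K A B S (cl i1) (cl i2) (cl p1) (cl p2)"
  using assms(1,2) biproduct_C[OF assms] biproductD[OF assms(3)] unfolding biproduct_def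
  by (auto intro!: stab_homI)

text \<open>Equations are checked on representatives, where they hold in \<open>\<A>\<close>. A zero
  object and biproducts of \<open>\<A>\<close> keep these roles, since \<open>\<C>\<close> contains
  them and classes respect their defining equations.\<close>

lemma stab_additive: "additive_category K"
proof (rule additive_category.intro)
  show "A \<in> Ob K \<and> B \<in> Ob K" if "f \<in> Hom K A B" for f A B
    using that by (simp add: stab_hom_iff)
  show "A = A' \<and> B = B'" if "f \<in> Hom K A B" "f \<in> Hom K A' B'" for f A B A' B'
    using that by (auto simp: stab_hom_iff cl_eq_iff)
  show "Idt K A \<in> Hom K A A" if "A \<in> Ob K" for A
    using that by (auto intro!: stab_homI)
  show "g \<cdot>\<^sub>K f \<in> Hom K A C" if "f \<in> Hom K A B" "g \<in> Hom K B C" for f g A B C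
    using that by (elim stab_homE) (auto intro!: stab_homI)
  show "f \<cdot>\<^sub>K Idt K A = f \<and> Idt K B \<cdot>\<^sub>K f = f" if "f \<in> Hom K A B" for f A B
    using that by (elim stab_homE) simp
  show "h \<cdot>\<^sub>K (g \<cdot>\<^sub>K f) = h \<cdot>\<^sub>K g \<cdot>\<^sub>K f" if "f \<in> Hom K A B" "g \<in> Hom K B C" "h \<in> Hom K C D"
    for f g h A B C D
    using that by (elim stab_homE) simp
  show "-\<^sub>K f \<in> Hom K A B \<and> f \<oplus>\<^bsub>K\<^esub> (-\<^sub>K f) = Zero K A B" if "f \<in> Hom K A B" for f A B
    using that by (elim stab_homE) (auto intro!: stab_homI)
  show "(g \<oplus>\<^bsub>K\<^esub> g') \<cdot>\<^sub>K f = g \<cdot>\<^sub>K f \<oplus>\<^bsub>K\<^esub> g' \<cdot>\<^sub>K f"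
    if "f \<in> Hom K A B" "g \<in> Hom K B C" "g' \<in> Hom K B C" for f g g' A B C
    using that by (elim stab_homE) simp
  show "g \<cdot>\<^sub>K (f \<oplus>\<^bsub>K\<^esub> f') = g \<cdot>\<^sub>K f \<oplus>\<^bsub>K\<^esub> g \<cdot>\<^sub>K f'"
    if "f \<in> Hom K A B" "f' \<in> Hom K A B" "g \<in> Hom K B C" for f f' g A B C
    using that by (elim stab_homE) simp
  show "comm_group \<lparr>carrier = Hom K A B, monoid.mult = Add K, one = Zero K A B\<rparr>"
    if "A \<in> Ob K" "B \<in> Ob K" for A B
  proof (rule comm_groupI, goal_cases)
    case (1 x y)
    then show ?case by simp (elim stab_homE, auto intro!: stab_homI)
  next
    case 2
    then show ?case using that by (auto intro!: stab_homI)
  next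
    case (3 x y z)
    then show ?case by simp (elim stab_homE, simp add: add_assoc)
  next
    case (4 x y)
    then show ?case by simp (elim stab_homE, simp add: add_commute)
  next
    case (5 x)
    then show ?case by simp (elim stab_homE, simp)
  next
    case (6 x)
    then have "-\<^sub>K x \<in> Hom K A B \<and> (-\<^sub>K x) \<oplus>\<^bsub>K\<^esub> x = Zero K A B"
      by simp (elim stab_homE, auto intro!: stab_homI)
    then show ?case by auto
  qed
  obtain Z where Z: "zero_object \<A> Z" using ex_zero_object by blast
  then have "Z \<in> \<C>" "idt Z = zmor Z Z" using zero_in_X zero_object_iff by auto
  have "f = Zero K Z A" if "f \<in> Hom K Z A" for f A
    using that by (elim stab_homE) (metis zero_object_hom[OF Z] mor_hom stab_simps(3))
  moreover have "f = Zero K A Z" if "f \<in> Hom K A Z" for f A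
    using that by (elim stab_homE) (metis zero_object_hom[OF Z] mor_hom stab_simps(3))
  moreover have "Zero K A B \<in> Hom K A B" if "A \<in> \<C>" "B \<in> \<C>" for A B
    using that by (auto intro!: stab_homI)
  ultimately have "zero_object K Z"
    unfolding zero_object_def using \<open>Z \<in> \<C>\<close> by (simp only: stab_simps(1)) blast
  then show "\<exists>Z. zero_object K Z" by blast
  show "\<exists>S i1 i2 p1 p2. biproduct K A B S i1 i2 p1 p2" if "A \<in> Ob K" "B \<in> Ob K" for A B
    using that stab_biproduct ex_biproduct[of A B] by (metis stab_simps(1) C_Ob)
qed

end

section \<open>Morphisms of right triangles and the suspension\<close>

context shift_category
begin

lemma right_seq_mor_diff:
  assumes "smor t t' \<alpha> \<beta> \<gamma>" "smor t t' \<alpha>' \<beta>' \<gamma>'"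
  shows "smor t t' (\<alpha> \<oplus> (\<ominus> \<alpha>')) (\<beta> \<oplus> (\<ominus> \<beta>')) (\<gamma> \<oplus> (\<ominus> \<gamma>'))"
proof -
  obtain f g h f' g' h' where t: "t = (f, g, h)" "t' = (f', g', h')" by (metis prod.exhaust)
  note a = assms[unfolded t right_seq_mor_iff]
  show ?thesis unfolding t right_seq_mor_iff using a by simp
qed

lemma right_seq_mor_add:
  assumes "smor t t' \<alpha> \<beta> \<gamma>" "smor t t' \<alpha>' \<beta>' \<gamma>'"
  shows "smor t t' (\<alpha> \<oplus> \<alpha>') (\<beta> \<oplus> \<beta>') (\<gamma> \<oplus> \<gamma>')"
proof -
  obtain f g h f' g' h' where t: "t = (f, g, h)" "t' = (f', g', h')" by (metis prod.exhaust)
  note a = assms[unfolded t right_seq_mor_iff]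
  show ?thesis unfolding t right_seq_mor_iff using a by simp
qed

lemma right_seq_mor_idt:
  "right_seq \<A> F A B C t \<Longrightarrow> smor t t (idt A) (idt B) (idt C)"
  by (cases t) (auto simp: right_seq_iff right_seq_mor_iff)

end

section \<open>Extension along \<open>\<X>\<close>-monics\<close>

context stable_category
begin

definition xmonic :: "'m \<Rightarrow> bool" where "xmonic f \<longleftrightarrow> mor f \<and>
  (\<forall>v. mor v \<longrightarrow> dm v = dm f \<longrightarrow> cd v \<in> \<X> \<longrightarrow> (\<exists>w. mor w \<and> dm w = cd f \<and> cd w = cd v \<and> w \<cdot> f = v))"

lemma xmonicE:
  assumes "xmonic f" "mor v" "dm v = dm f" "cd v \<in> \<X>"
  obtains w where "mor w" "dm w = cd f" "cd w = cd v" "w \<cdot> f = v"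
  using assms unfolding xmonic_def by blast

lemma xmonic_mor: "xmonic f \<Longrightarrow> mor f"
  by (simp add: xmonic_def)

lemma X_monic_iff: "X_monic \<A> \<X> A B f \<longleftrightarrow> xmonic f \<and> dm f = A \<and> cd f = B"
proof
  assume f: "X_monic \<A> \<X> A B f"
  have "\<exists>w. mor w \<and> dm w = B \<and> cd w = cd v \<and> w \<cdot> f = v" if "mor v" "dm v = A" "cd v \<in> \<X>" for v
  proof -
    have "v \<in> (\<lambda>v. v \<cdot> f) ` Hom \<A> B (cd v)"
      using f that mor_hom[OF that(1)] unfolding X_monic_def by simp
    then show ?thesis by (auto simp: hom_iff)
  qed
  then show "xmonic f \<and> dm f = A \<and> cd f = B"
    using f by (auto simp: xmonic_def X_monic_def hom_iff)
next
  assume f: "xmonic f \<and> dm f = A \<and> cd f = B"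
  then have ty: "mor f" "dm f = A" "cd f = B" by (auto simp: xmonic_def)
  have "(\<lambda>v. v \<cdot> f) ` Hom \<A> B X = Hom \<A> A X" if "X \<in> \<X>" for X
  proof -
    have "v \<in> (\<lambda>v. v \<cdot> f) ` Hom \<A> B X" if v: "v \<in> Hom \<A> A X" for v
    proof -
      obtain w where "mor w" "dm w = cd f" "cd w = cd v" "w \<cdot> f = v"
        using xmonicE[of f v] f v \<open>X \<in> \<X>\<close> by (auto simp: hom_iff)
      then show ?thesis using f v cd_Ob[OF ty(1)] by (intro image_eqI[of _ _ w]) (auto simp: hom_iff)
    qed
    then show ?thesis using ty cd_Ob[OF ty(1)] dm_Ob[OF ty(1)] by (auto simp: hom_iff)
  qed
  then show "X_monic \<A> \<X> A B f" using ty cd_Ob[OF ty(1)] dm_Ob[OF ty(1)] by (auto simp: X_monic_def hom_iff)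
qed

text \<open>Write \<open>k = b \<cdot> a\<close> through \<open>\<X>\<close>; it is enough to extend
  \<open>a\<close>, and the result passes through \<open>\<X>\<close> again. This turns a square
  that commutes stably into one that commutes in \<open>\<A>\<close>.\<close>

lemma null_extend:
  assumes "xmonic f" "null k" "dm k = dm f"
  obtains x where "null x" "dm x = cd f" "cd x = cd k" "x \<cdot> f = k"
proof -
  obtain a b where k: "mor a" "mor b" "cd a = dm b" "dm b \<in> \<X>" "k = b \<cdot> a" using assms null_iff by auto
  then obtain w where w: "mor w" "dm w = cd f" "cd w = cd a" "w \<cdot> f = a"
    using xmonicE[OF assms(1), of a] assms(3) by auto
  show thesis
    by (rule that[of "b \<cdot> w"]) (use k w xmonic_mor[OF assms(1)] in \<open>auto intro: nullI\<close>)
qed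

lemma xmonic_cmp:
  assumes "xmonic f" "xmonic g" "cd f = dm g" shows "xmonic (g \<cdot> f)"
  unfolding xmonic_def
proof (intro conjI allI impI)
  note ty = assms(1,2)[THEN xmonic_mor] assms(3)
  show "mor (g \<cdot> f)" using ty by simp
  fix v assume v: "mor v" "dm v = dm (g \<cdot> f)" "cd v \<in> \<X>"
  obtain w where w: "mor w" "dm w = cd f" "cd w = cd v" "w \<cdot> f = v" using xmonicE[OF assms(1)] v ty by auto
  obtain u where "mor u" "dm u = cd g" "cd u = cd w" "u \<cdot> g = w" using xmonicE[OF assms(2), of w] w v ty by auto
  then show "\<exists>w. mor w \<and> dm w = cd (g \<cdot> f) \<and> cd w = cd v \<and> w \<cdot> (g \<cdot> f) = v"
    using w ty by (intro exI[of _ u]) (auto simp flip: assoc)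
qed

lemma xmonic_split:
  assumes "mor f" "mor r" "dm r = cd f" "cd r = dm f" "r \<cdot> f = idt (dm f)" shows "xmonic f"
  unfolding xmonic_def
proof (intro conjI allI impI)
  fix v assume v: "mor v" "dm v = dm f" "cd v \<in> \<X>"
  then show "\<exists>w. mor w \<and> dm w = cd f \<and> cd w = cd v \<and> w \<cdot> f = v"
    using assms by (intro exI[of _ "v \<cdot> r"]) simp
qed (rule assms(1))

text \<open>An extension along the first component, composed with the projection, extends along the
  pair. Pairing with a preenvelope of the domain thus turns any morphism into an
  \<open>\<X>\<close>-monic.\<close>

lemma xmonic_pair:
  assumes "xmonic i" "mor f" "dm f = dm i" "biproduct \<A> (cd i) (cd f) S i1 i2 p1 p2"
  shows "xmonic (i1 \<cdot> i \<oplus> i2 \<cdot> f)"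
  unfolding xmonic_def
proof (intro conjI allI impI)
  note b = biproductD[OF assms(4)] assms(2,3) xmonic_mor[OF assms(1)]
  show "mor (i1 \<cdot> i \<oplus> i2 \<cdot> f)" using b by simp
  fix v assume v: "mor v" "dm v = dm (i1 \<cdot> i \<oplus> i2 \<cdot> f)" "cd v \<in> \<X>"
  obtain w where w: "mor w" "dm w = cd i" "cd w = cd v" "w \<cdot> i = v"
    using xmonicE[OF assms(1), of v] v b by auto
  then show "\<exists>w. mor w \<and> dm w = cd (i1 \<cdot> i \<oplus> i2 \<cdot> f) \<and> cd w = cd v \<and> w \<cdot> (i1 \<cdot> i \<oplus> i2 \<cdot> f) = v"
    using b v by (intro exI[of _ "w \<cdot> p1"]) (simp add: biproduct_cancel[OF assms(4)])
qed

text \<open>The morphism is the direct sum of \<open>f\<close> and the identity of \<open>D\<close>.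
  A test morphism splits into two components; the first extends along \<open>f\<close>, the second
  is kept.\<close>

lemma xmonic_sum:
  assumes "xmonic f" "biproduct \<A> (dm f) D P j1 j2 r1 r2" "biproduct \<A> (cd f) D Q i1 i2 p1 p2"
  shows "xmonic (i1 \<cdot> (f \<cdot> r1) \<oplus> i2 \<cdot> r2)"
  unfolding xmonic_def
proof (intro conjI allI impI)
  note b = biproductD[OF assms(2)] biproductD[OF assms(3)] xmonic_mor[OF assms(1)]
  show "mor (i1 \<cdot> (f \<cdot> r1) \<oplus> i2 \<cdot> r2)" using b by simp
  fix v assume v: "mor v" "dm v = dm (i1 \<cdot> (f \<cdot> r1) \<oplus> i2 \<cdot> r2)" "cd v \<in> \<X>"
  then have v': "dm v = P" using b by simp
  obtain w where w: "mor w" "dm w = cd f" "cd w = cd v" "w \<cdot> f = v \<cdot> j1"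
    using xmonicE[OF assms(1), of "v \<cdot> j1"] v b v' by auto
  have "v = v \<cdot> j1 \<cdot> r1 \<oplus> v \<cdot> j2 \<cdot> r2"
    by (rule biproduct_expand[OF assms(2), of _ "cd v"]) (use v b v' in \<open>simp add: hom_iff\<close>)
  also have "v \<cdot> j1 \<cdot> r1 = w \<cdot> (f \<cdot> r1)" unfolding w(4)[symmetric] using w(1-3) b by simp
  finally have "(w \<cdot> p1 \<oplus> v \<cdot> (j2 \<cdot> p2)) \<cdot> (i1 \<cdot> (f \<cdot> r1) \<oplus> i2 \<cdot> r2) = v"
    using b v v' w by (simp add: biproduct_cancel[OF assms(3)])
  then show "\<exists>w. mor w \<and> dm w = cd (i1 \<cdot> (f \<cdot> r1) \<oplus> i2 \<cdot> r2) \<and> cd w = cd v \<and>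
      w \<cdot> (i1 \<cdot> (f \<cdot> r1) \<oplus> i2 \<cdot> r2) = v"
    using b v v' w by (intro exI[of _ "w \<cdot> p1 \<oplus> v \<cdot> (j2 \<cdot> p2)"]) simp
qed

end

locale right_fixed = partial_right_triangulated \<A> \<Sigma> R \<C> \<X>
  for \<A> :: "('o, 'm) acat" (structure) and \<Sigma> R \<C> \<X> +
  fixes T :: "('o, 'm) fixed_tri"
  assumes fixed_T: "fixed_right_triangles \<A> \<Sigma> R \<C> \<X> T"
begin

sublocale shift_category \<A> \<Sigma>
  by unfold_locales (rule shift_functor)

sublocale stable_category \<A> \<C> \<X>
  by unfold_locales (rule sub_C sub_X X_C)+

abbreviation Sg where "Sg \<equiv> susp \<A> \<Sigma> \<C> \<X> T"

text \<open>One inclusion of each weak cokernel condition, read at an identity, makes consecutive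
  composites vanish; the other inclusion gives the factorizations in the last two items.\<close>

lemma R_hom:
  assumes "(f, g, h) \<in> R"
  shows "mor f" "mor g" "mor h" "dm g = cd f" "dm h = cd g" "cd h = fob \<Sigma> (dm f)" "cd g \<in> \<C>"
    "g \<cdot> f = zmor (dm f) (cd g)" "h \<cdot> g = zmor (cd f) (fob \<Sigma> (dm f))"
    "mor k \<Longrightarrow> dm k = cd f \<Longrightarrow> k \<cdot> f = zmor (dm f) (cd k) \<Longrightarrow>
      \<exists>l. mor l \<and> dm l = cd g \<and> cd l = cd k \<and> l \<cdot> g = k"
    "mor k \<Longrightarrow> dm k = cd g \<Longrightarrow> k \<cdot> g = zmor (cd f) (cd k) \<Longrightarrow>
      \<exists>l. mor l \<and> dm l = cd h \<and> cd l = cd k \<and> l \<cdot> h = k"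
proof -
  obtain A B C where ABC: "right_seq \<A> \<Sigma> A B C (f, g, h)" "C \<in> \<C>" "weak_cokernel \<A> A B C f g"
    "weak_cokernel \<A> B C (fob \<Sigma> A) g h"
    using right_C[OF assms] by (auto simp: right_C_seq_def)
  note ty = ABC(1)[unfolded right_seq_iff]
  show "mor f" "mor g" "mor h" "dm g = cd f" "dm h = cd g" "cd h = fob \<Sigma> (dm f)" "cd g \<in> \<C>"
    using ty ABC(2) by auto
  have wc: "{k \<in> Hom \<A> B Z. k \<cdot> f = zmor A Z} = (\<lambda>l. l \<cdot> g) ` Hom \<A> C Z"
    "{k \<in> Hom \<A> C Z. k \<cdot> g = zmor B Z} = (\<lambda>l. l \<cdot> h) ` Hom \<A> (fob \<Sigma> A) Z" if "Z \<in> Ob \<A>" for Z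
    using ABC(3,4) that by (simp_all add: weak_cokernel_def)
  have "idt C \<cdot> g \<in> {k \<in> Hom \<A> B C. k \<cdot> f = zmor A C}"
    unfolding wc(1)[OF C_Ob[OF ABC(2)]] using ABC(2) by (intro imageI) (simp add: hom_iff)
  then show "g \<cdot> f = zmor (dm f) (cd g)" using ty by simp
  have fA: "fob \<Sigma> A \<in> Ob \<A>" using ty by auto
  have "idt (fob \<Sigma> A) \<cdot> h \<in> {k \<in> Hom \<A> C (fob \<Sigma> A). k \<cdot> g = zmor B (fob \<Sigma> A)}"
    unfolding wc(2)[OF fA] using fA by (intro imageI) (simp add: hom_iff)
  then show "h \<cdot> g = zmor (cd f) (fob \<Sigma> (dm f))" using ty by simp
  show "\<exists>l. mor l \<and> dm l = cd g \<and> cd l = cd k \<and> l \<cdot> g = k"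
    if "mor k" "dm k = cd f" "k \<cdot> f = zmor (dm f) (cd k)"
  proof -
    have "k \<in> (\<lambda>l. l \<cdot> g) ` Hom \<A> C (cd k)"
      unfolding wc(1)[OF cd_Ob[OF that(1)], symmetric] using that ty by (simp add: hom_iff)
    then obtain l where l: "l \<in> Hom \<A> C (cd k)" "k = l \<cdot> g" by blast
    have "mor l" "dm l = cd g" "cd l = cd k"
      using hom_iff[THEN iffD1, OF l(1)] ty by simp_all
    then show ?thesis using l(2) by blast
  qed
  show "\<exists>l. mor l \<and> dm l = cd h \<and> cd l = cd k \<and> l \<cdot> h = k"
    if "mor k" "dm k = cd g" "k \<cdot> g = zmor (cd f) (cd k)"
  proof -
    have "k \<in> (\<lambda>l. l \<cdot> h) ` Hom \<A> (fob \<Sigma> A) (cd k)"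
      unfolding wc(2)[OF cd_Ob[OF that(1)], symmetric] using that ty by (simp add: hom_iff)
    then obtain l where l: "l \<in> Hom \<A> (fob \<Sigma> A) (cd k)" "k = l \<cdot> h" by blast
    have "mor l" "dm l = cd h" "cd l = cd k"
      using hom_iff[THEN iffD1, OF l(1)] ty by simp_all
    then show ?thesis using l(2) by blast
  qed
qed

lemma R_right_seq: "(f, g, h) \<in> R \<Longrightarrow> right_seq \<A> \<Sigma> (dm f) (cd f) (cd g) (f, g, h)"
  using R_hom[of f g h] unfolding right_seq_iff by auto

text \<open>Apply (PRT2) to the difference of the two morphisms. Its first component is null, hence
  extends along the \<open>\<X>\<close>-monic \<open>f\<close>; its last component then factors
  through the object \<open>cd f'\<close> of \<open>\<X>\<close>.\<close>

lemma mor_unique: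
  assumes "(f, g, h) \<in> R" "(f', s, h') \<in> R" "cd f' \<in> \<X>" "xmonic f"
    "smor (f, g, h) (f', s, h') \<alpha> \<beta> \<gamma>" "smor (f, g, h) (f', s, h') \<alpha>' \<beta>' \<gamma>'"
    "cl \<alpha> = cl \<alpha>'"
  shows "cl \<gamma> = cl \<gamma>'"
proof -
  note ty = assms(5,6)[unfolded right_seq_mor_iff]
  note d = right_seq_mor_diff[OF assms(5,6)]
  have "null (\<alpha> \<oplus> (\<ominus> \<alpha>'))" using assms(7) cl_eq_iff ty by auto
  then obtain u where u: "null u" "dm u = cd f" "cd u = dm f'" "u \<cdot> f = \<alpha> \<oplus> (\<ominus> \<alpha>')"
    using null_extend[OF assms(4), of "\<alpha> \<oplus> (\<ominus> \<alpha>')"] ty by auto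
  then have "u \<in> Hom \<A> (cd f) (dm f')" using null_mor[OF u(1)] ty by (auto simp: hom_iff)
  then obtain v where "v \<in> Hom \<A> (cd g) (cd f')" "\<gamma> \<oplus> (\<ominus> \<gamma>') = s \<cdot> v"
    using PRT2[OF assms(1,2) R_right_seq[OF assms(1)] R_right_seq[OF assms(2)] assms(3) d] u(4) by metis
  then have "null (\<gamma> \<oplus> (\<ominus> \<gamma>'))" using nullI[of v s] assms(3) ty by (simp add: hom_iff)
  then show ?thesis using ty by (intro cl_eqI) auto
qed

text \<open>The target of \<open>f' \<cdot> \<alpha>\<close> lies in \<open>\<X>\<close>, so this
  morphism extends along \<open>f\<close>; that gives the square which (PRT3) completes.\<close>

lemma mor_exists:
  assumes "(f, g, h) \<in> R" "(f', s, h') \<in> R" "cd f' \<in> \<X>" "xmonic f" "mor \<alpha>" "dm \<alpha> = dm f" "cd \<alpha> = dm f'"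
  obtains \<beta> \<gamma> where "smor (f, g, h) (f', s, h') \<alpha> \<beta> \<gamma>"
proof -
  note ty = R_hom[OF assms(1)] R_hom[OF assms(2)] assms(5-7)
  obtain \<beta> where b: "mor \<beta>" "dm \<beta> = cd f" "cd \<beta> = cd f'" "\<beta> \<cdot> f = f' \<cdot> \<alpha>"
    using xmonicE[OF assms(4), of "f' \<cdot> \<alpha>"] ty assms(3) by auto
  then show thesis
    using that PRT3[OF assms(1,2), of "dm f" "cd f" "dm f'" "cd f'" \<alpha> \<beta>] ty by (auto simp: hom_iff)
qed

lemma fixed_at:
  assumes "A \<in> \<C>"
  shows "(ti T A, tp T A, tq T A) \<in> R" "tri_at T A \<in> R" "mor (ti T A)" "mor (tp T A)" "mor (tq T A)" "dm (ti T A) = A"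
    "cd (ti T A) = tX T A" "dm (tp T A) = tX T A" "cd (tp T A) = tU T A" "dm (tq T A) = tU T A"
    "cd (tq T A) = fob \<Sigma> A" "tX T A \<in> \<X>" "tU T A \<in> \<C>" "xmonic (ti T A)"
proof -
  have 1: "tri_at T A \<in> R" "right_seq \<A> \<Sigma> A (tX T A) (tU T A) (tri_at T A)"
    "X_preenvelope \<A> \<X> A (tX T A) (ti T A)"
    using fixed_T assms by (auto simp: fixed_right_triangles_def)
  then show "tri_at T A \<in> R" "(ti T A, tp T A, tq T A) \<in> R" "mor (ti T A)" "mor (tp T A)" "mor (tq T A)" "dm (ti T A) = A"
    "cd (ti T A) = tX T A" "dm (tp T A) = tX T A" "cd (tp T A) = tU T A" "dm (tq T A) = tU T A"
    "cd (tq T A) = fob \<Sigma> A" "tX T A \<in> \<X>" "tU T A \<in> \<C>" "xmonic (ti T A)"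
    using R_hom[of "ti T A" "tp T A" "tq T A"]
    by (auto simp: tri_at_def right_seq_iff X_preenvelope_def X_monic_iff)
qed

lemma fixed_seq: "A \<in> \<C> \<Longrightarrow> right_seq \<A> \<Sigma> A (tX T A) (tU T A) (tri_at T A)"
  using fixed_T by (auto simp: fixed_right_triangles_def)

lemma mor_unique_fixed:
  assumes "(f, g, h) \<in> R" "xmonic f" "A \<in> \<C>" "smor (f, g, h) (tri_at T A) \<alpha> \<beta> \<gamma>"
    "smor (f, g, h) (tri_at T A) \<alpha>' \<beta>' \<gamma>'" "cl \<alpha> = cl \<alpha>'"
  shows "cl \<gamma> = cl \<gamma>'"
  by (rule mor_unique[OF assms(1) fixed_at(1)[OF assms(3)] _ assms(2) assms(4,5)[unfolded tri_at_def] assms(6)])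
    (simp add: fixed_at assms(3))

text \<open>The definite description is met by one class only: by uniqueness of comparisons,
  equivalent representatives with arbitrary fillers give the same last class.\<close>

lemma susp_eq:
  assumes "A \<in> \<C>" "B \<in> \<C>" "smor (tri_at T A) (tri_at T B) f \<sigma> \<kappa>"
  shows "fmor Sg (cl f) = cl \<kappa>"
proof -
  have f: "f \<in> Hom \<A> A B" "mor f"
    using assms(3) fixed_at(6)[OF assms(1)] fixed_at(6)[OF assms(2)] assms(1,2)
    unfolding tri_at_def right_seq_mor_iff hom_iff by auto
  show ?thesis
    unfolding susp_def endofun.simps
  proof (rule the_equality)
    show "\<exists>A\<in>\<C>. \<exists>B\<in>\<C>. \<exists>f'\<in>Hom \<A> A B. \<exists>\<sigma> \<kappa>'. cl f = cl f' \<and>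
       smor (tri_at T A) (tri_at T B) f' \<sigma> \<kappa>' \<and> cl \<kappa> = cl \<kappa>'"
      using assms f by blast
    fix Q assume "\<exists>A\<in>\<C>. \<exists>B\<in>\<C>. \<exists>f'\<in>Hom \<A> A B. \<exists>\<sigma> \<kappa>. cl f = cl f' \<and>
       smor (tri_at T A) (tri_at T B) f' \<sigma> \<kappa> \<and> Q = cl \<kappa>"
    then obtain A' B' f' \<sigma>' \<kappa>' where *: "A' \<in> \<C>" "B' \<in> \<C>" "f' \<in> Hom \<A> A' B'" "cl f = cl f'"
      "smor (tri_at T A') (tri_at T B') f' \<sigma>' \<kappa>'" "Q = cl \<kappa>'" by blast
    then have "A' = A" "B' = B" using f cl_eq_iff[of f f'] by (auto simp: hom_iff)
    then show "Q = cl \<kappa>"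
      using mor_unique_fixed[OF fixed_at(1)[OF assms(1)] fixed_at(14)[OF assms(1)] assms(2), of f' \<sigma>' \<kappa>' f \<sigma> \<kappa>] * assms(3)
      by (simp add: tri_at_def)
  qed
qed

lemma fixed_mor_exists:
  assumes "mor f" "dm f \<in> \<C>" "cd f \<in> \<C>"
  obtains \<sigma> \<kappa> where "smor (tri_at T (dm f)) (tri_at T (cd f)) f \<sigma> \<kappa>"
    "fmor Sg (cl f) = cl \<kappa>" "mor \<kappa>" "dm \<kappa> = tU T (dm f)" "cd \<kappa> = tU T (cd f)"
proof -
  obtain \<sigma> \<kappa> where "smor (tri_at T (dm f)) (tri_at T (cd f)) f \<sigma> \<kappa>"
    using mor_exists[OF fixed_at(1)[OF assms(2)] fixed_at(1)[OF assms(3)] _ fixed_at(14)[OF assms(2)] assms(1)]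
    fixed_at[OF assms(2)] fixed_at[OF assms(3)] unfolding tri_at_def by metis
  then show thesis
    using that susp_eq[OF assms(2,3)] fixed_at(9)[OF assms(2)] fixed_at(9)[OF assms(3)]
    unfolding tri_at_def right_seq_mor_iff by metis
qed

lemma Sg_ob [simp]: "fob Sg = tU T"
  by (simp add: susp_def)

text \<open>Identities, composites and sums of morphisms between fixed triangles are again such
  morphisms, and any of these may be used to compute the suspension.\<close>

lemma susp_additive: "additive_functor K Sg"
  unfolding additive_functor_def
proof (intro conjI allI ballI impI)
  show "fob Sg A \<in> Ob K" "fmor Sg (Idt K A) = Idt K (fob Sg A)" if "A \<in> Ob K" for A
    using that susp_eq[OF _ _ right_seq_mor_idt[OF fixed_seq]] by (simp_all add: fixed_at)
  show "fmor Sg f \<in> Hom K (fob Sg A) (fob Sg B)" if f: "f \<in> Hom K A B" for A B f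
  proof -
    obtain f0 where f0: "mor f0" "dm f0 = A" "cd f0 = B" "f = cl f0" "A \<in> \<C>" "B \<in> \<C>" using stab_homE[OF f] .
    then obtain \<sigma> \<kappa> where "fmor Sg (cl f0) = cl \<kappa>" "mor \<kappa>" "dm \<kappa> = tU T A" "cd \<kappa> = tU T B"
      using fixed_mor_exists[of f0] by blast
    then show ?thesis using f0 by (simp add: stab_homI fixed_at)
  qed
  show "fmor Sg (g \<cdot>\<^sub>K f) = fmor Sg g \<cdot>\<^sub>K fmor Sg f" if f: "f \<in> Hom K A B" and g: "g \<in> Hom K B C" for A B C f g
  proof -
    obtain f0 where f0: "mor f0" "dm f0 = A" "cd f0 = B" "f = cl f0" "A \<in> \<C>" "B \<in> \<C>" using stab_homE[OF f] .
    obtain g0 where g0: "mor g0" "dm g0 = B" "cd g0 = C" "g = cl g0" "B \<in> \<C>" "C \<in> \<C>" using stab_homE[OF g] .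
    obtain \<sigma> \<kappa> where 1: "smor (tri_at T A) (tri_at T B) f0 \<sigma> \<kappa>" "fmor Sg (cl f0) = cl \<kappa>"
      "mor \<kappa>" "cd \<kappa> = tU T B"
      using fixed_mor_exists[of f0] f0 by blast
    obtain \<sigma>' \<kappa>' where 2: "smor (tri_at T B) (tri_at T C) g0 \<sigma>' \<kappa>'" "fmor Sg (cl g0) = cl \<kappa>'"
      "mor \<kappa>'" "dm \<kappa>' = tU T B"
      using fixed_mor_exists[of g0] g0 by blast
    have "fmor Sg (cl (g0 \<cdot> f0)) = cl (\<kappa>' \<cdot> \<kappa>)"
      by (rule susp_eq[OF f0(5) g0(6) right_seq_mor_cmp[OF 1(1) 2(1)]])
    then show ?thesis using f0(1-4) g0(1-4) 1 2 by simp
  qed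
  show "fmor Sg (f \<oplus>\<^bsub>K\<^esub> g) = fmor Sg f \<oplus>\<^bsub>K\<^esub> fmor Sg g" if f: "f \<in> Hom K A B" and g: "g \<in> Hom K A B" for A B f g
  proof -
    obtain f0 where f0: "mor f0" "dm f0 = A" "cd f0 = B" "f = cl f0" "A \<in> \<C>" "B \<in> \<C>" using stab_homE[OF f] .
    obtain g0 where g0: "mor g0" "dm g0 = A" "cd g0 = B" "g = cl g0" "A \<in> \<C>" "B \<in> \<C>" using stab_homE[OF g] .
    obtain \<sigma> \<kappa> where 1: "smor (tri_at T A) (tri_at T B) f0 \<sigma> \<kappa>" "fmor Sg (cl f0) = cl \<kappa>"
      "mor \<kappa>" "dm \<kappa> = tU T A" "cd \<kappa> = tU T B"
      using fixed_mor_exists[of f0] f0 by blast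
    obtain \<sigma>' \<kappa>' where 2: "smor (tri_at T A) (tri_at T B) g0 \<sigma>' \<kappa>'" "fmor Sg (cl g0) = cl \<kappa>'"
      "mor \<kappa>'" "dm \<kappa>' = tU T A" "cd \<kappa>' = tU T B"
      using fixed_mor_exists[of g0] g0 by blast
    have "fmor Sg (cl (f0 \<oplus> g0)) = cl (\<kappa> \<oplus> \<kappa>')"
      by (rule susp_eq[OF f0(5,6) right_seq_mor_add[OF 1(1) 2(1)]])
    then show ?thesis using f0(1-4) g0(1-4) 1 2 by simp
  qed
qed

end

section \<open>Standard right triangles\<close>

context right_fixed
begin

text \<open>(PRT1)(ii) for the zero morphism from \<open>A\<close> to a zero object, with
  \<open>A\<close> itself as the biproduct.\<close>

lemma idt_R:
  assumes "A \<in> \<C>" "zero_object \<A> Z"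
  shows "(idt A, zmor A Z, zmor Z (fob \<Sigma> A)) \<in> R"
proof -
  have Z: "Z \<in> \<C>" "Z \<in> Ob \<A>" using zero_in_X[OF assms(2)] by auto
  have A: "A \<in> Ob \<A>" using assms by simp
  have "zmor A Z \<in> Hom \<A> A Z" using zero_hom A Z by blast
  from PRT1_ii[OF assms(1) Z(1) this biproduct_zero[OF assms(2) A]]
  show ?thesis using A Z by simp
qed

text \<open>Direct sum with the identity triangle of \<open>D\<close>, whose third object is zero,
  so the third object stays as it is. It provides triangles on the sums of a morphism with an
  identity that occur in the two octahedra below.\<close>

lemma R_stabilize:
  assumes "(f, g, h) \<in> R" "D \<in> \<C>" "biproduct \<A> (dm f) D P j1 j2 r1 r2"
    "biproduct \<A> (cd f) D Q i1 i2 p1 p2"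
  shows "(i1 \<cdot> (f \<cdot> r1) \<oplus> i2 \<cdot> r2, g \<cdot> p1, fmor \<Sigma> j1 \<cdot> h) \<in> R"
proof -
  obtain Z where Z: "zero_object \<A> Z" using ex_zero_object by blast
  have ZO: "Z \<in> Ob \<A>" using zero_in_X[OF Z] by auto
  note ty = R_hom(1-7)[OF assms(1)] biproductD[OF assms(3)] biproductD[OF assms(4)]
  have s: "right_seq \<A> \<Sigma> D D Z (idt D, zmor D Z, zmor Z (fob \<Sigma> D))"
    using ty ZO by (simp add: right_seq_iff)
  show ?thesis
    using closed_sum[OF assms(1) idt_R[OF assms(2) Z] R_right_seq[OF assms(1)] s assms(3,4)
        biproduct_zero[OF Z, of "cd g"]] ty ZO by simp
qed

text \<open>A lift of a standard triangle to \<open>\<A>\<close>. The original last morphism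
  \<open>h\<close> is kept beside the comparison \<open>\<xi>\<close>, since the axioms on
  \<open>R\<close> speak of \<open>h\<close> while the stable triangle records only
  \<open>\<xi>\<close>.\<close>

definition standard :: "'m \<Rightarrow> 'm \<Rightarrow> 'm \<Rightarrow> 'm \<Rightarrow> bool" where
  "standard f g h \<xi> \<longleftrightarrow> (f, g, h) \<in> R \<and> dm f \<in> \<C> \<and> cd f \<in> \<C> \<and> xmonic f \<and>
     (\<exists>\<delta>. smor (f, g, h) (tri_at T (dm f)) (idt (dm f)) \<delta> \<xi>)"

abbreviation D where "D \<equiv> standard_right \<A> \<Sigma> R \<C> \<X> T"
abbreviation Tri where "Tri \<equiv> right_triangles \<A> \<Sigma> R \<C> \<X> T"

lemma D_iff: "t \<in> D \<longleftrightarrow> (\<exists>f g h \<xi>. t = (cl f, cl g, cl \<xi>) \<and> standard f g h \<xi>)"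
  unfolding standard_right_def standard_def by (auto simp: X_monic_iff; blast)

lemma D_E:
  assumes "(F, G, H) \<in> D"
  obtains f g h \<xi> where "F = cl f" "G = cl g" "H = cl \<xi>" "standard f g h \<xi>"
  using assms unfolding D_iff by blast

lemma standard_hom:
  assumes "standard f g h \<xi>"
  shows "(f, g, h) \<in> R" "mor f" "mor g" "mor \<xi>" "dm g = cd f" "dm \<xi> = cd g" "cd \<xi> = tU T (dm f)"
    "dm f \<in> \<C>" "cd f \<in> \<C>" "cd g \<in> \<C>" "tU T (dm f) \<in> \<C>" "xmonic f"
  using assms R_hom[of f g h] fixed_at(9,13)[of "dm f"] unfolding standard_def tri_at_def right_seq_mor_iff by auto

lemma standard_mor:
  assumes "standard f g h \<xi>"
  obtains \<delta> where "smor (f, g, h) (tri_at T (dm f)) (idt (dm f)) \<delta> \<xi>"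
    "mor \<delta>" "dm \<delta> = cd f" "cd \<delta> = tX T (dm f)" "\<delta> \<cdot> f = ti T (dm f)" "\<xi> \<cdot> g = tp T (dm f) \<cdot> \<delta>"
    "tq T (dm f) \<cdot> \<xi> = h"
proof -
  obtain \<delta> where d: "smor (f, g, h) (tri_at T (dm f)) (idt (dm f)) \<delta> \<xi>"
    using assms unfolding standard_def by blast
  show thesis
    by (rule that[OF d]) (use d standard_hom(8)[OF assms] fixed_at[OF standard_hom(8)[OF assms]] in \<open>auto simp: tri_at_def right_seq_mor_iff\<close>)
qed

lemma standard_ex:
  assumes "(f, g, h) \<in> R" "dm f \<in> \<C>" "cd f \<in> \<C>" "xmonic f"
  obtains \<xi> where "standard f g h \<xi>"
proof -
  have "mor (idt (dm f))" "dm (idt (dm f)) = dm f" "cd (idt (dm f)) = dm (ti T (dm f))"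
    "cd (ti T (dm f)) \<in> \<X>"
    using assms(2) fixed_at by auto
  from mor_exists[OF assms(1) fixed_at(1)[OF assms(2)] this(4) assms(4) this(1-3)] obtain \<delta> \<xi> where
    "smor (f, g, h) (ti T (dm f), tp T (dm f), tq T (dm f)) (idt (dm f)) \<delta> \<xi>" by blast
  then show thesis using that assms unfolding standard_def tri_at_def by blast
qed

lemma D_I: "standard f g h \<xi> \<Longrightarrow> (cl f, cl g, cl \<xi>) \<in> D"
  unfolding D_iff by blast

lemma standard_seq: "standard f g h \<xi> \<Longrightarrow> right_seq K Sg (dm f) (cd f) (cd g) (cl f, cl g, cl \<xi>)"
  using standard_hom[of f g h \<xi>] by (simp add: right_seq_def stab_homI)

lemma K_inverseI:
  "mor f \<Longrightarrow> mor g \<Longrightarrow> dm f = A \<Longrightarrow> cd f = B \<Longrightarrow> dm g = B \<Longrightarrow> cd g = A \<Longrightarrow> A \<in> \<C> \<Longrightarrow> B \<in> \<C> \<Longrightarrow>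
    cl (g \<cdot> f) = cl (idt A) \<Longrightarrow> cl (f \<cdot> g) = cl (idt B) \<Longrightarrow> inverse_mor K A B (cl f) (cl g)"
  by (auto simp: inverse_mor_def intro!: stab_homI)

lemma K_morI:
  assumes "mor f" "mor g" "mor h" "dm g = cd f" "dm h = cd g" "cd h = tU T (dm f)"
    "mor f'" "mor g'" "mor h'" "dm g' = cd f'" "dm h' = cd g'" "cd h' = tU T (dm f')"
    "dm f \<in> \<C>" "cd f \<in> \<C>" "cd g \<in> \<C>" "dm f' \<in> \<C>" "cd f' \<in> \<C>" "cd g' \<in> \<C>"
    "mor \<alpha>" "mor \<beta>" "mor \<gamma>" "dm \<alpha> = dm f" "cd \<alpha> = dm f'" "dm \<beta> = cd f" "cd \<beta> = cd f'"
    "dm \<gamma> = cd g" "cd \<gamma> = cd g'" "cl (\<beta> \<cdot> f) = cl (f' \<cdot> \<alpha>)" "cl (\<gamma> \<cdot> g) = cl (g' \<cdot> \<beta>)"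
    "fmor Sg (cl \<alpha>) \<cdot>\<^sub>K cl h = cl (h' \<cdot> \<gamma>)"
  shows "right_seq_mor K Sg (cl f, cl g, cl h) (cl f', cl g', cl h') (cl \<alpha>) (cl \<beta>) (cl \<gamma>)"
  unfolding right_seq_mor_def
  by (rule exI[of _ "dm f"], rule exI[of _ "cd f"], rule exI[of _ "cd g"],
      rule exI[of _ "dm f'"], rule exI[of _ "cd f'"], rule exI[of _ "cd g'"])
    (use assms fixed_at(13) in \<open>auto simp: right_seq_def intro!: stab_homI\<close>)

lemma Sg_idt [simp]: "A \<in> \<C> \<Longrightarrow> fmor Sg (cl (idt A)) = cl (idt (tU T A))"
  using susp_additive unfolding additive_functor_def by simp

text \<open>Presents the composite of \<open>\<xi>\<close> with a suspended morphism as the last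
  component of a comparison over \<open>b \<cdot> a\<close>. Identities involving suspensions then
  reduce to uniqueness of comparisons.\<close>

lemma shift_compose:
  assumes "smor (f, g, h) (tri_at T A) a \<delta> \<xi>" "A \<in> \<C>" "B \<in> \<C>" "mor b" "dm b = A" "cd b = B"
  obtains \<delta>' \<kappa> where "smor (f, g, h) (tri_at T B) (b \<cdot> a) \<delta>' (\<kappa> \<cdot> \<xi>)"
    "fmor Sg (cl b) = cl \<kappa>" "fmor Sg (cl b) \<cdot>\<^sub>K cl \<xi> = cl (\<kappa> \<cdot> \<xi>)"
proof -
  obtain \<sigma> \<kappa> where k: "smor (tri_at T A) (tri_at T B) b \<sigma> \<kappa>" "fmor Sg (cl b) = cl \<kappa>" "mor \<kappa>" "dm \<kappa> = tU T A"
    using fixed_mor_exists[of b] assms by metis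
  have "mor \<xi>" "cd \<xi> = tU T A"
    using assms(1) fixed_at(9)[OF assms(2)] unfolding tri_at_def right_seq_mor_iff by auto
  then have "fmor Sg (cl b) \<cdot>\<^sub>K cl \<xi> = cl (\<kappa> \<cdot> \<xi>)" using k by simp
  then show thesis using that right_seq_mor_cmp[OF assms(1) k(1)] k(2) by blast
qed

lemma standard_id:
  assumes "A \<in> \<C>"
  shows "\<exists>Z. zero_object K Z \<and> (Idt K A, Zero K A Z, Zero K Z (fob Sg A)) \<in> D"
proof -
  interpret K: additive_category K by (rule stab_additive)
  obtain Z where Z: "zero_object \<A> Z" using ex_zero_object by blast
  have ZX: "Z \<in> \<X>" using zero_in_X[OF Z] .
  then have "zero_object K Z" unfolding K.zero_object_iff
    using cl_zero_iff[of "idt Z" Z Z] null_X[of "idt Z"] by simp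
  moreover have "standard (idt A) (zmor A Z) (zmor Z (fob \<Sigma> A)) (zmor Z (tU T A))"
    unfolding standard_def tri_at_def right_seq_mor_iff
    using idt_R[OF assms Z] assms ZX fixed_at[OF assms] R_hom(8)[OF fixed_at(1)[OF assms]]
      xmonic_split[of "idt A" "idt A"]
    by (auto intro!: exI[of _ "ti T A"])
  ultimately show ?thesis using D_I by (auto simp: stab_simps)
qed

text \<open>The square commutes only stably. Its defect is null and extends along \<open>f\<close>
  to a null \<open>x\<close>; subtracting \<open>x\<close> from \<open>b\<close> keeps the class and
  makes the square strict, so that (PRT3) applies.\<close>

lemma standard_TR3:
  assumes "(F, G, H) \<in> D" "(F', G', H') \<in> D" "F \<in> Hom K A B" "F' \<in> Hom K A' B'"
    "\<alpha> \<in> Hom K A A'" "\<beta> \<in> Hom K B B'" "\<beta> \<cdot>\<^sub>K F = F' \<cdot>\<^sub>K \<alpha>"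
  shows "\<exists>\<gamma>. right_seq_mor K Sg (F, G, H) (F', G', H') \<alpha> \<beta> \<gamma>"
proof -
  obtain f g h \<xi> where t: "F = cl f" "G = cl g" "H = cl \<xi>" "standard f g h \<xi>" using D_E[OF assms(1)] .
  obtain f' g' h' \<xi>' where t': "F' = cl f'" "G' = cl g'" "H' = cl \<xi>'" "standard f' g' h' \<xi>'" using D_E[OF assms(2)] .
  note ty = standard_hom[OF t(4)] and ty' = standard_hom[OF t'(4)]
  have AB: "dm f = A" "cd f = B" "dm f' = A'" "cd f' = B'"
    using assms(3,4) ty(2) ty'(2) unfolding t(1) t'(1) stab_hom_iff by (auto simp: cl_eq_iff)
  obtain a where a: "mor a" "dm a = A" "cd a = A'" "\<alpha> = cl a" using stab_homE[OF assms(5)] .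
  obtain b where b: "mor b" "dm b = B" "cd b = B'" "\<beta> = cl b" using stab_homE[OF assms(6)] .
  have "cl (b \<cdot> f) = cl (f' \<cdot> a)" using assms(7) ty ty' a b AB unfolding t(1) t'(1) a(4) b(4) by simp
  then have "null (b \<cdot> f \<oplus> (\<ominus> (f' \<cdot> a)))" using ty ty' a b AB cl_eq_iff[of "b \<cdot> f" "f' \<cdot> a"] by simp
  then obtain x where x: "null x" "dm x = B" "cd x = B'" "x \<cdot> f = b \<cdot> f \<oplus> (\<ominus> (f' \<cdot> a))"
    using null_extend[OF ty(12), of "b \<cdot> f \<oplus> (\<ominus> (f' \<cdot> a))"] ty ty' a b AB by auto
  define b' where "b' = b \<oplus> (\<ominus> x)"
  have b': "mor b'" "dm b' = B" "cd b' = B'" "cl b' = cl b"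
    using b null_mor[OF x(1)] x cl_add_null[OF b(1) null_neg[OF x(1)]] by (simp_all add: b'_def)
  have "b' \<cdot> f = f' \<cdot> a"
    using ty ty' a b AB x null_mor[OF x(1)] by (simp add: b'_def)
  then obtain c where c: "smor (f, g, h) (f', g', h') a b' c"
    using PRT3[OF ty(1) ty'(1), of "dm f" "cd f" "dm f'" "cd f'" a b'] ty ty' a b' AB by (auto simp: hom_iff)
  note cty = c[unfolded right_seq_mor_iff]
  obtain \<delta> where d: "smor (f, g, h) (tri_at T A) (idt A) \<delta> \<xi>" using standard_mor[OF t(4)] AB by blast
  obtain \<delta>' where d': "smor (f', g', h') (tri_at T A') (idt A') \<delta>' \<xi>'" using standard_mor[OF t'(4)] AB by blast
  have C: "A \<in> \<C>" "A' \<in> \<C>" using ty ty' AB by auto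
  obtain \<epsilon> \<kappa> where k: "smor (f, g, h) (tri_at T A') (a \<cdot> idt A) \<epsilon> (\<kappa> \<cdot> \<xi>)"
    "fmor Sg (cl a) \<cdot>\<^sub>K cl \<xi> = cl (\<kappa> \<cdot> \<xi>)"
    using shift_compose[OF d C a(1-3)] by metis
  \<comment> \<open>The third square: both sides are last components of comparisons from
    \<open>(f, g, h)\<close> to the fixed triangle of \<open>A'\<close> over
    \<open>a\<close>.\<close>
  have "cl (\<kappa> \<cdot> \<xi>) = cl (\<xi>' \<cdot> c)"
    by (rule mor_unique_fixed[OF ty(1,12) C(2) k(1) right_seq_mor_cmp[OF c d']]) (use a in simp)
  then have "right_seq_mor K Sg (cl f, cl g, cl \<xi>) (cl f', cl g', cl \<xi>') (cl a) (cl b') (cl c)"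
    using k(2) by (intro K_morI) (use ty ty' a b' AB cty in auto)
  then show ?thesis using t t' a b b' by auto
qed

text \<open>For a representative \<open>l\<close> of \<open>k\<close>, with
  \<open>l \<cdot> g = b \<cdot> a\<close> through \<open>\<X>\<close>, the aim is a decomposition
  \<open>l = w \<cdot> \<xi> + b \<cdot> c\<close>, whose second summand is null.\<close>

lemma standard_coker:
  assumes "(F, G, H) \<in> D" "right_seq K Sg A B C (F, G, H)" "k \<in> Hom K C Z" "k \<cdot>\<^sub>K G = Zero K B Z"
  shows "\<exists>x\<in>Hom K (fob Sg A) Z. k = x \<cdot>\<^sub>K H"
proof -
  obtain f g h \<xi> where t: "F = cl f" "G = cl g" "H = cl \<xi>" "standard f g h \<xi>" using D_E[OF assms(1)] .
  note ty = standard_hom[OF t(4)]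
  have AB: "dm f = A" "cd f = B" "cd g = C" "A \<in> \<C>" "Z \<in> \<C>"
    using assms(2,3) ty unfolding t(1-3) right_seq_def stab_hom_iff by (auto simp: cl_eq_iff)
  obtain \<delta> where d: "mor \<delta>" "dm \<delta> = B" "cd \<delta> = tX T A" "\<delta> \<cdot> f = ti T A" "\<xi> \<cdot> g = tp T A \<cdot> \<delta>"
    "tq T A \<cdot> \<xi> = h"
    using standard_mor[OF t(4)] AB by metis
  note F = fixed_at[OF AB(4)]
  obtain l where l: "mor l" "dm l = C" "cd l = Z" "k = cl l" using stab_homE[OF assms(3)] .
  have lg: "dm (l \<cdot> g) = B" "cd (l \<cdot> g) = Z" using l ty AB by simp_all
  have "null (l \<cdot> g)"
    using assms(4) l AB ty cl_zero_iff[of "l \<cdot> g" B Z] unfolding l(4) t(2) by simp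
  then obtain a b where ab: "mor a" "mor b" "cd a = dm b" "dm b \<in> \<X>" "l \<cdot> g = b \<cdot> a"
    and dcb: "dm a = B" "cd b = Z"
    using nullE[of "l \<cdot> g", unfolded lg] by blast
  \<comment> \<open>\<open>a\<close> need not factor through \<open>g\<close>, but
    \<open>a - x \<cdot> \<delta>\<close> does: since \<open>\<delta> \<cdot> f = ti T A\<close>,
    the choice of \<open>x\<close> makes it vanish on \<open>f\<close>.\<close>
  obtain x where x: "mor x" "dm x = tX T A" "cd x = dm b" "x \<cdot> ti T A = a \<cdot> f"
    using xmonicE[OF F(14), of "a \<cdot> f"] ab dcb ty F AB by auto
  have "(a \<oplus> (\<ominus> (x \<cdot> \<delta>))) \<cdot> f = zmor A (dm b)"
    using ab dcb x d ty F AB by simp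
  then obtain c where c: "mor c" "dm c = C" "cd c = dm b" "c \<cdot> g = a \<oplus> (\<ominus> (x \<cdot> \<delta>))"
    using R_hom(10)[OF ty(1), of "a \<oplus> (\<ominus> (x \<cdot> \<delta>))"] ab dcb x d ty F AB by auto
  \<comment> \<open>\<open>b \<cdot> x\<close> vanishes on \<open>ti T A\<close> because
    \<open>b \<cdot> a \<cdot> f = l \<cdot> g \<cdot> f\<close> is zero; so it factors through
    \<open>tp T A\<close>.\<close>
  have "(b \<cdot> x) \<cdot> ti T A = b \<cdot> (a \<cdot> f)" using x ab F by simp
  also have "\<dots> = (l \<cdot> g) \<cdot> f" using ab(1-4) dcb ty AB by (simp add: ab(5))
  also have "\<dots> = l \<cdot> zmor A C" using l ty AB R_hom(8)[OF ty(1)] by simp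
  finally have "(b \<cdot> x) \<cdot> ti T A = zmor A Z" using l ty AB by simp
  then obtain y where y: "mor y" "dm y = tU T A" "cd y = Z" "y \<cdot> tp T A = b \<cdot> x"
    using R_hom(10)[OF F(1), of "b \<cdot> x"] ab dcb x F by auto
  \<comment> \<open>Precomposed with \<open>g\<close>, \<open>n\<close> agrees with
    \<open>l\<close>: the terms \<open>b \<cdot> x \<cdot> \<delta>\<close> coming from
    \<open>c\<close> and from \<open>y\<close> cancel. The remainder \<open>m = l - n\<close>
    therefore factors through \<open>h = tq T A \<cdot> \<xi>\<close>.\<close>
  define n where "n = b \<cdot> c \<oplus> y \<cdot> \<xi>"
  have n: "mor n" "dm n = C" "cd n = Z" using ab c y ty AB dcb by (simp_all add: n_def)
  define m where "m = l \<oplus> (\<ominus> n)"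
  have m: "mor m" "dm m = C" "cd m = Z" using l n by (simp_all add: m_def)
  have e1: "y \<cdot> (\<xi> \<cdot> g) = b \<cdot> (x \<cdot> \<delta>)"
    unfolding d(5) using y x d ab F AB by (simp add: y(4)[THEN cmp_eq_assoc])
  have "n \<cdot> g = b \<cdot> (c \<cdot> g) \<oplus> y \<cdot> (\<xi> \<cdot> g)"
    unfolding n_def using ab c(1-3) y ty AB dcb by simp
  also have "\<dots> = b \<cdot> a"
    unfolding e1 c(4) using ab x d dcb by (simp add: add_assoc)
  finally have "m \<cdot> g = zmor B Z"
    unfolding m_def using l n ab ty AB dcb by simp
  then obtain z where z: "mor z" "dm z = fob \<Sigma> A" "cd z = Z" "z \<cdot> h = m"
    using R_hom(11)[OF ty(1), of m] m AB R_hom(6)[OF ty(1)] by auto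
  \<comment> \<open>Collects what passes through \<open>\<xi>\<close>: \<open>y\<close> from
    \<open>n\<close>, and \<open>z \<cdot> tq T A\<close> from
    \<open>m = z \<cdot> h\<close>.\<close>
  define w where "w = y \<oplus> z \<cdot> tq T A"
  have w: "mor w" "dm w = tU T A" "cd w = Z" using y z F by (simp_all add: w_def)
  have "z \<cdot> (tq T A \<cdot> \<xi>) = m" unfolding d(6) z(4) ..
  then have "w \<cdot> \<xi> \<oplus> b \<cdot> c = y \<cdot> \<xi> \<oplus> m \<oplus> b \<cdot> c"
    using y z F AB ty by (simp add: w_def)
  also have "\<dots> = m \<oplus> n"
    unfolding n_def using y m ab c dcb AB ty by (simp add: add_ac)
  also have "\<dots> = l" unfolding m_def using l n by (simp add: add_assoc)
  finally have "cl l = cl (w \<cdot> \<xi> \<oplus> b \<cdot> c)" by simp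
  also have "\<dots> = cl (w \<cdot> \<xi>)"
    by (rule cl_add_null) (use w ty AB nullI[of c b] ab c dcb in auto)
  finally have "k = cl w \<cdot>\<^sub>K H" using l(4) t(3) w ty AB by simp
  moreover have "cl w \<in> Hom K (fob Sg A) Z" using w F AB by (simp add: stab_homI)
  ultimately show ?thesis by blast
qed

end

section \<open>Rotation and the octahedron\<close>

context right_fixed
begin

text \<open>(PRT1)(iii) for the fixed preenvelope. The pair is the \<open>\<X>\<close>-monic
  replacement of \<open>f\<close>; the summand added to the codomain lies in \<open>\<X>\<close> and
  disappears stably.\<close>

lemma pushout_R:
  assumes "A \<in> \<C>" "mor f" "dm f = A" "cd f \<in> \<C>" "biproduct \<A> (tX T A) (cd f) Q i1 i2 p1 p2"
  obtains k b where "(i1 \<cdot> ti T A \<oplus> i2 \<cdot> f, k, b) \<in> R" "xmonic (i1 \<cdot> ti T A \<oplus> i2 \<cdot> f)" "Q \<in> \<C>"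
    "mor (i1 \<cdot> ti T A \<oplus> i2 \<cdot> f)" "dm (i1 \<cdot> ti T A \<oplus> i2 \<cdot> f) = A" "cd (i1 \<cdot> ti T A \<oplus> i2 \<cdot> f) = Q"
proof -
  note F = fixed_at[OF assms(1)] and B = biproductD[OF assms(5)]
  have "X_preenvelope \<A> \<X> A (tX T A) (ti T A)" using F by (simp add: X_preenvelope_def X_monic_iff)
  moreover have "f \<in> Hom \<A> A (cd f)" using assms by (simp add: hom_iff)
  ultimately obtain k b where "(i1 \<cdot> ti T A \<oplus> i2 \<cdot> f, k, b) \<in> R"
    using PRT1_iii[OF F(1) assms(1) _ assms(4) _ assms(5)] by blast
  moreover have "xmonic (i1 \<cdot> ti T A \<oplus> i2 \<cdot> f)"
    by (rule xmonic_pair[of _ _ Q i1 i2 p1 p2]) (use assms F in auto)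
  moreover have "Q \<in> \<C>" using biproduct_C[OF _ assms(4,5)] F by auto
  moreover have "mor (i1 \<cdot> ti T A \<oplus> i2 \<cdot> f)" "dm (i1 \<cdot> ti T A \<oplus> i2 \<cdot> f) = A" "cd (i1 \<cdot> ti T A \<oplus> i2 \<cdot> f) = Q"
    using F B assms(2,3) by simp_all
  ultimately show thesis using that by blast
qed

text \<open>The octahedron on \<open>A \<rightarrow> A \<oplus> B \<rightarrow> X\<^sup>A \<oplus> B\<close>, with morphisms \<open>(1, f)\<close> and \<open>i\<^sup>A \<oplus> 1\<close>, rotates the
  triangle on \<open>(i\<^sup>A, f)\<close>.\<close>

lemma rotation_R:
  assumes "A \<in> \<C>" "B \<in> \<C>" "mor f" "dm f = A" "cd f = B" "biproduct \<A> (tX T A) B Q i1 i2 p1 p2"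
  obtains k b s where "(i1 \<cdot> ti T A \<oplus> i2 \<cdot> f, k, b) \<in> R" "xmonic (i1 \<cdot> ti T A \<oplus> i2 \<cdot> f)"
    "smor (i1 \<cdot> ti T A \<oplus> i2 \<cdot> f, k, b) (tri_at T A) (idt A) p1 s"
    "(\<ominus> (k \<cdot> i2), s, fmor \<Sigma> f \<cdot> tq T A) \<in> R" "xmonic (\<ominus> (k \<cdot> i2))"
proof -
  note F = fixed_at[OF assms(1)] and b = biproductD[OF assms(6)]
  define i p q where "i = ti T A" and "p = tp T A" and "q = tq T A"
  note F = F[folded i_def p_def q_def]
  obtain k b where kb: "(i1 \<cdot> i \<oplus> i2 \<cdot> f, k, b) \<in> R" "xmonic (i1 \<cdot> i \<oplus> i2 \<cdot> f)" "Q \<in> \<C>"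
    using pushout_R[OF assms(1,3,4)] assms(2,5,6) unfolding i_def by metis
  obtain P j1 j2 r1 r2 where P: "biproduct \<A> A B P j1 j2 r1 r2"
    using ex_biproduct[of A B] assms(1,2) by auto
  note Pd = biproductD[OF P]
  have PC: "P \<in> \<C>" using biproduct_C[OF assms(1,2) P] .
  \<comment> \<open>\<open>u\<close> is \<open>(1, f)\<close>, \<open>l\<close> is the row
    \<open>(f, -1)\<close> of (PRT1)(ii), and \<open>v\<close> is the sum of \<open>i\<close> with
    the identity of \<open>B\<close>; the composite \<open>v \<cdot> u\<close> is
    \<open>(i, f)\<close>.\<close>
  define u l v where "u = j1 \<oplus> j2 \<cdot> f" and "l = f \<cdot> r1 \<oplus> (\<ominus> r2)" and "v = i1 \<cdot> (i \<cdot> r1) \<oplus> i2 \<cdot> r2"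
  have uty: "mor u" "dm u = A" "cd u = P" "mor l" "dm l = P" "cd l = B" "mor v" "dm v = P" "cd v = Q"
    unfolding u_def l_def v_def using Pd b F assms(3-5) by simp_all
  have Ru: "(u, l, zmor B (fob \<Sigma> A)) \<in> R"
    unfolding u_def l_def using PRT1_ii[OF assms(1,2) _ P] assms(1-5) by (simp add: hom_iff)
  have Rv: "(v, p \<cdot> p1, fmor \<Sigma> j1 \<cdot> q) \<in> R"
    unfolding v_def using R_stabilize[OF F(1) assms(2), of P j1 j2 r1 r2 Q i1 i2 p1 p2] P assms(6) F by simp
  have r1u: "r1 \<cdot> u = idt A" unfolding u_def using Pd assms(3-5) by (simp add: biproduct_cancel[OF P])
  have lj: "l \<cdot> j1 = f" "l \<cdot> j2 = \<ominus> (idt B)" unfolding l_def using Pd assms(3-5) by simp_all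
  have vj: "v \<cdot> j2 = i2" unfolding v_def using Pd b F assms(3-5) by simp
  have xu: "xmonic u" by (rule xmonic_split[of _ r1]) (use uty Pd r1u in auto)
  have xv: "xmonic v" unfolding v_def by (rule xmonic_sum[of _ B P j1 j2 r1 r2 Q]) (use F P assms(6) in auto)
  have vu: "v \<cdot> u = i1 \<cdot> i \<oplus> i2 \<cdot> f"
    unfolding u_def v_def using Pd b F assms(3-5) by (simp add: biproduct_cancel[OF P])
  note kbd = R_hom[OF kb(1)]
  have kty: "mor k" "mor b" "dm k = Q" "dm b = cd k" "cd b = fob \<Sigma> A" "cd k \<in> \<C>"
    using kbd(1-7) b F assms(3-5) by auto
  have pty: "mor (p \<cdot> p1)" "dm (p \<cdot> p1) = Q" "cd (p \<cdot> p1) = tU T A" "mor (fmor \<Sigma> j1 \<cdot> q)" "dm (fmor \<Sigma> j1 \<cdot> q) = tU T A"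
     "cd (fmor \<Sigma> j1 \<cdot> q) = fob \<Sigma> P"
    using b F Pd by simp_all
  obtain r s where rs: "r \<in> Hom \<A> B (cd k)" "s \<in> Hom \<A> (cd k) (tU T A)" "r \<cdot> l = k \<cdot> v"
    "s \<cdot> k = p \<cdot> p1" "fmor \<Sigma> j1 \<cdot> q \<cdot> s = fmor \<Sigma> u \<cdot> b"
    "(r, s, fmor \<Sigma> l \<cdot> (fmor \<Sigma> j1 \<cdot> q)) \<in> R" "X_monic \<A> \<X> B (cd k) r"
    using PRT4[OF Ru Rv kb(1)[folded vu] assms(1) PC kb(3), of B "tU T A" "cd k"] xu xv uty kty pty assms(1,2) F
    by (auto simp: X_monic_iff right_seq_iff)
  note rty = rs(1,2)[unfolded hom_iff]
  \<comment> \<open>On the summand \<open>B\<close> the relation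
    \<open>r \<cdot> l = k \<cdot> v\<close> reads \<open>- r = k \<cdot> i2\<close>; this
    determines \<open>r\<close> and is the source of the sign.\<close>
  have "r \<cdot> (l \<cdot> j2) = k \<cdot> (v \<cdot> j2)" using cmp_eq_assoc[OF rs(3), of j2] uty kty rty Pd by simp
  then have r: "r = \<ominus> (k \<cdot> i2)" unfolding lj vj using rty kty b neg_neg[of r] by simp
  have "fmor \<Sigma> l \<cdot> (fmor \<Sigma> j1 \<cdot> q) = fmor \<Sigma> (l \<cdot> j1) \<cdot> q" using uty Pd F by simp
  then have R': "(\<ominus> (k \<cdot> i2), s, fmor \<Sigma> f \<cdot> q) \<in> R" using rs(6) r lj by simp
  \<comment> \<open>Apply the suspension of \<open>r1\<close> to the last relation of the
    octahedron; \<open>r1\<close> is a left inverse of both \<open>j1\<close> and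
    \<open>u\<close>.\<close>
  have "fmor \<Sigma> (r1 \<cdot> j1) \<cdot> (q \<cdot> s) = fmor \<Sigma> r1 \<cdot> (fmor \<Sigma> j1 \<cdot> q \<cdot> s)" using Pd(1-15) F rty by simp
  also have "\<dots> = fmor \<Sigma> (r1 \<cdot> u) \<cdot> b" unfolding rs(5) using Pd(1-15) uty kty by simp
  finally have qs: "q \<cdot> s = b" unfolding r1u using Pd F rty kty by simp
  have "p1 \<cdot> (i1 \<cdot> i \<oplus> i2 \<cdot> f) = i"
    using b F assms(3-5) by (simp add: biproduct_cancel[OF assms(6)])
  then have "smor (i1 \<cdot> i \<oplus> i2 \<cdot> f, k, b) (tri_at T A) (idt A) p1 s"
    unfolding right_seq_mor_iff tri_at_def i_def[symmetric] p_def[symmetric] q_def[symmetric]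
    using b F assms(1,3-5) rty kty rs(4) qs by simp
  moreover have "xmonic (\<ominus> (k \<cdot> i2))" using rs(7) r X_monic_iff by simp
  ultimately show thesis using that kb R' unfolding i_def q_def by blast
qed

text \<open>The relation \<open>k \<cdot> i2 \<cdot> f = - k \<cdot> i1 \<cdot> ti T A\<close> makes
  \<open>(f, k \<cdot> i1, 1)\<close> a morphism from the fixed triangle of \<open>A\<close> to the
  rotated triangle. Followed by the comparison with the fixed triangle of \<open>B\<close>, it
  computes the suspension of \<open>f\<close> as the class of \<open>\<xi>\<close>.\<close>

lemma rotation_standard:
  assumes "A \<in> \<C>" "B \<in> \<C>" "mor f" "dm f = A" "cd f = B" "biproduct \<A> (tX T A) B Q i1 i2 p1 p2"
  obtains k b s h \<xi> where "standard (i1 \<cdot> ti T A \<oplus> i2 \<cdot> f) k b s" "s \<cdot> k = tp T A \<cdot> p1"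
    "standard (\<ominus> (k \<cdot> i2)) s h \<xi>" "cl \<xi> = fmor Sg (cl f)"
proof -
  obtain k b s where t: "(i1 \<cdot> ti T A \<oplus> i2 \<cdot> f, k, b) \<in> R" "xmonic (i1 \<cdot> ti T A \<oplus> i2 \<cdot> f)"
    "smor (i1 \<cdot> ti T A \<oplus> i2 \<cdot> f, k, b) (tri_at T A) (idt A) p1 s"
    "(\<ominus> (k \<cdot> i2), s, fmor \<Sigma> f \<cdot> tq T A) \<in> R" "xmonic (\<ominus> (k \<cdot> i2))"
    using rotation_R[OF assms] .
  note F = fixed_at[OF assms(1)] and b = biproductD[OF assms(6)]
  have Q: "Q \<in> \<C>" using biproduct_C[OF _ assms(2,6)] F by simp
  note kbd = R_hom[OF t(1)] and sd = R_hom[OF t(4)]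
  have kty: "mor k" "dm k = Q" "cd k \<in> \<C>"
    using kbd(1-7) b F assms(3-5) by auto
  have f1: "dm (i1 \<cdot> ti T A \<oplus> i2 \<cdot> f) = A" "cd (i1 \<cdot> ti T A \<oplus> i2 \<cdot> f) = Q" using b F assms(3-5) by simp_all
  have s1: "standard (i1 \<cdot> ti T A \<oplus> i2 \<cdot> f) k b s"
    unfolding standard_def using t(1-3) f1 assms(1) Q by auto
  have sk: "s \<cdot> k = tp T A \<cdot> p1" using t(3) by (simp add: right_seq_mor_iff tri_at_def)
  have r: "mor (\<ominus> (k \<cdot> i2))" "dm (\<ominus> (k \<cdot> i2)) = B" "cd (\<ominus> (k \<cdot> i2)) = cd k" using kty b by simp_all
  obtain \<xi> where x: "standard (\<ominus> (k \<cdot> i2)) s (fmor \<Sigma> f \<cdot> tq T A) \<xi>"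
    using standard_ex[OF t(4) _ _ t(5)] r assms(2) kty(3) by auto
  obtain \<delta> where d: "smor (\<ominus> (k \<cdot> i2), s, fmor \<Sigma> f \<cdot> tq T A) (tri_at T B) (idt B) \<delta> \<xi>"
    using standard_mor[OF x] r by metis
  have sty: "mor s" "dm s = cd k" "cd s = tU T A"
    using t(3) F unfolding right_seq_mor_iff tri_at_def by auto
  have "k \<cdot> (i1 \<cdot> ti T A) \<oplus> k \<cdot> (i2 \<cdot> f) = zmor A (cd k)"
    using kbd(8) f1 kty b F assms(3-5) by simp
  then have "k \<cdot> (i2 \<cdot> f) = \<ominus> (k \<cdot> (i1 \<cdot> ti T A))"
    using neg_unique[of "k \<cdot> (i1 \<cdot> ti T A)" "k \<cdot> (i2 \<cdot> f)"] kty b F assms(3-5) by simp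
  then have "\<ominus> (k \<cdot> (i2 \<cdot> f)) = k \<cdot> (i1 \<cdot> ti T A)" using kty b F by simp
  moreover have "s \<cdot> (k \<cdot> i1) = tp T A"
    using cmp_eq_assoc[OF sk, of i1] kty b F sty by simp
  ultimately have "smor (tri_at T A) (\<ominus> (k \<cdot> i2), s, fmor \<Sigma> f \<cdot> tq T A) f (k \<cdot> i1) (idt (tU T A))"
    unfolding right_seq_mor_iff tri_at_def using kty b F sty assms(3-5) by simp
  from right_seq_mor_cmp[OF this d]
  have "smor (tri_at T A) (tri_at T B) f (\<delta> \<cdot> (k \<cdot> i1)) \<xi>"
    using standard_hom[OF x] assms(3-5) sty by simp
  from susp_eq[OF assms(1,2) this] show thesis using that[OF s1 sk x] by simp
qed

lemma Tri_I:
  assumes "t \<in> D" "right_seq_iso K Sg t t'" shows "t' \<in> Tri"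
  using assms unfolding right_triangles_def by blast

lemma K_shift: "shift_category K Sg"
  by (intro shift_category.intro stab_additive shift_category_axioms.intro susp_additive)

lemma D_Tri: "standard f g h \<xi> \<Longrightarrow> (cl f, cl g, cl \<xi>) \<in> Tri"
  by (rule Tri_I[OF D_I shift_category.right_seq_iso_refl[OF K_shift standard_seq]])

lemma K_idt_inverse: "A \<in> \<C> \<Longrightarrow> inverse_mor K A A (cl (idt A)) (cl (idt A))"
  by (rule K_inverseI) auto

text \<open>\<open>i2 \<cdot> p2\<close> differs from the identity of \<open>Q\<close> by
  \<open>i1 \<cdot> p1\<close>, which passes through \<open>X\<close>; so a summand in
  \<open>\<X>\<close> is invisible stably.\<close>

lemma cl_split:
  assumes "biproduct \<A> X B Q i1 i2 p1 p2" "X \<in> \<X>" "mor k" "dm k = Q"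
  shows "cl (k \<cdot> i2 \<cdot> p2) = cl k" and "mor m \<Longrightarrow> cd m = Q \<Longrightarrow> cl (i2 \<cdot> (p2 \<cdot> m)) = cl m"
proof -
  note b = biproductD[OF assms(1)]
  have e: "i2 \<cdot> p2 \<oplus> i1 \<cdot> p1 = idt Q" using biproductD(20)[OF biproduct_sym[OF assms(1)]] .
  have "k \<cdot> i2 \<cdot> p2 \<oplus> k \<cdot> i1 \<cdot> p1 = k \<cdot> (i2 \<cdot> p2 \<oplus> i1 \<cdot> p1)" using b assms(2-4) by simp
  then have k: "k \<cdot> i2 \<cdot> p2 \<oplus> k \<cdot> i1 \<cdot> p1 = k" unfolding e using assms by simp
  have "null (k \<cdot> i1 \<cdot> p1)" by (rule nullI) (use b assms(2-4) in auto)
  then show "cl (k \<cdot> i2 \<cdot> p2) = cl k"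
    using cl_add_null[of "k \<cdot> i2 \<cdot> p2" "k \<cdot> i1 \<cdot> p1"] k b(1-15) assms(3,4) by simp
  show "cl (i2 \<cdot> (p2 \<cdot> m)) = cl m" if "mor m" "cd m = Q"
  proof -
    have "i2 \<cdot> (p2 \<cdot> m) \<oplus> i1 \<cdot> (p1 \<cdot> m) = (i2 \<cdot> p2 \<oplus> i1 \<cdot> p1) \<cdot> m" using b that by simp
    then have m: "i2 \<cdot> (p2 \<cdot> m) \<oplus> i1 \<cdot> (p1 \<cdot> m) = m" unfolding e using that by simp
    have "null (i1 \<cdot> (p1 \<cdot> m))" by (rule nullI) (use b assms(2) that in auto)
    then show ?thesis
      using cl_add_null[of "i2 \<cdot> (p2 \<cdot> m)" "i1 \<cdot> (p1 \<cdot> m)"] m b(1-15) that by simp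
  qed
qed

lemma K_split_inverse:
  assumes "biproduct \<A> X B Q i1 i2 p1 p2" "X \<in> \<X>" "B \<in> \<C>"
  shows "inverse_mor K B Q (cl i2) (cl p2)" "Q \<in> \<C>"
proof -
  show "Q \<in> \<C>" using biproduct_C[OF _ assms(3,1)] assms(2) by simp
  then show "inverse_mor K B Q (cl i2) (cl p2)"
    by (intro K_inverseI) (use biproductD[OF assms(1)] assms(2,3) cl_split(1)[OF assms(1,2), of "idt Q"] in auto)
qed

text \<open>The rotation is known for the pair \<open>(ti T A, f)\<close>. The stable isomorphism
  \<open>p2\<close> carries the pair to \<open>f\<close>, and the second morphism becomes
  \<open>k \<cdot> i2\<close>, the negative of the first morphism of the rotated triangle.\<close>

lemma stab_rotation:
  assumes "F \<in> Hom K A B"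
  shows "\<exists>G H. (F, G, H) \<in> Tri \<and> (-\<^sub>K G, H, fmor Sg F) \<in> Tri"
proof -
  interpret K: shift_category K Sg by (rule K_shift)
  obtain f where f: "mor f" "dm f = A" "cd f = B" "F = cl f" "A \<in> \<C>" "B \<in> \<C>" using stab_homE[OF assms] .
  note Fx = fixed_at[OF f(5)]
  obtain Q i1 i2 p1 p2 where Q: "biproduct \<A> (tX T A) B Q i1 i2 p1 p2"
    using ex_biproduct[of "tX T A" B] f Fx by auto
  note b = biproductD[OF Q]
  obtain k c s h \<xi> where s: "standard (i1 \<cdot> ti T A \<oplus> i2 \<cdot> f) k c s"
    "standard (\<ominus> (k \<cdot> i2)) s h \<xi>" "cl \<xi> = fmor Sg (cl f)"
    using rotation_standard[OF f(5,6,1-3) Q] .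
  have f1: "dm (i1 \<cdot> ti T A \<oplus> i2 \<cdot> f) = A" "cd (i1 \<cdot> ti T A \<oplus> i2 \<cdot> f) = Q" "mor (i1 \<cdot> ti T A \<oplus> i2 \<cdot> f)"
    using b Fx f by simp_all
  note s1 = standard_hom[OF s(1), unfolded f1]
  have p2f: "p2 \<cdot> (i1 \<cdot> ti T A \<oplus> i2 \<cdot> f) = f" using b Fx f by (simp add: biproduct_cancel[OF Q])
  have kk: "cl (k \<cdot> i2 \<cdot> p2) = cl k" using cl_split(1)[OF Q Fx(12)] s1 by simp
  have "right_seq_mor K Sg (cl (i1 \<cdot> ti T A \<oplus> i2 \<cdot> f), cl k, cl s) (cl f, cl (k \<cdot> i2), cl s)
    (cl (idt A)) (cl p2) (cl (idt (cd k)))"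
    by (rule K_morI; (simp only: f1 p2f)?; use s1 f b Fx kk in simp)
  from K.right_seq_isoI[OF this K_idt_inverse K.inverse_mor_sym[OF K_split_inverse(1)[OF Q]] K_idt_inverse]
  have "(cl f, cl (k \<cdot> i2), cl s) \<in> Tri"
    using Tri_I[OF D_I[OF s(1)]] f Fx s1 by blast
  moreover have "(-\<^sub>K (cl (k \<cdot> i2)), cl s, fmor Sg (cl f)) \<in> Tri"
    using D_Tri[OF s(2)] s(3) s1 b by simp
  ultimately show ?thesis unfolding f(4) by blast
qed

text \<open>(PRT4) relates the original last morphisms: \<open>(1, g, r)\<close>,
  \<open>(f, 1, s)\<close> and \<open>(l, k, 1)\<close> are morphisms of triangles. Composing each
  with a comparison to a fixed triangle, uniqueness turns them into the relations for
  \<open>\<phi>\<close>, \<open>\<beta>\<close>, \<open>\<gamma>\<close> and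
  \<open>\<xi>\<close>.\<close>

lemma octahedron_standard:
  assumes f: "standard f l a \<phi>" and g: "standard g h j \<gamma>" and gf: "standard (g \<cdot> f) k b \<beta>" and fg: "cd f = dm g"
  obtains r s \<xi> where "standard r s (fmor \<Sigma> l \<cdot> j) \<xi>" "mor r" "mor s" "dm r = cd l" "cd r = cd k" "dm s = cd k" "cd s = cd h"
    "r \<cdot> l = k \<cdot> g" "s \<cdot> k = h" "cl (\<beta> \<cdot> r) = cl \<phi>" "cl (\<gamma> \<cdot> s) = fmor Sg (cl f) \<cdot>\<^sub>K cl \<beta>"
    "cl \<xi> = fmor Sg (cl l) \<cdot>\<^sub>K cl \<gamma>"
proof -
  note ty = standard_hom[OF f] standard_hom[OF g] fg
  have gfd: "dm (g \<cdot> f) = dm f" "cd (g \<cdot> f) = cd g" using ty by auto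
  note tgf = standard_hom[OF gf, unfolded gfd]
  note Rh = R_hom(1-6)[OF ty(1)] R_hom(1-6)[OF ty(13)] R_hom(1-6)[OF tgf(1), unfolded gfd]
  have rs: "right_seq \<A> \<Sigma> (dm f) (cd f) (cd l) (f, l, a)" "right_seq \<A> \<Sigma> (cd f) (cd g) (cd h) (g, h, j)"
    "right_seq \<A> \<Sigma> (dm f) (cd g) (cd k) (g \<cdot> f, k, b)"
    using R_right_seq[OF ty(1)] R_right_seq[OF ty(13)] R_right_seq[OF tgf(1)] gfd fg by simp_all
  obtain r s where o: "r \<in> Hom \<A> (cd l) (cd k)" "s \<in> Hom \<A> (cd k) (cd h)" "r \<cdot> l = k \<cdot> g" "b \<cdot> r = a" "s \<cdot> k = h"
    "j \<cdot> s = fmor \<Sigma> f \<cdot> b" "(r, s, fmor \<Sigma> l \<cdot> j) \<in> R" "X_monic \<A> \<X> (cd l) (cd k) r"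
    using PRT4[OF ty(1,13) tgf(1) _ _ _ _ _ rs] ty by (auto simp: X_monic_iff)
  note rty = o(1,2)[unfolded hom_iff]
  have xr: "xmonic r" using o(8) X_monic_iff by blast
  have rC: "dm r \<in> \<C>" "cd r \<in> \<C>" "cd l \<in> \<C>" using rty ty tgf by auto
  obtain \<xi> where x: "standard r s (fmor \<Sigma> l \<cdot> j) \<xi>" using standard_ex[OF o(7) rC(1,2) xr] by blast
  obtain df where df: "smor (f, l, a) (tri_at T (dm f)) (idt (dm f)) df \<phi>"
    using standard_mor[OF f] by metis
  obtain dg where dg: "smor (g, h, j) (tri_at T (cd f)) (idt (cd f)) dg \<gamma>"
    using standard_mor[OF g] fg by metis
  obtain dgf where dgf: "smor (g \<cdot> f, k, b) (tri_at T (dm f)) (idt (dm f)) dgf \<beta>"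
    using standard_mor[OF gf] gfd by metis
  obtain dx where dx: "smor (r, s, fmor \<Sigma> l \<cdot> j) (tri_at T (cd l)) (idt (cd l)) dx \<xi>"
    using standard_mor[OF x] rty by metis
  have "smor (f, l, a) (g \<cdot> f, k, b) (idt (dm f)) g r"
    unfolding right_seq_mor_iff using ty Rh rty o(3,4) by simp
  from mor_unique_fixed[OF ty(1,12,8) right_seq_mor_cmp[OF this dgf] df]
  have 1: "cl (\<beta> \<cdot> r) = cl \<phi>" using ty by simp
  have "smor (g \<cdot> f, k, b) (g, h, j) f (idt (cd g)) s"
    unfolding right_seq_mor_iff using ty Rh rty o(5,6) by simp
  note m2 = right_seq_mor_cmp[OF this dg]
  obtain \<delta>' \<kappa> where k1: "smor (g \<cdot> f, k, b) (tri_at T (cd f)) (f \<cdot> idt (dm f)) \<delta>' (\<kappa> \<cdot> \<beta>)"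
    "fmor Sg (cl f) \<cdot>\<^sub>K cl \<beta> = cl (\<kappa> \<cdot> \<beta>)"
    using shift_compose[OF dgf ty(8,9,2)] by metis
  have "cl (\<gamma> \<cdot> s) = cl (\<kappa> \<cdot> \<beta>)"
    by (rule mor_unique_fixed[OF tgf(1,12) ty(9) m2 k1(1)]) (use ty in simp)
  then have 2: "cl (\<gamma> \<cdot> s) = fmor Sg (cl f) \<cdot>\<^sub>K cl \<beta>" using k1 by simp
  have "smor (g, h, j) (r, s, fmor \<Sigma> l \<cdot> j) l k (idt (cd h))"
    unfolding right_seq_mor_iff using ty Rh rty o(3,5) by simp
  note m3 = right_seq_mor_cmp[OF this dx]
  obtain \<delta>'' \<kappa>' where k2: "smor (g, h, j) (tri_at T (cd l)) (l \<cdot> idt (cd f)) \<delta>'' (\<kappa>' \<cdot> \<gamma>)"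
    "fmor Sg (cl l) \<cdot>\<^sub>K cl \<gamma> = cl (\<kappa>' \<cdot> \<gamma>)"
    using shift_compose[OF dg ty(9) rC(3), of l] ty by metis
  have "cl (\<xi> \<cdot> idt (cd h)) = cl (\<kappa>' \<cdot> \<gamma>)"
    by (rule mor_unique_fixed[OF ty(13,24) rC(3) m3 k2(1)]) (use ty in simp)
  then have 3: "cl \<xi> = fmor Sg (cl l) \<cdot>\<^sub>K cl \<gamma>" using k2 standard_hom[OF x] rty by simp
  show thesis using that[OF x _ _ _ _ _ _ o(3,5) 1 2 3] rty by auto
qed

text \<open>The representative \<open>1 \<oplus> (i\<^sup>B, g): X\<^sup>A \<oplus> B \<rightarrow> X\<^sup>A \<oplus> (X\<^sup>B \<oplus> C)\<close> of \<open>g\<close> keeps the composite with \<open>(i\<^sup>A, f)\<close>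
  in the form to which (PRT1)(iii) applies.\<close>

lemma stab_octahedron:
  assumes "F \<in> Hom K A B" "G \<in> Hom K B C"
  shows "\<exists>B1 C1 \<beta> \<beta>' \<delta> \<delta>' f1 g1 l a h j k b r s. inverse_mor K B B1 \<beta> \<beta>' \<and> inverse_mor K C C1 \<delta> \<delta>' \<and>
        f1 \<in> Hom K A B1 \<and> g1 \<in> Hom K B1 C1 \<and> \<beta> \<cdot>\<^sub>K F = f1 \<and> \<delta> \<cdot>\<^sub>K G = g1 \<cdot>\<^sub>K \<beta> \<and>
        (f1, l, a) \<in> Tri \<and> (g1, h, j) \<in> Tri \<and> (g1 \<cdot>\<^sub>K f1, k, b) \<in> Tri \<and>
        r \<cdot>\<^sub>K l = k \<cdot>\<^sub>K g1 \<and> b \<cdot>\<^sub>K r = a \<and> s \<cdot>\<^sub>K k = h \<and> j \<cdot>\<^sub>K s = fmor Sg f1 \<cdot>\<^sub>K b \<and>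
        (r, s, fmor Sg l \<cdot>\<^sub>K j) \<in> Tri \<and> (\<exists>C' B' A'. right_seq K Sg A B1 C' (f1, l, a) \<and>
          right_seq K Sg B1 C1 A' (g1, h, j) \<and> right_seq K Sg A C1 B' (g1 \<cdot>\<^sub>K f1, k, b) \<and>
          r \<in> Hom K C' B' \<and> s \<in> Hom K B' A')"
proof -
  obtain f where f: "mor f" "dm f = A" "cd f = B" "F = cl f" "A \<in> \<C>" "B \<in> \<C>" using stab_homE[OF assms(1)] .
  obtain g where g: "mor g" "dm g = B" "cd g = C" "G = cl g" "B \<in> \<C>" "C \<in> \<C>" using stab_homE[OF assms(2)] .
  note FA = fixed_at[OF f(5)] and FB = fixed_at[OF g(5)]
  obtain Q i1 i2 p1 p2 where Q: "biproduct \<A> (tX T A) B Q i1 i2 p1 p2"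
    using ex_biproduct[of "tX T A" B] f FA by auto
  obtain E e1 e2 d1 d2 where E: "biproduct \<A> (tX T B) C E e1 e2 d1 d2"
    using ex_biproduct[of "tX T B" C] g FB by auto
  have EC: "E \<in> \<C>" and QC: "Q \<in> \<C>" using K_split_inverse(2) E Q FA FB f g by blast+
  obtain M m1 m2 n1 n2 where M: "biproduct \<A> (tX T A) E M m1 m2 n1 n2"
    using ex_biproduct[of "tX T A" E] EC FA by auto
  note b = biproductD[OF Q] biproductD[OF E] biproductD[OF M]
  define f1 where "f1 = i1 \<cdot> ti T A \<oplus> i2 \<cdot> f"
  define g' where "g' = e1 \<cdot> ti T B \<oplus> e2 \<cdot> g"
  define g1 where "g1 = m2 \<cdot> (g' \<cdot> p2) \<oplus> m1 \<cdot> p1"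
  have ty: "mor f1" "dm f1 = A" "cd f1 = Q" "mor g'" "dm g' = B" "cd g' = E"
    unfolding f1_def g'_def using b f g FA FB by simp_all
  have g1: "mor g1" "dm g1 = Q" "cd g1 = M"
    unfolding g1_def using b ty by simp_all
  obtain l a where Rf: "(f1, l, a) \<in> R" "xmonic f1"
    by (rule pushout_R[OF f(5,1,2) f(6)[folded f(3)] Q[folded f(3)], folded f1_def])
  obtain h' j' where Rg': "(g', h', j') \<in> R" "xmonic g'"
    by (rule pushout_R[OF g(5,1,2) g(6)[folded g(3)] E[folded g(3)], folded g'_def])
  \<comment> \<open>\<open>R_stabilize\<close> adds the identity as second summand, while
    \<open>tX T A\<close> is the first summand of \<open>Q\<close> and \<open>M\<close>; the
    biproducts are therefore read in reverse order.\<close>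
  have Rg: "(g1, h' \<cdot> n2, fmor \<Sigma> i2 \<cdot> j') \<in> R"
    unfolding g1_def using R_stabilize[OF Rg'(1), of "tX T A" Q i2 i1 p2 p1 M m2 m1 n2 n1] ty FA
      biproduct_sym[OF Q] biproduct_sym[OF M] by simp
  have xg: "xmonic g1"
    unfolding g1_def using xmonic_sum[OF Rg'(2), of "tX T A" Q i2 i1 p2 p1 M m2 m1 n2 n1] ty
      biproduct_sym[OF Q] biproduct_sym[OF M] by simp
  have M': "biproduct \<A> (tX T A) (cd (g' \<cdot> f)) M m1 m2 n1 n2" using M ty f by simp
  have "mor (g' \<cdot> f)" "dm (g' \<cdot> f) = A" "cd (g' \<cdot> f) \<in> \<C>" using f ty EC by simp_all
  note gf_hom = this
  obtain k c where
    "(m1 \<cdot> ti T A \<oplus> m2 \<cdot> (g' \<cdot> f), k, c) \<in> R" and MC: "M \<in> \<C>"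
    by (rule pushout_R[OF f(5) gf_hom M'])
  moreover have gf: "g1 \<cdot> f1 = m1 \<cdot> ti T A \<oplus> m2 \<cdot> (g' \<cdot> f)"
    unfolding g1_def f1_def using b f g FA FB ty
    by (simp add: biproduct_cancel[OF Q] add_commute[of "m2 \<cdot> (g' \<cdot> f)"])
  ultimately have Rgf: "(g1 \<cdot> f1, k, c) \<in> R" by simp
  have xgf: "xmonic (g1 \<cdot> f1)" using xmonic_cmp[OF Rf(2) xg] ty g1 by simp
  obtain \<phi> where sf: "standard f1 l a \<phi>"
    using standard_ex[OF Rf(1) _ _ Rf(2)] ty f QC by auto
  obtain \<gamma> where sg: "standard g1 (h' \<cdot> n2) (fmor \<Sigma> i2 \<cdot> j') \<gamma>"
    using standard_ex[OF Rg(1) _ _ xg] g1 QC MC by auto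
  obtain \<beta> where sgf: "standard (g1 \<cdot> f1) k c \<beta>"
    using standard_ex[OF Rgf(1) _ _ xgf] ty f g1 MC by auto
  obtain r s \<xi> where o: "standard r s (fmor \<Sigma> l \<cdot> (fmor \<Sigma> i2 \<cdot> j')) \<xi>" "mor r" "mor s" "dm r = cd l" "cd r = cd k" "dm s = cd k" "cd s = cd (h' \<cdot> n2)"
    "r \<cdot> l = k \<cdot> g1" "s \<cdot> k = h' \<cdot> n2" "cl (\<beta> \<cdot> r) = cl \<phi>" "cl (\<gamma> \<cdot> s) = fmor Sg (cl f1) \<cdot>\<^sub>K cl \<beta>"
    "cl \<xi> = fmor Sg (cl l) \<cdot>\<^sub>K cl \<gamma>"
    using octahedron_standard[OF sf sg sgf] ty g1 by metis
  note tf = standard_hom[OF sf, unfolded ty] and tg = standard_hom[OF sg, unfolded g1]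
  have gfd: "dm (g1 \<cdot> f1) = A" "cd (g1 \<cdot> f1) = M" using ty g1 by simp_all
  note tgf = standard_hom[OF sgf, unfolded gfd]
  have \<beta>: "inverse_mor K B Q (cl i2) (cl p2)" by (rule K_split_inverse(1)[OF Q FA(12) f(6)])
  have \<delta>0: "inverse_mor K C E (cl e2) (cl d2)" "inverse_mor K E M (cl m2) (cl n2)"
    by (rule K_split_inverse(1)[OF E FB(12) g(6)], rule K_split_inverse(1)[OF M FA(12) EC])
  \<comment> \<open>\<open>C\<close> is enlarged twice, by \<open>tX T B\<close> to make
    \<open>g\<close> an \<open>\<X>\<close>-monic and by \<open>tX T A\<close> to match the new
    domain; both enlargements are stable isomorphisms.\<close>
  have \<delta>: "inverse_mor K C M (cl m2 \<cdot>\<^sub>K cl e2) (cl d2 \<cdot>\<^sub>K cl n2)"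
    by (rule additive_category.inverse_mor_cmp[OF stab_additive \<delta>0])
  have "p2 \<cdot> f1 = f" unfolding f1_def using b FA f by (simp add: biproduct_cancel[OF Q])
  then have 1: "cl i2 \<cdot>\<^sub>K F = cl f1"
    using cl_split(2)[OF Q FA(12), of "idt Q" f1] ty f b by simp
  have "d2 \<cdot> g' = g" unfolding g'_def using b FB g by (simp add: biproduct_cancel[OF E])
  then have "cl (e2 \<cdot> g) = cl g'"
    using cl_split(2)[OF E FB(12), of "idt E" g'] ty b by simp
  then have "cl m2 \<cdot>\<^sub>K cl (e2 \<cdot> g) = cl (m2 \<cdot> g')" using b ty by simp
  moreover have "g1 \<cdot> i2 = m2 \<cdot> g'" unfolding g1_def using b ty by simp
  ultimately have 2: "cl m2 \<cdot>\<^sub>K cl e2 \<cdot>\<^sub>K G = cl g1 \<cdot>\<^sub>K cl i2"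
    using b g g1 by simp
  show ?thesis
  proof (intro exI conjI)
    show "inverse_mor K B Q (cl i2) (cl p2)" "inverse_mor K C M (cl m2 \<cdot>\<^sub>K cl e2) (cl d2 \<cdot>\<^sub>K cl n2)"
      using \<beta> \<delta> by auto
    show "cl f1 \<in> Hom K A Q" "cl g1 \<in> Hom K Q M" using ty g1 f QC MC by (auto intro: stab_homI)
    show "cl i2 \<cdot>\<^sub>K F = cl f1" "cl m2 \<cdot>\<^sub>K cl e2 \<cdot>\<^sub>K G = cl g1 \<cdot>\<^sub>K cl i2" using 1 2 by auto
    show "(cl f1, cl l, cl \<phi>) \<in> Tri" "(cl g1, cl (h' \<cdot> n2), cl \<gamma>) \<in> Tri" using D_Tri sf sg by auto
    show "(cl g1 \<cdot>\<^sub>K cl f1, cl k, cl \<beta>) \<in> Tri" using D_Tri[OF sgf] ty g1 by simp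
    show "cl r \<cdot>\<^sub>K cl l = cl k \<cdot>\<^sub>K cl g1" using o tf tgf g1 by simp
    show "cl \<beta> \<cdot>\<^sub>K cl r = cl \<phi>" using o tgf by simp
    show "cl s \<cdot>\<^sub>K cl k = cl (h' \<cdot> n2)" using o tgf by simp
    show "cl \<gamma> \<cdot>\<^sub>K cl s = fmor Sg (cl f1) \<cdot>\<^sub>K cl \<beta>" using o tg by simp
    show "(cl r, cl s, fmor Sg (cl l) \<cdot>\<^sub>K cl \<gamma>) \<in> Tri" using D_Tri[OF o(1)] o(12) by simp
    show "right_seq K Sg A Q (cd l) (cl f1, cl l, cl \<phi>)" "right_seq K Sg Q M (cd (h' \<cdot> n2)) (cl g1, cl (h' \<cdot> n2), cl \<gamma>)"
      using standard_seq[OF sf] standard_seq[OF sg] ty g1 by auto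
    show "right_seq K Sg A M (cd k) (cl g1 \<cdot>\<^sub>K cl f1, cl k, cl \<beta>)"
      using standard_seq[OF sgf] ty g1 by simp
    show "cl r \<in> Hom K (cd l) (cd k)" "cl s \<in> Hom K (cd k) (cd (h' \<cdot> n2))"
      using o tf tg tgf by (auto intro: stab_homI)
  qed
qed

lemma standard_triangles_K: "standard_triangles K Sg D Tri"
proof (intro standard_triangles.intro K_shift standard_triangles_axioms.intro)
  show "Tri = {t. \<exists>s\<in>D. right_seq_iso K Sg s t}" by (rule right_triangles_def)
  show "\<exists>A B C. right_seq K Sg A B C t" if "t \<in> D" for t
    using that standard_seq unfolding D_iff by blast
  show "\<exists>Z. zero_object K Z \<and> (Idt K A, Zero K A Z, Zero K Z (fob Sg A)) \<in> D" if "A \<in> Ob K" for A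
    by (rule standard_id) (use that in simp)
qed (rule standard_TR3 standard_coker stab_rotation stab_octahedron; assumption)+

end

section \<open>Duality\<close>

lemma opp_simps [simp]:
  "Ob (opp \<A>) = Ob \<A>" "Hom (opp \<A>) A B = Hom \<A> B A" "Idt (opp \<A>) = Idt \<A>"
  "g \<cdot>\<^bsub>opp \<A>\<^esub> f = f \<cdot>\<^bsub>\<A>\<^esub> g" "Add (opp \<A>) = Add \<A>" "Zero (opp \<A>) A B = Zero \<A> B A"
  "Neg (opp \<A>) = Neg \<A>"
  by (simp_all add: opp_def)

lemma opp_opp [simp]: "opp (opp \<A>) = \<A>"
  by (simp add: opp_def)

lemma rev_seq_rev_seq [simp]: "rev_seq (rev_seq t) = t"
  by (simp add: rev_seq_def split: prod.splits)

lemma rev_seq_image_image [simp]: "rev_seq ` rev_seq ` Q = Q"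
  by (simp add: image_image)

lemma rev_seq_mem [simp]: "(f, g, h) \<in> rev_seq ` Q \<longleftrightarrow> (h, g, f) \<in> Q"
  by (force simp: rev_seq_def split: prod.splits)

lemma inverse_mor_opp [simp]: "inverse_mor (opp \<A>) A B f g \<longleftrightarrow> inverse_mor \<A> B A f g"
  by (auto simp: inverse_mor_def)

lemma iso_mor_opp [simp]: "iso_mor (opp \<A>) A B f \<longleftrightarrow> iso_mor \<A> B A f"
  by (simp add: iso_mor_def)

lemma additive_functor_opp [simp]: "additive_functor (opp \<A>) F \<longleftrightarrow> additive_functor \<A> F"
  unfolding additive_functor_def by (simp, blast)

lemma X_monic_opp [simp]: "X_monic (opp \<A>) \<X> A B f \<longleftrightarrow> X_epic \<A> \<X> B A f"
  and X_epic_opp [simp]: "X_epic (opp \<A>) \<X> A B f \<longleftrightarrow> X_monic \<A> \<X> B A f"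
  by (simp_all add: X_monic_def X_epic_def)

context additive_category
begin

text \<open>\<open>mor\<close>, \<open>dm\<close> and \<open>cd\<close> depend on the category, so
  facts from an interpretation in \<open>opp \<A>\<close> come with their own copies; these
  equations translate them, exchanging the two ends.\<close>

lemma opp_calculus:
  assumes "additive_category (opp \<A>)"
  shows "additive_category.mor (opp \<A>) = mor" "additive_category.dm (opp \<A>) = cd"
    "additive_category.cd (opp \<A>) = dm"
  using additive_category.mor_def[OF assms] additive_category.dm_def[OF assms]
    additive_category.cd_def[OF assms]
  by (auto simp: fun_eq_iff mor_def dm_def cd_def)

end

lemma adjoint_pair_bij:
  assumes "adjoint_pair \<A> F G \<psi>" "C \<in> Ob \<A>" "A \<in> Ob \<A>"
  shows "bij_betw (\<psi> C A) (Hom \<A> (fob F C) A) (Hom \<A> C (fob G A))"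
  using assms unfolding adjoint_pair_def by blast

lemma adj_inv_props:
  assumes "adjoint_pair \<A> F G \<psi>" "C \<in> Ob \<A>" "A \<in> Ob \<A>"
  shows "h \<in> Hom \<A> C (fob G A) \<Longrightarrow> adj_inv \<A> F \<psi> C A h \<in> Hom \<A> (fob F C) A"
    "h \<in> Hom \<A> C (fob G A) \<Longrightarrow> \<psi> C A (adj_inv \<A> F \<psi> C A h) = h"
    "u \<in> Hom \<A> (fob F C) A \<Longrightarrow> \<psi> C A u \<in> Hom \<A> C (fob G A)"
    "u \<in> Hom \<A> (fob F C) A \<Longrightarrow> adj_inv \<A> F \<psi> C A (\<psi> C A u) = u"
    "bij_betw (adj_inv \<A> F \<psi> C A) (Hom \<A> C (fob G A)) (Hom \<A> (fob F C) A)"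
  using adjoint_pair_bij[OF assms] bij_betw_inv_into[OF adjoint_pair_bij[OF assms]]
  unfolding adj_inv_def by (auto simp: bij_betw_def intro: inv_into_into f_inv_into_f)

text \<open>A morphism from \<open>G C\<close> to \<open>A\<close> in \<open>opp \<A>\<close> is one
  from \<open>A\<close> to \<open>G C\<close> in \<open>\<A>\<close>, where \<open>F\<close> is left
  adjoint to \<open>G\<close>; the adjunction of the opposite category is therefore the inverse
  bijection with indices swapped.\<close>

definition opp_adj ::
  "('o, 'm) acat \<Rightarrow> ('o, 'm) endofun \<Rightarrow> ('o \<Rightarrow> 'o \<Rightarrow> 'm \<Rightarrow> 'm) \<Rightarrow> 'o \<Rightarrow> 'o \<Rightarrow> 'm \<Rightarrow> 'm" where
  "opp_adj \<A> F \<psi> C A = adj_inv \<A> F \<psi> A C"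

lemma (in additive_category) adjoint_pair_opp:
  assumes adj: "adjoint_pair \<A> F G \<psi>"
  shows "adjoint_pair (opp \<A>) G F (opp_adj \<A> F \<psi>)"
proof -
  have F: "additive_functor \<A> F" and G: "additive_functor \<A> G" using adj unfolding adjoint_pair_def by auto
  have nat: "opp_adj \<A> F \<psi> C' A' (a \<cdot>\<^bsub>opp \<A>\<^esub> u \<cdot>\<^bsub>opp \<A>\<^esub> fmor G c) =
      fmor F a \<cdot>\<^bsub>opp \<A>\<^esub> opp_adj \<A> F \<psi> C A u \<cdot>\<^bsub>opp \<A>\<^esub> c"
    if c: "c \<in> Hom (opp \<A>) C' C" and a: "a \<in> Hom (opp \<A>) A A'" and u: "u \<in> Hom (opp \<A>) (fob G C) A"
    for C C' A A' c a u
  proof -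
    note ty = c[simplified, unfolded hom_iff] a[simplified, unfolded hom_iff] u[simplified, unfolded hom_iff]
    define x where "x = adj_inv \<A> F \<psi> A C u"
    have x: "x \<in> Hom \<A> (fob F A) C" "\<psi> A C x = u"
      unfolding x_def using adj_inv_props(1,2)[OF adj] ty u by auto
    note xt = x(1)[unfolded hom_iff]
    have "\<psi> A' C' (c \<cdot> x \<cdot> fmor F a) = fmor G c \<cdot> \<psi> A C x \<cdot> a"
      using adj a c x(1) unfolding adjoint_pair_def by auto
    moreover have "c \<cdot> x \<cdot> fmor F a \<in> Hom \<A> (fob F A') C'"
      using xt ty additive_functorD[OF F] by (simp add: hom_iff)
    ultimately have "adj_inv \<A> F \<psi> A' C' (fmor G c \<cdot> u \<cdot> a) = c \<cdot> x \<cdot> fmor F a"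
      using adj_inv_props(4)[OF adj, of A' C' "c \<cdot> x \<cdot> fmor F a"] ty x by simp
    then show ?thesis
      using ty xt additive_functorD[OF F] additive_functorD[OF G] by (simp add: opp_adj_def x_def)
  qed
  show ?thesis
    unfolding adjoint_pair_def
    using F G nat adj_inv_props(5)[OF adj] by (auto simp: opp_adj_def)
qed

context partial_triangulated
begin

sublocale right_fixed \<A> \<Sigma> R \<C> \<X> T
  by (intro right_fixed.intro right_fixed_axioms.intro right fixed_right)

lemmas adj_props = adj_inv_props[OF adjoint]

text \<open>The two directions of the exchange axiom swap roles, as do the conditions on
  \<open>tp T\<close> and \<open>tp S\<close>. Hence results on right triangles hold for left
  triangles by interpretation in \<open>opp \<A>\<close>.\<close>

lemma dual: "partial_triangulated (opp \<A>) \<Sigma> \<Omega> (rev_seq ` R) (rev_seq ` L) \<C> \<X> (opp_adj \<A> \<Omega> \<psi>) T S"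
proof (rule partial_triangulated.intro)
  show "partial_left_triangulated (opp \<A>) \<Sigma> (rev_seq ` R) \<C> \<X>"
    using right by (simp add: partial_left_triangulated_def)
  show "partial_right_triangulated (opp \<A>) \<Omega> (rev_seq ` L) \<C> \<X>"
    using left by (simp add: partial_left_triangulated_def)
  show "fixed_left_triangles (opp \<A>) \<Sigma> (rev_seq ` R) \<C> \<X> T"
    using fixed_right by (simp add: fixed_left_triangles_def)
  show "fixed_right_triangles (opp \<A>) \<Omega> (rev_seq ` L) \<C> \<X> S"
    using fixed_left by (simp add: fixed_left_triangles_def)
  show "adjoint_pair (opp \<A>) \<Sigma> \<Omega> (opp_adj \<A> \<Omega> \<psi>)"
    by (rule adjoint_pair_opp[OF adjoint])
  show "(v, w, \<ominus>\<^bsub>opp \<A>\<^esub> (opp_adj \<A> \<Omega> \<psi> C A u)) \<in> rev_seq ` L"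
    if "(u, v, w) \<in> rev_seq ` R" "B \<in> \<C>" "C \<in> \<C>" "u \<in> Hom (opp \<A>) (fob \<Sigma> C) A"
      "v \<in> Hom (opp \<A>) A B" "w \<in> Hom (opp \<A>) B C" for u v w A B C
    using right_to_left[of w v u C B A] that by (simp add: right_seq_def opp_adj_def)
  show "(\<ominus>\<^bsub>opp \<A>\<^esub> (adj_inv (opp \<A>) \<Sigma> (opp_adj \<A> \<Omega> \<psi>) C A h), f, g) \<in> rev_seq ` R"
    if "(f, g, h) \<in> rev_seq ` L" "A \<in> \<C>" "B \<in> \<C>" "right_seq (opp \<A>) \<Omega> A B C (f, g, h)" for f g h A B C
  proof -
    have h: "h \<in> Hom \<A> (fob \<Omega> A) C" and C: "C \<in> Ob \<A>" and gf: "g \<in> Hom \<A> C B" "f \<in> Hom \<A> B A"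
      using that(4) by (auto simp: right_seq_def hom_iff)
    \<comment> \<open>The adjunction of the opposite category is the inverse of
      \<open>\<psi>\<close>, so inverting it returns \<open>\<psi>\<close>.\<close>
    have "adj_inv (opp \<A>) \<Sigma> (opp_adj \<A> \<Omega> \<psi>) C A h = \<psi> A C h"
      unfolding adj_inv_def[of "opp \<A>"] opp_adj_def
      using adj_props(4)[OF _ C h] adj_props(3)[OF _ C h] adj_props(5)[OF _ C, of A] that(2) h
      by (auto simp: bij_betw_def intro!: inv_into_f_eq)
    then show ?thesis using left_to_right[of h g f B A C] that h gf by simp
  qed
  show "X_precover (opp \<A>) \<X> (tX S A) (tU S A) (tp S A)" if "A \<in> \<C>" for A
    using iota_preenvelope[OF that] by (simp add: X_precover_def X_preenvelope_def)
  show "X_preenvelope (opp \<A>) \<X> (tU T A) (tX T A) (tp T A)" if "A \<in> \<C>" for A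
    using p_precover[OF that] by (simp add: X_precover_def X_preenvelope_def)
qed

end

section \<open>Right triangles as left triangles\<close>

context partial_triangulated
begin

definition xepic :: "'m \<Rightarrow> bool" where "xepic f \<longleftrightarrow> mor f \<and>
  (\<forall>v. mor v \<longrightarrow> cd v = cd f \<longrightarrow> dm v \<in> \<X> \<longrightarrow> (\<exists>w. mor w \<and> cd w = dm f \<and> dm w = dm v \<and> f \<cdot> w = v))"

lemma xepicE:
  assumes "xepic f" "mor v" "cd v = cd f" "dm v \<in> \<X>"
  obtains w where "mor w" "cd w = dm f" "dm w = dm v" "f \<cdot> w = v"
  using assms unfolding xepic_def by blast

text \<open>The first morphism of the left triangle that the exchange axiom assigns to the right
  triangle \<open>(f, g, h)\<close>.\<close>

abbreviation unadj :: "'m \<Rightarrow> 'm \<Rightarrow> 'm \<Rightarrow> 'm" where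
  "unadj f g h \<equiv> \<ominus> (adj_inv \<A> \<Omega> \<psi> (cd g) (dm f) h)"

lemma psi_natural:
  assumes "u \<in> Hom \<A> (fob \<Omega> C) A" "C \<in> Ob \<A>"
  shows "mor a \<Longrightarrow> dm a = A \<Longrightarrow> \<psi> C (cd a) (a \<cdot> u) = fmor \<Sigma> a \<cdot> \<psi> C A u"
    "mor c \<Longrightarrow> cd c = C \<Longrightarrow> \<psi> (dm c) A (u \<cdot> fmor \<Omega> c) = \<psi> C A u \<cdot> c"
proof -
  have O: "additive_functor \<A> \<Omega>" using adjoint by (simp add: adjoint_pair_def)
  have A: "A \<in> Ob \<A>" using assms by (simp add: hom_iff)
  note u = assms(1)[unfolded hom_iff] and pu = adj_props(3)[OF assms(2) A assms(1), unfolded hom_iff]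
  have nat: "\<psi> C' A' (a \<cdot> u \<cdot> fmor \<Omega> c) = fmor \<Sigma> a \<cdot> \<psi> C A u \<cdot> c"
    if "c \<in> Hom \<A> C' C" "a \<in> Hom \<A> A A'" for C' A' c a
    using adjoint that assms unfolding adjoint_pair_def by blast
  show "\<psi> C (cd a) (a \<cdot> u) = fmor \<Sigma> a \<cdot> \<psi> C A u" if "mor a" "dm a = A"
    using nat[of "idt C" C a "cd a"] that u pu assms(2) additive_functorD[OF O] by (simp add: hom_iff)
  show "\<psi> (dm c) A (u \<cdot> fmor \<Omega> c) = \<psi> C A u \<cdot> c" if "mor c" "cd c = C"
    using nat[of c "dm c" "idt A" A] that u pu assms(2) A additive_functorD[OF O] by (simp add: hom_iff)
qed

text \<open>Naturality along \<open>- 1\<close> and additivity of \<open>\<Sigma>\<close>; the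
  adjunction is given as a natural bijection, with no mention of sums.\<close>

lemma psi_neg:
  assumes "u \<in> Hom \<A> (fob \<Omega> C) A" "C \<in> Ob \<A>"
  shows "\<psi> C A (\<ominus> u) = \<ominus> (\<psi> C A u)"
proof -
  have A: "A \<in> Ob \<A>" using assms by (simp add: hom_iff)
  have "\<psi> C A (\<ominus> u) = \<psi> C A ((\<ominus> idt A) \<cdot> u)" using assms A by (simp add: hom_iff)
  also have "\<dots> = fmor \<Sigma> (\<ominus> idt A) \<cdot> \<psi> C A u" using psi_natural(1)[OF assms, of "\<ominus> idt A"] A by simp
  finally show ?thesis using A adj_props(3)[OF assms(2) A assms(1)] by (simp add: hom_iff)
qed

lemma unadj_props:
  assumes "mor h" "dm h = cd g" "cd h = fob \<Sigma> (dm f)" "mor g" "mor f"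
  shows "unadj f g h \<in> Hom \<A> (fob \<Omega> (cd g)) (dm f)" "\<psi> (cd g) (dm f) (unadj f g h) = \<ominus> h"
proof -
  have h: "h \<in> Hom \<A> (cd g) (fob \<Sigma> (dm f))" using assms by (simp add: hom_iff)
  note p = adj_props(1,2)[OF _ _ h]
  show "unadj f g h \<in> Hom \<A> (fob \<Omega> (cd g)) (dm f)" using p(1) assms by (simp add: hom_iff)
  show "\<psi> (cd g) (dm f) (unadj f g h) = \<ominus> h"
    using psi_neg[OF p(1)] p(2) assms by simp
qed

lemma unadj_neg_psi:
  assumes "u \<in> Hom \<A> (fob \<Omega> (cd g)) (dm f)" "mor g" "mor f"
  shows "unadj f g (\<ominus> \<psi> (cd g) (dm f) u) = u"
proof -
  have "\<ominus> u \<in> Hom \<A> (fob \<Omega> (cd g)) (dm f)" using assms by (simp add: hom_iff)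
  from adj_props(4)[OF _ _ this] psi_neg[OF assms(1)] assms show ?thesis by (simp add: hom_iff)
qed

text \<open>The squares between \<open>f\<close> and \<open>f'\<close> and between \<open>g\<close>
  and \<open>g'\<close> are the same on both sides. For the remaining one, \<open>\<psi>\<close> is
  injective and, by naturality in either variable, sends the two sides to
  \<open>- \<Sigma> \<alpha> \<cdot> h\<close> and \<open>- h' \<cdot> \<gamma>\<close>; the sign
  drops out.\<close>

lemma mor_dual:
  assumes "mor f" "mor g" "mor h" "dm g = cd f" "dm h = cd g" "cd h = fob \<Sigma> (dm f)"
    "mor f'" "mor g'" "mor h'" "dm g' = cd f'" "dm h' = cd g'" "cd h' = fob \<Sigma> (dm f')"
  shows "smor (f, g, h) (f', g', h') \<alpha> \<beta> \<gamma> \<longleftrightarrow>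
    right_seq_mor (opp \<A>) \<Omega> (g', f', unadj f' g' h') (g, f, unadj f g h) \<gamma> \<beta> \<alpha>"
proof -
  interpret d: partial_triangulated "opp \<A>" \<Sigma> \<Omega> "rev_seq ` R" "rev_seq ` L" \<C> \<X> "opp_adj \<A> \<Omega> \<psi>" T S
    by (rule dual)
  have O: "additive_functor \<A> \<Omega>" using adjoint by (simp add: adjoint_pair_def)
  define u u' where "u = unadj f g h" and "u' = unadj f' g' h'"
  have u: "u \<in> Hom \<A> (fob \<Omega> (cd g)) (dm f)" "\<psi> (cd g) (dm f) u = \<ominus> h"
    using unadj_props assms unfolding u_def by blast+
  have u': "u' \<in> Hom \<A> (fob \<Omega> (cd g')) (dm f')" "\<psi> (cd g') (dm f') u' = \<ominus> h'"
    using unadj_props assms unfolding u'_def by blast+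
  note uty = u(1)[unfolded hom_iff] u'(1)[unfolded hom_iff]
  have key: "fmor \<Sigma> \<alpha> \<cdot> h = h' \<cdot> \<gamma> \<longleftrightarrow> \<alpha> \<cdot> u = u' \<cdot> fmor \<Omega> \<gamma>"
    if ty: "mor \<alpha>" "dm \<alpha> = dm f" "cd \<alpha> = dm f'" "mor \<gamma>" "dm \<gamma> = cd g" "cd \<gamma> = cd g'"
  proof -
    have "\<psi> (cd g) (dm f') (\<alpha> \<cdot> u) = \<ominus> (fmor \<Sigma> \<alpha> \<cdot> h)"
      using psi_natural(1)[OF u(1), of \<alpha>] u(2) ty assms by simp
    moreover have "\<psi> (cd g) (dm f') (u' \<cdot> fmor \<Omega> \<gamma>) = \<ominus> (h' \<cdot> \<gamma>)"
      using psi_natural(2)[OF u'(1), of \<gamma>] u'(2) ty assms by simp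
    moreover have "\<alpha> \<cdot> u \<in> Hom \<A> (fob \<Omega> (cd g)) (dm f')" "u' \<cdot> fmor \<Omega> \<gamma> \<in> Hom \<A> (fob \<Omega> (cd g)) (dm f')"
      using ty uty assms additive_functorD[OF O] by (simp_all add: hom_iff)
    then have "\<alpha> \<cdot> u = u' \<cdot> fmor \<Omega> \<gamma> \<longleftrightarrow> \<psi> (cd g) (dm f') (\<alpha> \<cdot> u) = \<psi> (cd g) (dm f') (u' \<cdot> fmor \<Omega> \<gamma>)"
      using adj_props(4)[of "cd g" "dm f'"] assms by (metis cd_Ob dm_Ob)
    ultimately show ?thesis using ty assms by simp
  qed
  show ?thesis
    unfolding u_def[symmetric] u'_def[symmetric] d.right_seq_mor_iff right_seq_mor_iff
      opp_calculus[OF d.additive_category_axioms] opp_simps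
    using assms uty key by auto
qed

lemma R_to_L:
  assumes "(f, g, h) \<in> R" "dm f \<in> \<C>" "cd f \<in> \<C>"
  shows "(unadj f g h, f, g) \<in> L"
  using right_to_left[OF assms R_right_seq[OF assms(1)]] .

lemma left_fixed: "right_fixed (opp \<A>) \<Omega> (rev_seq ` L) \<C> \<X> S"
  using left fixed_left unfolding partial_left_triangulated_def fixed_left_triangles_def
  by (intro right_fixed.intro right_fixed_axioms.intro)

lemma xmonic_opp: "stable_category.xmonic (opp \<A>) \<X> f \<longleftrightarrow> xepic f"
  and X_epic_iff: "X_epic \<A> \<X> A B f \<longleftrightarrow> xepic f \<and> dm f = A \<and> cd f = B"
proof -
  interpret d: right_fixed "opp \<A>" \<Omega> "rev_seq ` L" \<C> \<X> S by (rule left_fixed)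
  note c = opp_calculus[OF d.additive_category_axioms]
  show 1: "d.xmonic f \<longleftrightarrow> xepic f" for f
    unfolding d.xmonic_def xepic_def c opp_simps by blast
  show "X_epic \<A> \<X> A B f \<longleftrightarrow> xepic f \<and> dm f = A \<and> cd f = B"
    using d.X_monic_iff[of B A f] unfolding c 1 by auto
qed

text \<open>Uniqueness of comparisons in the opposite category, where \<open>g'\<close> becomes
  \<open>\<X>\<close>-monic and the triangle with middle object in \<open>\<X>\<close> becomes the
  target.\<close>

lemma mor_unique_left:
  assumes "(f, g, h) \<in> R" "(f', g', h') \<in> R" "dm f \<in> \<C>" "cd f \<in> \<X>" "dm f' \<in> \<C>" "cd f' \<in> \<C>" "xepic g'"
    "smor (f, g, h) (f', g', h') \<alpha> \<beta> \<gamma>" "smor (f, g, h) (f', g', h') \<alpha>' \<beta>' \<gamma>'"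
    "cl \<gamma> = cl \<gamma>'"
  shows "cl \<alpha> = cl \<alpha>'"
proof -
  interpret d: right_fixed "opp \<A>" \<Omega> "rev_seq ` L" \<C> \<X> S by (rule left_fixed)
  note c = opp_calculus[OF d.additive_category_axioms]
  note ty = R_hom(1-6)[OF assms(1)] R_hom(1-6)[OF assms(2)]
  have "(g', f', unadj f' g' h') \<in> rev_seq ` L" "(g, f, unadj f g h) \<in> rev_seq ` L"
    using R_to_L assms by simp_all
  from d.mor_unique[OF this, unfolded c xmonic_opp stab_class_opp, OF _ assms(7)
      assms(8)[unfolded mor_dual[OF ty]] assms(9)[unfolded mor_dual[OF ty]] assms(10)]
  show ?thesis using ty assms(4) by simp
qed

text \<open>Dual to extending along an \<open>\<X>\<close>-monic: the middle component is a lift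
  along the \<open>\<X>\<close>-epic \<open>g'\<close>.\<close>

lemma mor_exists_left:
  assumes "(f, g, h) \<in> R" "(f', g', h') \<in> R" "dm f \<in> \<C>" "cd f \<in> \<X>" "dm f' \<in> \<C>" "cd f' \<in> \<C>" "xepic g'"
    "mor \<gamma>" "dm \<gamma> = cd g" "cd \<gamma> = cd g'"
  obtains \<alpha> \<beta> where "smor (f, g, h) (f', g', h') \<alpha> \<beta> \<gamma>"
proof -
  interpret d: right_fixed "opp \<A>" \<Omega> "rev_seq ` L" \<C> \<X> S by (rule left_fixed)
  note c = opp_calculus[OF d.additive_category_axioms]
  note ty = R_hom(1-6)[OF assms(1)] R_hom(1-6)[OF assms(2)]
  have L: "(g', f', unadj f' g' h') \<in> rev_seq ` L" "(g, f, unadj f g h) \<in> rev_seq ` L"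
    using R_to_L assms by simp_all
  have X: "dm g \<in> \<X>" using ty assms(4) by simp
  show thesis
    by (rule d.mor_exists[OF L, unfolded c xmonic_opp, OF X assms(7,8,10,9)])
      (rule that, simp add: mor_dual[OF ty])
qed

text \<open>In the opposite category this is the weak cokernel property of the corresponding left
  triangle.\<close>

lemma weak_kernel:
  assumes "(f, g, h) \<in> R" "dm f \<in> \<C>" "cd f \<in> \<C>" "mor z" "cd z = cd f" "g \<cdot> z = zmor (dm z) (cd g)"
  obtains y where "mor y" "dm y = dm z" "cd y = dm f" "f \<cdot> y = z"
proof -
  interpret d: right_fixed "opp \<A>" \<Omega> "rev_seq ` L" \<C> \<X> S by (rule left_fixed)
  note c = opp_calculus[OF d.additive_category_axioms]
  note ty = R_hom(1-6)[OF assms(1)]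
  have "(g, f, unadj f g h) \<in> rev_seq ` L" using R_to_L assms by simp
  from d.R_hom(10)[OF this, of z, unfolded c opp_simps] assms(4-6) ty
  show thesis using that by auto
qed

end

section \<open>Suspension and loop as mutually inverse equivalences\<close>

context partial_triangulated
begin

lemma R_mor_idt:
  "(f, g, h) \<in> R \<Longrightarrow> smor (f, g, h) (f, g, h) (idt (dm f)) (idt (cd f)) (idt (cd g))"
  using right_seq_mor_idt[OF R_right_seq] .

text \<open>Triangles \<open>A \<rightarrow> X \<rightarrow> U \<rightarrow> \<Sigma> A\<close> that present \<open>U\<close> as suspension of \<open>A\<close> and \<open>A\<close> as loop of \<open>U\<close>.\<close>

definition good :: "'m seq \<Rightarrow> bool" where
  "good t \<longleftrightarrow> (case t of (i, p, q) \<Rightarrow> t \<in> R \<and> dm i \<in> \<C> \<and> cd i \<in> \<X> \<and> xmonic i \<and> xepic p)"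

text \<open>The outer objects: \<open>lo t\<close> plays the part of a loop of \<open>hi t\<close>,
  and \<open>hi t\<close> that of a suspension of \<open>lo t\<close>.\<close>

definition lo :: "'m seq \<Rightarrow> 'o" where "lo t = dm (fst t)"
definition hi :: "'m seq \<Rightarrow> 'o" where "hi t = cd (fst (snd t))"

lemma goodD:
  assumes "good t"
  obtains i p q where "t = (i, p, q)" "(i, p, q) \<in> R" "lo t = dm i" "hi t = cd p" "dm i \<in> \<C>" "cd i \<in> \<X>"
    "xmonic i" "xepic p" "cd p \<in> \<C>"
  using assms R_hom(7) by (cases t) (auto simp: good_def lo_def hi_def)

text \<open>A ladder, kept as a relation between its two outer classes so that no choice of functor
  is built in. Suspension, loop, unit and counit all give ladders, up to signs, and identities
  between them follow by comparing two ladders with a common side.\<close>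

definition lad :: "'m seq \<Rightarrow> 'm seq \<Rightarrow> 'm set \<Rightarrow> 'm set \<Rightarrow> bool" where
  "lad t t' F G \<longleftrightarrow> (\<exists>f \<beta> g. F = cl f \<and> G = cl g \<and> smor t t' f \<beta> g)"

lemma ladI: "smor t t' f \<beta> g \<Longrightarrow> lad t t' (cl f) (cl g)"
  unfolding lad_def by blast

lemma lad_hom:
  assumes "good t" "good t'" "lad t t' F G"
  shows "F \<in> Hom K (lo t) (lo t')" "G \<in> Hom K (hi t) (hi t')"
proof -
  obtain i p q where t: "t = (i, p, q)" "lo t = dm i" "hi t = cd p" "dm i \<in> \<C>" "cd p \<in> \<C>" using goodD[OF assms(1)] by metis
  obtain i' p' q' where t': "t' = (i', p', q')" "lo t' = dm i'" "hi t' = cd p'" "dm i' \<in> \<C>" "cd p' \<in> \<C>" using goodD[OF assms(2)] by metis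
  obtain f \<beta> g where l: "F = cl f" "G = cl g" "smor t t' f \<beta> g" using assms(3) unfolding lad_def by blast
  note l3 = l(3)[unfolded t(1) t'(1) right_seq_mor_iff]
  show "F \<in> Hom K (lo t) (lo t')" "G \<in> Hom K (hi t) (hi t')"
    unfolding l(1,2) t(2,3) t'(2,3) by (rule stab_homI; use l3 t t' in simp)+
qed

lemma lad_ex_right:
  assumes "good t" "good t'" "F \<in> Hom K (lo t) (lo t')"
  obtains G where "lad t t' F G" "G \<in> Hom K (hi t) (hi t')"
proof -
  obtain i p q where t: "t = (i, p, q)" "(i, p, q) \<in> R" "lo t = dm i" "xmonic i" using goodD[OF assms(1)] by metis
  obtain i' p' q' where t': "t' = (i', p', q')" "(i', p', q') \<in> R" "lo t' = dm i'" "cd i' \<in> \<X>" using goodD[OF assms(2)] by metis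
  obtain f where f: "mor f" "dm f = lo t" "cd f = lo t'" "F = cl f" using stab_homE[OF assms(3)] .
  obtain \<beta> g where "smor t t' f \<beta> g"
    using mor_exists[OF t(2) t'(2,4) t(4), of f] f t t' by metis
  then show thesis using that ladI f lad_hom[OF assms(1,2)] by blast
qed

lemma lad_ex_left:
  assumes "good t" "good t'" "G \<in> Hom K (hi t) (hi t')"
  obtains F where "lad t t' F G" "F \<in> Hom K (lo t) (lo t')"
proof -
  obtain i p q where t: "t = (i, p, q)" "(i, p, q) \<in> R" "hi t = cd p" "dm i \<in> \<C>" "cd i \<in> \<X>" using goodD[OF assms(1)] by metis
  obtain i' p' q' where t': "t' = (i', p', q')" "(i', p', q') \<in> R" "hi t' = cd p'" "dm i' \<in> \<C>" "cd i' \<in> \<X>" "xepic p'" using goodD[OF assms(2)] by metis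
  obtain g where g: "mor g" "dm g = hi t" "cd g = hi t'" "G = cl g" using stab_homE[OF assms(3)] .
  obtain f \<beta> where "smor t t' f \<beta> g"
    using mor_exists_left[OF t(2) t'(2) t(4,5) t'(4) X_in_C[OF t'(5)] t'(6), of g] g t t' by metis
  then show thesis using that ladI g lad_hom[OF assms(1,2)] by blast
qed

lemma lad_fun_right:
  assumes "good t" "good t'" "lad t t' F G" "lad t t' F G'" shows "G = G'"
proof -
  obtain i p q where t: "t = (i, p, q)" "(i, p, q) \<in> R" "xmonic i" using goodD[OF assms(1)] by metis
  obtain i' p' q' where t': "t' = (i', p', q')" "(i', p', q') \<in> R" "cd i' \<in> \<X>" using goodD[OF assms(2)] by metis
  show ?thesis
    using assms(3,4) mor_unique[OF t(2) t'(2,3) t(3)] unfolding lad_def t(1) t'(1) by blast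
qed

lemma lad_fun_left:
  assumes "good t" "good t'" "lad t t' F G" "lad t t' F' G" shows "F = F'"
proof -
  obtain i p q where t: "t = (i, p, q)" "(i, p, q) \<in> R" "dm i \<in> \<C>" "cd i \<in> \<X>" using goodD[OF assms(1)] by metis
  obtain i' p' q' where t': "t' = (i', p', q')" "(i', p', q') \<in> R" "dm i' \<in> \<C>" "cd i' \<in> \<X>" "xepic p'" using goodD[OF assms(2)] by metis
  show ?thesis
    using assms(3,4) mor_unique_left[OF t(2) t'(2) t(3,4) t'(3) X_in_C[OF t'(4)] t'(5)] unfolding lad_def t(1) t'(1) by blast
qed

lemma lad_cmp:
  assumes "lad t t' F G" "lad t' t'' F' G'"
  shows "lad t t'' (F' \<cdot>\<^sub>K F) (G' \<cdot>\<^sub>K G)"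
proof -
  obtain f \<beta> g where l: "F = cl f" "G = cl g" "smor t t' f \<beta> g" using assms(1) unfolding lad_def by blast
  obtain f' \<beta>' g' where l': "F' = cl f'" "G' = cl g'" "smor t' t'' f' \<beta>' g'" using assms(2) unfolding lad_def by blast
  obtain a b c a' b' c' a'' b'' c'' where t: "t = (a, b, c)" "t' = (a', b', c')" "t'' = (a'', b'', c'')" by (metis prod.exhaust)
  have ty: "mor f" "mor f'" "cd f = dm f'" "mor g" "mor g'" "cd g = dm g'"
    using l(3) l'(3) unfolding t right_seq_mor_iff by auto
  show ?thesis
    unfolding l l' using ladI[OF right_seq_mor_cmp[OF l(3) l'(3)]] ty by simp
qed

lemma lad_neg: assumes "lad t t' F G" shows "lad t t' (-\<^sub>K F) (-\<^sub>K G)"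
proof -
  obtain f \<beta> g where l: "F = cl f" "G = cl g" "smor t t' f \<beta> g" using assms(1) unfolding lad_def by blast
  obtain a b c a' b' c' where t: "t = (a, b, c)" "t' = (a', b', c')" by (metis prod.exhaust)
  have "smor t t' (\<ominus> f) (\<ominus> \<beta>) (\<ominus> g)" "mor f" "mor g"
    using l(3) unfolding t right_seq_mor_iff by auto
  then show ?thesis unfolding l using ladI by simp
qed

lemma lad_idt: assumes "good t" shows "lad t t (Idt K (lo t)) (Idt K (hi t))"
proof -
  obtain i p q where t: "t = (i, p, q)" "(i, p, q) \<in> R" "lo t = dm i" "hi t = cd p" using goodD[OF assms(1)] by metis
  show ?thesis using ladI[OF R_mor_idt[OF t(2)]] t by simp
qed

text \<open>A ladder over the inverse on the right end gives a candidate on the left; the composites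
  are ladders over identities, hence identities by uniqueness.\<close>

lemma lad_inverse:
  assumes "good t" "good t'" "lad t t' F G" "inverse_mor K (hi t) (hi t') G G'"
  obtains F' where "lad t' t F' G'" "inverse_mor K (lo t) (lo t') F F'"
proof -
  obtain F' where F: "lad t' t F' G'" "F' \<in> Hom K (lo t') (lo t)"
    using lad_ex_left[OF assms(2,1), of G'] assms(4) by (auto simp: inverse_mor_def)
  have "F' \<cdot>\<^sub>K F = Idt K (lo t)"
    by (rule lad_fun_left[OF assms(1,1) lad_cmp[OF assms(3) F(1)]])
      (use assms(4) lad_idt[OF assms(1)] in \<open>simp add: inverse_mor_def del: stab_simps\<close>)
  moreover have "F \<cdot>\<^sub>K F' = Idt K (lo t')"
    by (rule lad_fun_left[OF assms(2,2) lad_cmp[OF F(1) assms(3)]])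
      (use assms(4) lad_idt[OF assms(2)] in \<open>simp add: inverse_mor_def del: stab_simps\<close>)
  ultimately show thesis
    using that F lad_hom[OF assms(1-3)] unfolding inverse_mor_def by blast
qed

lemma lad_inverse_hi:
  assumes "good t" "good t'" "lad t t' F G" "inverse_mor K (lo t) (lo t') F F'"
  obtains G' where "lad t' t F' G'" "inverse_mor K (hi t) (hi t') G G'"
proof -
  obtain G' where G: "lad t' t F' G'" "G' \<in> Hom K (hi t') (hi t)"
    using lad_ex_right[OF assms(2,1), of F'] assms(4) by (auto simp: inverse_mor_def)
  have "G' \<cdot>\<^sub>K G = Idt K (hi t)"
    by (rule lad_fun_right[OF assms(1,1) lad_cmp[OF assms(3) G(1)]])
      (use assms(4) lad_idt[OF assms(1)] in \<open>simp add: inverse_mor_def del: stab_simps\<close>)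
  moreover have "G \<cdot>\<^sub>K G' = Idt K (hi t')"
    by (rule lad_fun_right[OF assms(2,2) lad_cmp[OF G(1) assms(3)]])
      (use assms(4) lad_idt[OF assms(2)] in \<open>simp add: inverse_mor_def del: stab_simps\<close>)
  ultimately show thesis
    using that G lad_hom[OF assms(1-3)] unfolding inverse_mor_def by blast
qed

text \<open>The fixed left triangle of \<open>A\<close>, read as a right triangle from its loop object to \<open>A\<close>.\<close>

definition cotri_at :: "'o \<Rightarrow> 'm seq" where
  "cotri_at A = (tp S A, ti S A, \<ominus> \<psi> A (tU S A) (tq S A))"

lemma cofixed_at:
  assumes "A \<in> \<C>"
  shows "(tq S A, tp S A, ti S A) \<in> L" "mor (ti S A)" "mor (tp S A)" "tq S A \<in> Hom \<A> (fob \<Omega> A) (tU S A)"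
    "dm (tp S A) = tU S A" "cd (tp S A) = tX S A" "dm (ti S A) = tX S A" "cd (ti S A) = A"
    "tX S A \<in> \<X>" "tU S A \<in> \<C>" "xmonic (tp S A)" "xepic (ti S A)"
proof -
  interpret d: right_fixed "opp \<A>" \<Omega> "rev_seq ` L" \<C> \<X> S by (rule left_fixed)
  note F = d.fixed_at[OF assms, unfolded opp_calculus[OF d.additive_category_axioms] xmonic_opp]
  show "(tq S A, tp S A, ti S A) \<in> L" "mor (ti S A)" "mor (tp S A)" "tq S A \<in> Hom \<A> (fob \<Omega> A) (tU S A)"
    "dm (tp S A) = tU S A" "cd (tp S A) = tX S A" "dm (ti S A) = tX S A" "cd (ti S A) = A"
    "tX S A \<in> \<X>" "tU S A \<in> \<C>" "xepic (ti S A)"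
    using F dm_Ob[OF F(5)] cd_Ob[OF F(5)] by (simp_all add: hom_iff)
  show "xmonic (tp S A)"
    using iota_preenvelope[OF assms] by (simp add: X_preenvelope_def X_monic_iff)
qed

lemma good_fixed [simp]: "A \<in> \<C> \<Longrightarrow> good (tri_at T A)"
  using fixed_at[of A] p_precover[of A] unfolding good_def tri_at_def
  by (auto simp: X_precover_def X_epic_iff)

lemma good_cofixed [simp]:
  assumes "A \<in> \<C>" shows "good (cotri_at A)"
proof -
  note F = cofixed_at[OF assms]
  have "(tp S A, ti S A, \<ominus> (\<psi> A (tU S A) (tq S A))) \<in> R"
    by (rule left_to_right[OF F(1) X_in_C[OF F(9)] assms F(4)]) (use F assms in \<open>simp_all add: hom_iff\<close>)
  then show ?thesis using F unfolding good_def cotri_at_def by simp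
qed

lemma fixed_ends [simp]:
  "A \<in> \<C> \<Longrightarrow> lo (tri_at T A) = A" "A \<in> \<C> \<Longrightarrow> hi (tri_at T A) = tU T A"
  "A \<in> \<C> \<Longrightarrow> lo (cotri_at A) = tU S A" "A \<in> \<C> \<Longrightarrow> hi (cotri_at A) = A"
  using fixed_at[of A] cofixed_at[of A] by (simp_all add: lo_def hi_def tri_at_def cotri_at_def)

lemma loop_ob [simp]: "A \<in> \<C> \<Longrightarrow> tU S A \<in> \<C>" and susp_ob [simp]: "A \<in> \<C> \<Longrightarrow> tU T A \<in> \<C>"
  using fixed_at(13) cofixed_at(10) by auto

abbreviation Lp where "Lp \<equiv> loop \<A> \<Omega> \<C> \<X> S"

lemma Lp_ob [simp]: "fob Lp = tU S"
  by (simp add: loop_def susp_def)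

lemma Lp_additive: "additive_functor K Lp"
proof -
  interpret d: right_fixed "opp \<A>" \<Omega> "rev_seq ` L" \<C> \<X> S by (rule left_fixed)
  show ?thesis using d.susp_additive unfolding loop_def stab_opp by simp
qed

lemma lad_susp:
  assumes "F \<in> Hom K A B" shows "lad (tri_at T A) (tri_at T B) F (fmor Sg F)"
proof -
  obtain f where f: "mor f" "dm f = A" "cd f = B" "F = cl f" "A \<in> \<C>" "B \<in> \<C>" using stab_homE[OF assms] .
  obtain \<sigma> \<kappa> where "smor (tri_at T A) (tri_at T B) f \<sigma> \<kappa>" "fmor Sg (cl f) = cl \<kappa>"
    using fixed_mor_exists[of f] f by metis
  then show ?thesis using ladI f(4) by metis
qed

text \<open>The loop functor is computed from morphisms of left triangles in the opposite category.
  A ladder becomes such a morphism by \<open>mor_dual\<close>, where \<open>unadj\<close> undoes the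
  sign and the adjunction in \<open>cotri_at\<close>.\<close>

lemma lad_loop:
  assumes "G \<in> Hom K A B" shows "lad (cotri_at A) (cotri_at B) (fmor Lp G) G"
proof -
  have AB: "A \<in> \<C>" "B \<in> \<C>" using assms stab_homE by blast+
  interpret d: right_fixed "opp \<A>" \<Omega> "rev_seq ` L" \<C> \<X> S by (rule left_fixed)
  obtain F where F: "lad (cotri_at A) (cotri_at B) F G"
    using lad_ex_left[of "cotri_at A" "cotri_at B" G] AB assms by auto
  then obtain f \<beta> g where l: "F = cl f" "G = cl g" "smor (cotri_at A) (cotri_at B) f \<beta> g"
    unfolding lad_def by blast
  note A = cofixed_at[OF AB(1)] and B = cofixed_at[OF AB(2)]
  have pA: "\<psi> A (tU S A) (tq S A) \<in> Hom \<A> A (fob \<Sigma> (tU S A))" "\<psi> B (tU S B) (tq S B) \<in> Hom \<A> B (fob \<Sigma> (tU S B))"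
    using adj_props(3) A B AB by auto
  have u: "unadj (tp S A) (ti S A) (\<ominus> \<psi> A (tU S A) (tq S A)) = tq S A"
    "unadj (tp S B) (ti S B) (\<ominus> \<psi> B (tU S B) (tq S B)) = tq S B"
    using unadj_neg_psi[of "tq S A" "ti S A" "tp S A"] unadj_neg_psi[of "tq S B" "ti S B" "tp S B"] A B by auto
  have "right_seq_mor (opp \<A>) \<Omega> (ti S B, tp S B, tq S B) (ti S A, tp S A, tq S A) g \<beta> f"
    using l(3) mor_dual[of "tp S A" "ti S A" "\<ominus> \<psi> A (tU S A) (tq S A)" "tp S B" "ti S B" "\<ominus> \<psi> B (tU S B) (tq S B)" f \<beta> g]
      A B pA unfolding cotri_at_def u by (simp add: hom_iff)
  then have "fmor Lp (cl g) = cl f"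
    using d.susp_eq[OF AB(2,1), of g \<beta> f] unfolding loop_def tri_at_def stab_class_opp by simp
  then show ?thesis using F l by simp
qed

text \<open>The sign makes the unit and counit compatible with both classes of triangles.\<close>

definition phi :: "'o \<Rightarrow> 'o \<Rightarrow> 'm set \<Rightarrow> 'm set" where
  "phi C A G = -\<^sub>K (THE F. lad (tri_at T C) (cotri_at A) F G)"

lemma phi_eqI:
  assumes "C \<in> \<C>" "A \<in> \<C>" "lad (tri_at T C) (cotri_at A) F G" shows "phi C A G = -\<^sub>K F"
proof -
  have "(THE F. lad (tri_at T C) (cotri_at A) F G) = F"
    by (rule the_equality[where P = "\<lambda>F. lad (tri_at T C) (cotri_at A) F G", OF assms(3)])
      (rule lad_fun_left[OF good_fixed[OF assms(1)] good_cofixed[OF assms(2)] _ assms(3)])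
  then show ?thesis by (simp add: phi_def)
qed

lemma phi_lad:
  assumes "C \<in> \<C>" "A \<in> \<C>" "G \<in> Hom K (tU T C) A"
  shows "lad (tri_at T C) (cotri_at A) (-\<^sub>K (phi C A G)) G" "phi C A G \<in> Hom K C (tU S A)"
proof -
  interpret K: additive_category K by (rule stab_additive)
  obtain F where F: "lad (tri_at T C) (cotri_at A) F G" "F \<in> Hom K C (tU S A)"
    using lad_ex_left[of "tri_at T C" "cotri_at A" G] assms by auto
  show "lad (tri_at T C) (cotri_at A) (-\<^sub>K (phi C A G)) G" "phi C A G \<in> Hom K C (tU S A)"
    unfolding phi_eqI[OF assms(1,2) F(1)] using F by (simp_all add: K.hom_iff)
qed

text \<open>Bijectivity is existence and uniqueness of ladders in both directions. Naturality
  composes three ladders: that of the suspension, the one defining \<open>phi\<close>, and that of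
  the loop.\<close>

lemma phi_adjoint: "adjoint_pair K Sg Lp phi"
proof -
  interpret K: additive_category K by (rule stab_additive)
  have bij: "bij_betw (phi C A) (Hom K (tU T C) A) (Hom K C (tU S A))" if CA: "C \<in> \<C>" "A \<in> \<C>" for C A
  proof (rule bij_betw_imageI)
    show "inj_on (phi C A) (Hom K (tU T C) A)"
    proof (rule inj_onI)
      fix G G' assume "G \<in> Hom K (tU T C) A" "G' \<in> Hom K (tU T C) A" "phi C A G = phi C A G'"
      then show "G = G'"
        using phi_lad(1)[OF CA] lad_fun_right[OF good_fixed good_cofixed] CA by metis
    qed
    have "F \<in> phi C A ` Hom K (tU T C) A" if F: "F \<in> Hom K C (tU S A)" for F
    proof -
      have "-\<^sub>K F \<in> Hom K C (tU S A)" using F by (simp add: K.hom_iff)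
      then obtain G where "lad (tri_at T C) (cotri_at A) (-\<^sub>K F) G" "G \<in> Hom K (tU T C) A"
        using lad_ex_right[of "tri_at T C" "cotri_at A" "-\<^sub>K F"] CA by auto
      then show ?thesis using phi_eqI[OF CA] F by (intro image_eqI[of _ _ G]) (auto simp: K.hom_iff)
    qed
    then show "phi C A ` Hom K (tU T C) A = Hom K C (tU S A)" using phi_lad(2)[OF CA] by blast
  qed
  have nat: "phi C' A' (a \<cdot>\<^sub>K u \<cdot>\<^sub>K fmor Sg c) = fmor Lp a \<cdot>\<^sub>K phi C A u \<cdot>\<^sub>K c"
    if c: "c \<in> Hom K C' C" and a: "a \<in> Hom K A A'" and u: "u \<in> Hom K (tU T C) A" for C C' A A' c a u
  proof -
    have ob: "C \<in> \<C>" "C' \<in> \<C>" "A \<in> \<C>" "A' \<in> \<C>" using c a stab_homE by blast+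
    note S = K.additive_functorD[OF susp_additive] and P = K.additive_functorD[OF Lp_additive]
    note p = phi_lad[OF ob(1,3) u]
    have "lad (tri_at T C') (cotri_at A') (fmor Lp a \<cdot>\<^sub>K ((-\<^sub>K (phi C A u)) \<cdot>\<^sub>K c)) (a \<cdot>\<^sub>K (u \<cdot>\<^sub>K fmor Sg c))"
      using lad_cmp[OF lad_cmp[OF lad_susp[OF c] p(1)] lad_loop[OF a]] .
    moreover have "a \<cdot>\<^sub>K (u \<cdot>\<^sub>K fmor Sg c) = a \<cdot>\<^sub>K u \<cdot>\<^sub>K fmor Sg c"
      using a u c S by (simp add: K.hom_iff)
    ultimately have "phi C' A' (a \<cdot>\<^sub>K u \<cdot>\<^sub>K fmor Sg c) = -\<^sub>K (fmor Lp a \<cdot>\<^sub>K ((-\<^sub>K (phi C A u)) \<cdot>\<^sub>K c))"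
      using phi_eqI[OF ob(2,4)] by metis
    also have "\<dots> = fmor Lp a \<cdot>\<^sub>K phi C A u \<cdot>\<^sub>K c"
      using a c p(2) P by (simp add: K.hom_iff)
    finally show ?thesis .
  qed
  show ?thesis
    unfolding adjoint_pair_def using susp_additive Lp_additive bij nat by auto
qed

abbreviation unit where "unit \<equiv> adj_unit K Sg phi"
abbreviation counit where "counit \<equiv> adj_counit K Sg Lp phi"

lemma unit_lad:
  assumes "A \<in> \<C>"
  shows "lad (tri_at T A) (cotri_at (tU T A)) (-\<^sub>K (unit A)) (Idt K (tU T A))" "unit A \<in> Hom K A (tU S (tU T A))"
  using phi_lad[OF assms susp_ob[OF assms], of "Idt K (tU T A)"] assms
    additive_category.id_hom[OF stab_additive, of "tU T A"]
  by (simp_all add: adj_unit_def)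

lemma counit_lad:
  assumes "A \<in> \<C>"
  shows "lad (tri_at T (tU S A)) (cotri_at A) (-\<^sub>K (Idt K (tU S A))) (counit A)" "counit A \<in> Hom K (tU T (tU S A)) A"
proof -
  interpret K: additive_category K by (rule stab_additive)
  have i: "Idt K (tU S A) \<in> Hom K (tU S A) (tU S A)" using K.id_hom assms by simp
  have c: "counit A \<in> Hom K (tU T (tU S A)) A" "phi (tU S A) A (counit A) = Idt K (tU S A)"
    using adj_inv_props(1,2)[OF phi_adjoint, of "tU S A" A "Idt K (tU S A)"] i assms
    by (simp_all add: adj_counit_def del: stab_simps(2))
  from phi_lad(1)[OF loop_ob[OF assms] assms c(1)] c
  show "lad (tri_at T (tU S A)) (cotri_at A) (-\<^sub>K (Idt K (tU S A))) (counit A)" "counit A \<in> Hom K (tU T (tU S A)) A"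
    by simp_all
qed

text \<open>Besides invertibility, the ladder of the inverse is recorded, which lies over
  \<open>- 1\<close>; in this form the unit enters the comparison of triangles.\<close>

lemma unit_inverse:
  assumes "A \<in> \<C>"
  obtains e where "inverse_mor K A (tU S (tU T A)) (unit A) e"
    "lad (cotri_at (tU T A)) (tri_at T A) e (-\<^sub>K (Idt K (tU T A)))"
proof -
  interpret K: additive_category K by (rule stab_additive)
  have U: "tU T A \<in> Ob K" using assms by simp
  obtain e where e: "lad (cotri_at (tU T A)) (tri_at T A) e (Idt K (tU T A))"
     "inverse_mor K A (tU S (tU T A)) (-\<^sub>K (unit A)) e"
    using lad_inverse[OF _ _ unit_lad(1)[OF assms], of "Idt K (tU T A)"] assms K.inverse_mor_idt[OF U]
    by (auto simp del: stab_simps(2))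
  show thesis
  proof (rule that)
    show "inverse_mor K A (tU S (tU T A)) (unit A) (-\<^sub>K e)"
      using K.inverse_mor_neg[OF e(2)] unit_lad(2)[OF assms] by (simp add: K.hom_iff)
    show "lad (cotri_at (tU T A)) (tri_at T A) (-\<^sub>K e) (-\<^sub>K (Idt K (tU T A)))"
      by (rule lad_neg[OF e(1)])
  qed
qed

lemma counit_inverse:
  assumes "A \<in> \<C>"
  obtains e where "inverse_mor K (tU T (tU S A)) A (counit A) e"
    "lad (cotri_at A) (tri_at T (tU S A)) (-\<^sub>K (Idt K (tU S A))) e"
proof -
  interpret K: additive_category K by (rule stab_additive)
  have U: "tU S A \<in> Ob K" using assms by simp
  show thesis
    using lad_inverse_hi[OF _ _ counit_lad(1)[OF assms], of "-\<^sub>K (Idt K (tU S A))"] that assms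
      K.inverse_mor_neg[OF K.inverse_mor_idt[OF U]]
    by (auto simp del: stab_simps(2))
qed

text \<open>Up to the common sign, both sides complete the same ladder over
  \<open>fmor Sg f\<close>.\<close>

lemma unit_natural:
  assumes "f \<in> Hom K A B" shows "unit B \<cdot>\<^sub>K f = fmor Lp (fmor Sg f) \<cdot>\<^sub>K unit A"
proof -
  interpret K: additive_category K by (rule stab_additive)
  have ob: "A \<in> \<C>" "B \<in> \<C>" using assms stab_homE by blast+
  note S = K.additive_functorD[OF susp_additive] and P = K.additive_functorD[OF Lp_additive]
  have Sf: "fmor Sg f \<in> Hom K (tU T A) (tU T B)" using assms S by (simp add: K.hom_iff)
  note u = unit_lad[OF ob(1)] unit_lad[OF ob(2)]
  have e: "Idt K (tU T B) \<cdot>\<^sub>K fmor Sg f = fmor Sg f" "fmor Sg f \<cdot>\<^sub>K Idt K (tU T A) = fmor Sg f"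
    using K.cmp_id[OF Sf] by auto
  have "(-\<^sub>K (unit B)) \<cdot>\<^sub>K f = fmor Lp (fmor Sg f) \<cdot>\<^sub>K (-\<^sub>K (unit A))"
    using lad_fun_left[OF good_fixed[OF ob(1)] good_cofixed[OF susp_ob[OF ob(2)]]
      lad_cmp[OF lad_susp[OF assms] u(3), unfolded e] lad_cmp[OF u(1) lad_loop[OF Sf], unfolded e]] .
  then show ?thesis using assms Sf u(2,4) P by (simp add: K.hom_iff)
qed

lemma counit_natural:
  assumes "f \<in> Hom K A B" shows "counit B \<cdot>\<^sub>K fmor Sg (fmor Lp f) = f \<cdot>\<^sub>K counit A"
proof -
  interpret K: additive_category K by (rule stab_additive)
  have ob: "A \<in> \<C>" "B \<in> \<C>" using assms stab_homE by blast+
  note S = K.additive_functorD[OF susp_additive] and P = K.additive_functorD[OF Lp_additive]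
  have Lf: "fmor Lp f \<in> Hom K (tU S A) (tU S B)" using assms P by (simp add: K.hom_iff)
  note u = counit_lad[OF ob(1)] counit_lad[OF ob(2)]
  have e: "(-\<^sub>K (Idt K (tU S B))) \<cdot>\<^sub>K fmor Lp f = fmor Lp f \<cdot>\<^sub>K (-\<^sub>K (Idt K (tU S A)))"
    using K.idt_cmp K.idt_mor Lf ob by (simp add: K.hom_iff del: stab_simps(2))
  show ?thesis
    using lad_fun_right[OF good_fixed[OF loop_ob[OF ob(1)]] good_cofixed[OF ob(2)]
      lad_cmp[OF lad_susp[OF Lf] u(3), unfolded e] lad_cmp[OF u(1) lad_loop[OF assms]]] .
qed

lemma phi_adjoint_equivalence: "adjoint_equivalence K Sg Lp phi"
  unfolding adjoint_equivalence_def nat_iso_def comp_fun_def id_fun_def iso_mor_def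
  using phi_adjoint unit_natural counit_natural by (auto elim: unit_inverse counit_inverse)

lemma Sg_autoequivalence: "autoequivalence K Sg"
  using phi_adjoint_equivalence Lp_additive susp_additive
  unfolding autoequivalence_def adjoint_equivalence_def by blast

text \<open>The left side of a ladder over \<open>c\<close> between fixed triangles is a
  preimage.\<close>

lemma susp_full:
  assumes "A \<in> \<C>" "B \<in> \<C>" "c \<in> Hom K (tU T A) (tU T B)" shows "\<exists>c0\<in>Hom K A B. fmor Sg c0 = c"
proof -
  obtain F where F: "lad (tri_at T A) (tri_at T B) F c" "F \<in> Hom K A B"
    using lad_ex_left[of "tri_at T A" "tri_at T B" c] assms by auto
  then show ?thesis
    using lad_fun_right[OF good_fixed[OF assms(1)] good_fixed[OF assms(2)] F(1) lad_susp[OF F(2)]] by blast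
qed

lemma susp_faithful:
  assumes "u \<in> Hom K A B" "v \<in> Hom K A B" "fmor Sg u = fmor Sg v" shows "u = v"
proof -
  have ob: "A \<in> \<C>" "B \<in> \<C>" using assms stab_homE by blast+
  show ?thesis
    using lad_fun_left[OF good_fixed[OF ob(1)] good_fixed[OF ob(2)] lad_susp[OF assms(1)], of v]
      lad_susp[OF assms(2)] assms(3) by simp
qed

lemma Tri_triangulated: "triangulated_category K Sg Tri"
  by (rule standard_triangles.triangulated[OF standard_triangles_K Sg_autoequivalence])
    (use susp_full susp_faithful in auto)

end

section \<open>Comparison of the two triangulations\<close>

context partial_triangulated
begin

text \<open>For \<open>x\<close> from an object of \<open>\<X>\<close>, \<open>s \<cdot> x\<close>
  lifts to \<open>y\<close> along the precover \<open>tp T A\<close>. The correction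
  \<open>x - k \<cdot> i1 \<cdot> y\<close> is killed by \<open>s\<close>, so it lifts along the
  weak kernel \<open>- k \<cdot> i2\<close> of \<open>s\<close>. Together the two lifts give one of
  \<open>x\<close> along \<open>k\<close>.\<close>

lemma rotation_xepic:
  assumes "A \<in> \<C>" "mor k" "dm k = Q" "mor s" "dm s = cd k" "biproduct \<A> (tX T A) B Q i1 i2 p1 p2"
    "s \<cdot> k = tp T A \<cdot> p1" "standard (\<ominus> (k \<cdot> i2)) s h \<xi>"
  shows "xepic k"
  unfolding xepic_def
proof (intro conjI allI impI)
  note F = fixed_at[OF assms(1)] and b = biproductD[OF assms(6)] and st = standard_hom[OF assms(8)]
  have k2: "dm (\<ominus> (k \<cdot> i2)) = B" "cd (\<ominus> (k \<cdot> i2)) = cd k" using b assms(2,3) by simp_all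
  note st = st[unfolded k2]
  have p: "xepic (tp T A)" using p_precover[OF assms(1)] by (simp add: X_precover_def X_epic_iff)
  have sk: "cd s = tU T A"
    using arg_cong[OF assms(7), of cd] b F assms(2-5) by simp
  show "mor k" by fact
  fix x assume x: "mor x" "cd x = cd k" "dm x \<in> \<X>"
  obtain y where y: "mor y" "cd y = tX T A" "dm y = dm x" "tp T A \<cdot> y = s \<cdot> x"
    using xepicE[OF p, of "s \<cdot> x"] x assms(4,5) sk F by auto
  define z where "z = x \<oplus> (\<ominus> (k \<cdot> (i1 \<cdot> y)))"
  have z: "mor z" "dm z = dm x" "cd z = cd k" unfolding z_def using x y b assms(2,3) by simp_all
  have "s \<cdot> (k \<cdot> (i1 \<cdot> y)) = tp T A \<cdot> (p1 \<cdot> (i1 \<cdot> y))"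
    using cmp_eq_assoc[OF assms(7), of "i1 \<cdot> y"] b F assms(2-5) y by simp
  then have "s \<cdot> z = zmor (dm x) (tU T A)"
    unfolding z_def using x y b F assms(2-5) sk by (simp add: biproduct_cancel[OF assms(6)])
  then obtain w where w: "mor w" "dm w = dm x" "cd w = B" "\<ominus> (k \<cdot> i2) \<cdot> w = z"
    using weak_kernel[OF st(1), of z] st(8,9) z sk k2 by auto
  have "k \<cdot> (i1 \<cdot> y \<oplus> (\<ominus> (i2 \<cdot> w))) = k \<cdot> (i1 \<cdot> y) \<oplus> z"
    unfolding w(4)[symmetric] using w(1-3) y b assms(2,3) by simp
  also have "\<dots> = x" unfolding z_def using x y b assms(2,3) by (simp add: add_commute[of x])
  finally show "\<exists>w. mor w \<and> cd w = dm k \<and> dm w = dm x \<and> k \<cdot> w = x"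
    using w y b assms(3) by (intro exI[of _ "i1 \<cdot> y \<oplus> (\<ominus> (i2 \<cdot> w))"]) simp
qed

text \<open>Such a triangle is standard for both structures.\<close>

lemma Tri_monic_epic:
  assumes "t \<in> Tri"
  obtains f g h \<xi> where "standard f g h \<xi>" "xepic g" "right_seq_iso K Sg (cl f, cl g, cl \<xi>) t"
proof -
  interpret ST: standard_triangles K Sg D Tri by (rule standard_triangles_K)
  obtain f g h \<xi> where s: "standard f g h \<xi>" "right_seq_iso K Sg (cl f, cl g, cl \<xi>) t"
    using assms D_iff unfolding right_triangles_def by auto
  note ty = standard_hom[OF s(1)] and F = fixed_at[OF standard_hom(8)[OF s(1)]]
  obtain Q i1 i2 p1 p2 where Q: "biproduct \<A> (tX T (dm f)) (cd f) Q i1 i2 p1 p2"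
    using ex_biproduct[of "tX T (dm f)" "cd f"] ty F by auto
  note b = biproductD[OF Q]
  \<comment> \<open>The given representative need not have an \<open>\<X>\<close>-epic second
    morphism; the pair with the preenvelope does, because its triangle can be rotated.\<close>
  obtain k c s0 h' \<xi>' where k: "standard (i1 \<cdot> ti T (dm f) \<oplus> i2 \<cdot> f) k c s0" "s0 \<cdot> k = tp T (dm f) \<cdot> p1"
    "standard (\<ominus> (k \<cdot> i2)) s0 h' \<xi>'"
    using rotation_standard[OF ty(8,9,2) _ _ Q] by metis
  define f1 where "f1 = i1 \<cdot> ti T (dm f) \<oplus> i2 \<cdot> f"
  have f1: "mor f1" "dm f1 = dm f" "cd f1 = Q" unfolding f1_def using b F ty by simp_all
  note k1 = standard_hom[OF k(1)[folded f1_def], unfolded f1]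
  have x: "xepic k"
    using rotation_xepic[OF ty(8) _ _ _ _ Q k(2,3)] k1 by auto
  have hm: "cl f1 \<in> Hom K (dm f) Q" "cl f \<in> Hom K (dm f) (cd f)" "cl k \<in> Hom K Q (cd k)" "cl g \<in> Hom K (cd f) (cd g)"
    using k1 ty f1 by (auto intro!: stab_homI)
  note hm = hm[unfolded ST.hom_iff]
  have "p2 \<cdot> f1 = f" unfolding f1_def using b F ty by (simp add: biproduct_cancel[OF Q])
  then have e: "cl p2 \<cdot>\<^sub>K cl f1 = cl f \<cdot>\<^sub>K cl (idt (dm f))" using b f1 ty by simp
  have i: "inverse_mor K Q (cd f) (cl p2) (cl i2)"
    using K_split_inverse(1)[OF Q F(12) ty(9)] by (rule ST.inverse_mor_sym)
  obtain \<gamma> \<gamma>' where "right_seq_mor K Sg (cl f1, cl k, cl s0) (cl f, cl g, cl \<xi>) (cl (idt (dm f))) (cl p2) \<gamma>"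
    "inverse_mor K (cd k) (cd g) \<gamma> \<gamma>'"
    using ST.tri_iso_third[OF D_Tri[OF k(1)[folded f1_def]] D_Tri[OF s(1)], of "cl (idt (dm f))" "cl (idt (dm f))" "cl p2" "cl i2"]
      hm i e K_idt_inverse[OF ty(8)] by auto
  from ST.right_seq_isoI[OF this(1) K_idt_inverse[OF ty(8)] i this(2)]
  have "right_seq_iso K Sg (cl f1, cl k, cl s0) t" using ST.right_seq_iso_trans s(2) by blast
  then show thesis using that[OF k(1) x] unfolding f1_def by blast
qed

section \<open>From left triangles to right triangles and back\<close>

abbreviation Ltri where "Ltri \<equiv> left_triangles \<A> \<Omega> L \<C> \<X> S"

lemma cotri_mor:
  assumes "A \<in> \<C>" "mor f" "mor g" "mor h" "dm g = cd f" "dm h = cd g" "cd h = fob \<Sigma> (dm f)"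
  shows "smor (cotri_at A) (f, g, h) \<alpha> \<beta> \<gamma> \<longleftrightarrow>
    right_seq_mor (opp \<A>) \<Omega> (g, f, unadj f g h) (tri_at S A) \<gamma> \<beta> \<alpha>"
proof -
  note A = cofixed_at[OF assms(1)]
  have "\<psi> A (tU S A) (tq S A) \<in> Hom \<A> A (fob \<Sigma> (tU S A))"
    using adj_props(3) A assms(1) by auto
  moreover have "unadj (tp S A) (ti S A) (\<ominus> \<psi> A (tU S A) (tq S A)) = tq S A"
    using unadj_neg_psi[of "tq S A" "ti S A" "tp S A"] A by auto
  ultimately show ?thesis
    using mor_dual[of "tp S A" "ti S A" "\<ominus> \<psi> A (tU S A) (tq S A)" f g h \<alpha> \<beta> \<gamma>] A assms
    unfolding cotri_at_def tri_at_def by (simp add: hom_iff)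
qed

text \<open>As \<open>v\<close> is \<open>\<X>\<close>-monic, the left triangle also yields a
  standard right triangle \<open>(v, w, \<xi>')\<close>. A ladder determines \<open>\<xi>'\<close>
  as \<open>- \<Sigma> \<xi> \<cdot> e\<close>, so modulo the isomorphism \<open>e\<close> this
  triangle is the rotation of the wanted one; rotate back.\<close>

lemma left_standard_Tri:
  assumes "stable_category.xmonic (opp \<A>) \<X> w" "xmonic v"
    "(u, v, w) \<in> L" "u \<in> Hom \<A> (fob \<Omega> (cd w)) (dm v)" "mor v" "mor w" "cd v = dm w" "dm v \<in> \<C>" "dm w \<in> \<C>" "cd w \<in> \<C>"
    "right_seq_mor (opp \<A>) \<Omega> (w, v, u) (tri_at S (cd w)) (idt (cd w)) \<delta> \<xi>"
    "lad (cotri_at (cd w)) (tri_at T (tU S (cd w))) (-\<^sub>K (Idt K (tU S (cd w)))) e"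
  shows "(cl \<xi>, cl v, e \<cdot>\<^sub>K cl w) \<in> Tri"
proof -
  interpret K: shift_category K Sg by (rule K_shift)
  interpret TC: triangulated_category K Sg Tri by (rule Tri_triangulated)
  define C where "C = cd w"
  note wC = C_def[symmetric]
  note a = assms(3-12)[unfolded wC]
  define h where "h = \<ominus> (\<psi> C (dm v) u)"
  have Rh: "(v, w, h) \<in> R"
    unfolding h_def by (rule left_to_right[OF a(1,7) _ a(2)]) (use a wC in \<open>simp_all add: hom_iff\<close>)
  note hty = R_hom[OF Rh]
  have u: "unadj v w h = u" unfolding h_def wC using unadj_neg_psi[of u w v] a wC by (simp add: hom_iff)
  have m: "smor (cotri_at C) (v, w, h) \<xi> \<delta> (idt C)"
    using cotri_mor[OF a(8) hty(1-6), of \<xi> \<delta> "idt C"] a(9) unfolding u by simp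
  obtain \<xi>' where st: "standard v w h \<xi>'" using standard_ex[OF Rh a(6) _ assms(2)] a by auto
  note sty = standard_hom[OF st]
  obtain \<delta>' where "smor (v, w, h) (tri_at T (dm v)) (idt (dm v)) \<delta>' \<xi>'"
    using standard_mor[OF st] by metis
  from ladI[OF right_seq_mor_cmp[OF m this]]
  have l1: "lad (cotri_at C) (tri_at T (dm v)) (cl \<xi>) (cl \<xi>')"
    using m sty wC unfolding cotri_at_def right_seq_mor_iff by simp
  note g = good_cofixed[OF a(8)] good_fixed[OF a(6)]
  have x: "cl \<xi> \<in> Hom K (tU S C) (dm v)" using lad_hom(1)[OF g l1] a by simp
  have e: "e \<in> Hom K C (tU T (tU S C))" using lad_hom(2)[OF g(1) _ a(10)] a by simp
  have Sx: "fmor Sg (cl \<xi>) \<in> Hom K (tU T (tU S C)) (tU T (dm v))" using x by (simp add: K.hom_iff)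
  \<comment> \<open>A second ladder between the same triangles: that of \<open>e\<close>, over
    \<open>- 1\<close>, followed by the suspension ladder of \<open>cl \<xi>\<close>, with the sign
    removed. Uniqueness then computes \<open>cl \<xi>'\<close>.\<close>
  have "lad (cotri_at C) (tri_at T (dm v)) (-\<^sub>K (cl \<xi> \<cdot>\<^sub>K (-\<^sub>K (Idt K (tU S C))))) (-\<^sub>K (fmor Sg (cl \<xi>) \<cdot>\<^sub>K e))"
    by (rule lad_neg[OF lad_cmp[OF a(10) lad_susp[OF x]]])
  moreover have "-\<^sub>K (cl \<xi> \<cdot>\<^sub>K (-\<^sub>K (Idt K (tU S C)))) = cl \<xi>"
    using x K.idt_mor[of "tU S C"] by (simp add: K.hom_iff del: stab_simps(2))
  ultimately have x': "cl \<xi>' = -\<^sub>K (fmor Sg (cl \<xi>) \<cdot>\<^sub>K e)"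
    using lad_fun_right[OF g l1] by simp
  obtain e' where e': "inverse_mor K C (tU T (tU S C)) e e'"
    using lad_inverse_hi[OF g(1) _ a(10)] K.inverse_mor_neg[OF K.inverse_mor_idt[of "tU S C"]] a by (auto simp del: stab_simps(2))
  have hv: "cl v \<in> Hom K (dm v) (dm w)" "cl w \<in> Hom K (dm w) C" "cl \<xi>' \<in> Hom K C (tU T (dm v))"
    using sty wC by (auto intro!: stab_homI)
  have i: "Idt K (dm v) \<in> Hom K (dm v) (dm v)" "Idt K (dm w) \<in> Hom K (dm w) (dm w)"
    using K.id_hom a by simp_all
  note Ki = K.inverse_mor_idt[of "dm v"] K.inverse_mor_idt[of "dm w"]
  have rm: "right_seq_mor K Sg (cl v, cl w, cl \<xi>') (cl v, e \<cdot>\<^sub>K cl w, -\<^sub>K (fmor Sg (cl \<xi>)))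
     (Idt K (dm v)) (Idt K (dm w)) e"
    unfolding K.right_seq_mor_iff x' using hv(1,2) e Sx i by (simp add: K.hom_iff del: stab_simps(2))
  have "right_seq_iso K Sg (cl v, cl w, cl \<xi>') (cl v, e \<cdot>\<^sub>K cl w, -\<^sub>K (fmor Sg (cl \<xi>)))"
    by (rule K.right_seq_isoI[OF rm Ki e']) (use a in simp_all)
  then have "(cl v, e \<cdot>\<^sub>K cl w, -\<^sub>K (fmor Sg (cl \<xi>))) \<in> Tri"
    using TC.tri_iso D_Tri[OF st] by blast
  moreover have "right_seq K Sg (tU S C) (dm v) (dm w) (cl \<xi>, cl v, e \<cdot>\<^sub>K cl w)"
    unfolding right_seq_def using x hv e by (simp add: K.hom_iff)
  ultimately show ?thesis using TC.TR2 by blast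
qed

text \<open>In the opposite category the triangle is isomorphic to a standard one that has both an
  \<open>\<X>\<close>-monic and an \<open>\<X>\<close>-epic, where the previous lemma applies. The
  isomorphism is carried over with \<open>fmor Lp \<alpha>\<close> on the first object.\<close>

lemma left_to_Tri:
  assumes "(U, V, W) \<in> Ltri" "W \<in> Hom K B A"
    "lad (cotri_at A) (tri_at T (tU S A)) (-\<^sub>K (Idt K (tU S A))) e"
  shows "(U, V, e \<cdot>\<^sub>K W) \<in> Tri"
proof -
  interpret d: partial_triangulated "opp \<A>" \<Sigma> \<Omega> "rev_seq ` R" "rev_seq ` L" \<C> \<X> "opp_adj \<A> \<Omega> \<psi>" T S
    by (rule dual)
  interpret K: shift_category K Sg by (rule K_shift)
  interpret KL: shift_category K Lp by (intro shift_category.intro stab_additive shift_category_axioms.intro Lp_additive)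
  interpret TC: triangulated_category K Sg Tri by (rule Tri_triangulated)
  note c = opp_calculus[OF d.additive_category_axioms]
  have "(W, V, U) \<in> d.Tri" using assms(1) unfolding left_triangles_opp by simp
  then obtain w v u \<xi> where s: "d.standard w v u \<xi>" "d.xepic v" "right_seq_iso (stab (opp \<A>) \<C> \<X>) d.Sg (d.cl w, d.cl v, d.cl \<xi>) (W, V, U)"
    using d.Tri_monic_epic by blast
  note ty = d.standard_hom[OF s(1), unfolded c]
  note Rd = d.R_hom[OF ty(1), unfolded c]
  have v: "xmonic v" using s(2) unfolding d.xepic_def c xmonic_def opp_simps by blast
  obtain \<delta> where d: "right_seq_mor (opp \<A>) \<Omega> (w, v, u) (tri_at S (cd w)) (idt (cd w)) \<delta> \<xi>"
    using d.standard_mor[OF s(1)] unfolding c opp_simps by metis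
  define C where "C = cd w"
  note wC = C_def[symmetric]
  obtain e0 where e0: "lad (cotri_at C) (tri_at T (tU S C)) (-\<^sub>K (Idt K (tU S C))) e0"
    using counit_inverse[of C] ty wC by metis
  have t0: "(cl \<xi>, cl v, e0 \<cdot>\<^sub>K cl w) \<in> Tri"
    by (rule left_standard_Tri[OF ty(12) v, of u, folded C_def, OF _ _ _ _ _ _ _ _ d[folded C_def] e0])
      (use ty Rd(1-9) dm_Ob[OF Rd(3)] wC in \<open>auto simp: hom_iff\<close>)
  obtain \<alpha> \<beta> \<gamma> where m: "right_seq_mor (opp K) Lp (cl w, cl v, cl \<xi>) (W, V, U) \<alpha> \<beta> \<gamma>"
    and iso: "\<exists>A B. iso_mor K A B \<alpha>" "\<exists>A B. iso_mor K A B \<beta>" "\<exists>A B. iso_mor K A B \<gamma>"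
    using s(3) unfolding right_seq_iso_def stab_opp stab_class_opp loop_def iso_mor_opp by blast
  \<comment> \<open>Read in \<open>K\<close>, the isomorphism points from the given sequence to the
    standard one, with \<open>\<alpha>\<close> on the last objects.\<close>
  obtain A1 A' B1 B' C1 C' where h: "cl \<xi> \<in> Hom K (tU S C1) A1" "cl v \<in> Hom K A1 B1" "cl w \<in> Hom K B1 C1"
     "U \<in> Hom K (tU S C') A'" "V \<in> Hom K A' B'" "W \<in> Hom K B' C'" "\<gamma> \<in> Hom K A' A1" "\<beta> \<in> Hom K B' B1" "\<alpha> \<in> Hom K C' C1"
     "\<gamma> \<cdot>\<^sub>K U = cl \<xi> \<cdot>\<^sub>K fmor Lp \<alpha>" "\<beta> \<cdot>\<^sub>K V = cl v \<cdot>\<^sub>K \<gamma>" "\<alpha> \<cdot>\<^sub>K W = cl w \<cdot>\<^sub>K \<beta>"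
    using m unfolding left_mor_explicit Lp_ob by blast
  have C': "C' = A" using h(6) assms(2) K.hom_disjoint by blast
  have C1: "C1 = C" using h(3) K.hom_disjoint stab_homI[of w "dm w" "cd w"] ty wC by blast
  note h = h[unfolded C' C1]
  have ob: "A \<in> \<C>" "C \<in> \<C>" using h(9) stab_homE by blast+
  have La: "fmor Lp \<alpha> \<in> Hom K (tU S A) (tU S C)" using h(9) KL.shift_simps by (simp add: K.hom_iff)
  have e: "e \<in> Hom K A (tU T (tU S A))" "e0 \<in> Hom K C (tU T (tU S C))"
    using lad_hom(2)[OF good_cofixed[OF ob(1)] good_fixed[OF loop_ob[OF ob(1)]] assms(3)]
      lad_hom(2)[OF good_cofixed[OF ob(2)] good_fixed[OF loop_ob[OF ob(2)]] e0] ob by simp_all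
  \<comment> \<open>Naturality of \<open>e\<close> in the object, needed for the last square: two
    ladders share the side \<open>- fmor Lp \<alpha>\<close>.\<close>
  have "lad (cotri_at A) (tri_at T (tU S C)) (fmor Lp \<alpha> \<cdot>\<^sub>K (-\<^sub>K (Idt K (tU S A)))) (fmor Sg (fmor Lp \<alpha>) \<cdot>\<^sub>K e)"
    by (rule lad_cmp[OF assms(3) lad_susp[OF La]])
  moreover have "lad (cotri_at A) (tri_at T (tU S C)) ((-\<^sub>K (Idt K (tU S C))) \<cdot>\<^sub>K fmor Lp \<alpha>) (e0 \<cdot>\<^sub>K \<alpha>)"
    by (rule lad_cmp[OF lad_loop[OF h(9)] e0])
  moreover have "(-\<^sub>K (Idt K (tU S C))) \<cdot>\<^sub>K fmor Lp \<alpha> = fmor Lp \<alpha> \<cdot>\<^sub>K (-\<^sub>K (Idt K (tU S A)))"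
    using La K.idt_mor[of "tU S C"] K.idt_mor[of "tU S A"] ob by (simp add: K.hom_iff del: stab_simps(2))
  ultimately have ea: "fmor Sg (fmor Lp \<alpha>) \<cdot>\<^sub>K e = e0 \<cdot>\<^sub>K \<alpha>"
    using lad_fun_right[OF good_cofixed[OF ob(1)] good_fixed[OF loop_ob[OF ob(2)]]] by metis
  have rm: "right_seq_mor K Sg (U, V, e \<cdot>\<^sub>K W) (cl \<xi>, cl v, e0 \<cdot>\<^sub>K cl w) (fmor Lp \<alpha>) \<gamma> \<beta>"
  proof -
    have "fmor Sg (fmor Lp \<alpha>) \<cdot>\<^sub>K (e \<cdot>\<^sub>K W) = e0 \<cdot>\<^sub>K (cl w \<cdot>\<^sub>K \<beta>)"
      unfolding h(12)[symmetric] using La e h(6,9) by (simp add: K.hom_iff K.cmp_eq_assoc[OF ea])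
    then show ?thesis
      unfolding K.right_seq_mor_iff using h(1-9) La e h(10,11) by (simp add: K.hom_iff)
  qed
  obtain \<alpha>' \<beta>' \<gamma>' where inv: "inverse_mor K A C \<alpha> \<alpha>'" "inverse_mor K B' B1 \<beta> \<beta>'" "inverse_mor K A' A1 \<gamma> \<gamma>'"
    using iso h(7-9) K.hom_disjoint unfolding iso_mor_def inverse_mor_def by metis
  have "inverse_mor K (tU S A) (tU S C) (fmor Lp \<alpha>) (fmor Lp \<alpha>')"
    using KL.inverse_mor_shift[OF inv(1)] by simp
  from K.right_seq_iso_sym[OF K.right_seq_isoI[OF rm this inv(3,2)]]
  show ?thesis using TC.tri_iso[OF t0] by blast
qed

text \<open>From left to right, \<open>left_to_Tri\<close> is applied at the object
  \<open>tU T A\<close> and corrected by the isomorphism \<open>e0\<close> on the first object. The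
  converse is the same lemma in the opposite category, where the ladder of \<open>e0\<close> has
  exactly the required shape.\<close>

lemma Tri_iff_left:
  assumes "right_seq K Sg A B C (f, g, h)"
  shows "(f, g, h) \<in> Tri \<longleftrightarrow> (f \<cdot>\<^sub>K the_inverse K A (tU S (tU T A)) (unit A), g, h) \<in> Ltri"
proof -
  interpret K: shift_category K Sg by (rule K_shift)
  interpret TC: triangulated_category K Sg Tri by (rule Tri_triangulated)
  have hm: "f \<in> Hom K A B" "g \<in> Hom K B C" "h \<in> Hom K C (tU T A)"
    using assms by (auto simp: right_seq_def)
  then have ob: "A \<in> \<C>" "tU T A \<in> \<C>" using stab_homE by blast+
  obtain e0 where e0: "inverse_mor K A (tU S (tU T A)) (unit A) e0"
    "lad (cotri_at (tU T A)) (tri_at T A) e0 (-\<^sub>K (Idt K (tU T A)))" using unit_inverse[OF ob(1)] .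
  have te: "the_inverse K A (tU S (tU T A)) (unit A) = e0" using K.the_inverse_eq[OF e0(1)] .
  have e0h: "e0 \<in> Hom K (tU S (tU T A)) A" using e0(1) by (simp add: inverse_mor_def)
  show ?thesis unfolding te
  proof
    assume l: "(f \<cdot>\<^sub>K e0, g, h) \<in> Ltri"
    obtain e1 where e1: "inverse_mor K (tU T (tU S (tU T A))) (tU T A) (counit (tU T A)) e1"
      "lad (cotri_at (tU T A)) (tri_at T (tU S (tU T A))) (-\<^sub>K (Idt K (tU S (tU T A)))) e1"
      using counit_inverse[OF ob(2)] .
    have e1h: "e1 \<in> Hom K (tU T A) (tU T (tU S (tU T A)))" using e1(1) by (simp add: inverse_mor_def)
    have t: "(f \<cdot>\<^sub>K e0, g, e1 \<cdot>\<^sub>K h) \<in> Tri" by (rule left_to_Tri[OF l hm(3) e1(2)])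
    \<comment> \<open>A triangle identity, \<open>fmor Sg e0\<close> being a left inverse of
      \<open>e1\<close>, obtained from two ladders over \<open>- e0\<close>.\<close>
    have "lad (cotri_at (tU T A)) (tri_at T A) (e0 \<cdot>\<^sub>K (-\<^sub>K (Idt K (tU S (tU T A))))) (fmor Sg e0 \<cdot>\<^sub>K e1)"
      by (rule lad_cmp[OF e1(2) lad_susp[OF e0h]])
    moreover have "e0 \<cdot>\<^sub>K (-\<^sub>K (Idt K (tU S (tU T A)))) = -\<^sub>K e0"
      using e0h K.idt_mor[of "tU S (tU T A)"] ob by (simp add: K.hom_iff del: stab_simps(2))
    moreover have "lad (cotri_at (tU T A)) (tri_at T A) (-\<^sub>K e0) (Idt K (tU T A))"
      using lad_neg[OF e0(2)] K.neg_neg[of "Idt K (tU T A)"] K.idt_mor[of "tU T A"] ob by (simp del: stab_simps(2))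
    ultimately have s: "fmor Sg e0 \<cdot>\<^sub>K e1 = Idt K (tU T A)"
      using lad_fun_right[OF good_cofixed[OF ob(2)] good_fixed[OF ob(1)]] by metis
    have i: "Idt K B \<in> Hom K B B" "Idt K C \<in> Hom K C C" using K.id_hom hm(2) K.hom_ob by blast+
    have Se: "fmor Sg e0 \<in> Hom K (tU T (tU S (tU T A))) (tU T A)" using e0h by (simp add: K.hom_iff)
    have "right_seq_mor K Sg (f \<cdot>\<^sub>K e0, g, e1 \<cdot>\<^sub>K h) (f, g, h) e0 (Idt K B) (Idt K C)"
      unfolding K.right_seq_mor_iff using hm e0h e1h i Se K.cmp_eq_assoc[OF s, of h]
      by (simp add: K.hom_iff del: stab_simps(2))
    from K.right_seq_isoI[OF this K.inverse_mor_sym[OF e0(1)] K.inverse_mor_idt K.inverse_mor_idt]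
    show "(f, g, h) \<in> Tri" using TC.tri_iso[OF t] hm(2) K.hom_ob by blast
  next
    assume t: "(f, g, h) \<in> Tri"
    interpret d: partial_triangulated "opp \<A>" \<Sigma> \<Omega> "rev_seq ` R" "rev_seq ` L" \<C> \<X> "opp_adj \<A> \<Omega> \<psi>" T S
      by (rule dual)
    obtain x \<beta> y where xy: "e0 = cl x" "-\<^sub>K (Idt K (tU T A)) = cl y"
      "smor (cotri_at (tU T A)) (tri_at T A) x \<beta> y"
      using e0(2) unfolding lad_def by blast
    note F = fixed_at[OF ob(1)]
    \<comment> \<open>In the opposite category \<open>cotri_at\<close> is the fixed right triangle
      of \<open>A\<close>, and the ends of a ladder change places: \<open>- 1\<close> now stands on
      the left and \<open>e0\<close> on the right.\<close>
    have "right_seq_mor (opp \<A>) \<Omega> (d.cotri_at A) (tri_at S (tU T A)) y \<beta> x"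
      using xy(3) cotri_mor[OF ob(2) F(3-5), of x \<beta> y] F
      unfolding d.cotri_at_def tri_at_def[of T] opp_adj_def opp_simps by simp
    then have l: "d.lad (d.cotri_at A) (tri_at S (tU T A)) (-\<^sub>K (Idt K (tU T A))) e0"
      unfolding d.lad_def xy stab_class_opp by blast
    have "(h, g, f) \<in> d.Ltri" using t unfolding left_triangles_opp by simp
    from d.left_to_Tri[OF this, unfolded stab_opp opp_simps, OF hm(1) l]
    show "(f \<cdot>\<^sub>K e0, g, h) \<in> Ltri" unfolding left_triangles_opp by simp
  qed
qed

lemma stab_same_triangulation: "same_triangulation K Lp Ltri Sg Tri"
  unfolding same_triangulation_def using phi_adjoint_equivalence Tri_iff_left by auto

end

theorem theorem6p7:
  fixes \<A> :: "('o, 'm) acat"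
    and \<Omega> \<Sigma> :: "('o, 'm) endofun" and L R :: "'m seq set" and \<C> \<X> :: "'o set"
    and \<psi> :: "'o \<Rightarrow> 'o \<Rightarrow> 'm \<Rightarrow> 'm" and S T :: "('o, 'm) fixed_tri"
  assumes "partial_triangulated \<A> \<Omega> \<Sigma> L R \<C> \<X> \<psi> S T"
  shows "triangulated_category (stab \<A> \<C> \<X>)
           (susp \<A> \<Sigma> \<C> \<X> T) (right_triangles \<A> \<Sigma> R \<C> \<X> T) \<and>
         left_triangulated_category (stab \<A> \<C> \<X>)
           (loop \<A> \<Omega> \<C> \<X> S) (left_triangles \<A> \<Omega> L \<C> \<X> S) \<and>
         same_triangulation (stab \<A> \<C> \<X>)
           (loop \<A> \<Omega> \<C> \<X> S) (left_triangles \<A> \<Omega> L \<C> \<X> S)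
           (susp \<A> \<Sigma> \<C> \<X> T) (right_triangles \<A> \<Sigma> R \<C> \<X> T)"
proof -
  interpret partial_triangulated \<A> \<Omega> \<Sigma> L R \<C> \<X> \<psi> S T by fact
  show ?thesis
    using Tri_triangulated partial_triangulated.Tri_triangulated[OF dual] stab_same_triangulation
    by (simp add: left_triangulated_category_def left_triangles_opp stab_opp loop_def)
qed

end
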